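(* For all $n \geq 0$, $$p_{\xi}(16n+14) \equiv 0 \pmod{8},\qquad p_{\xi}(24n+13) \equiv 0 \pmod{8},\qquad p_{\xi}(24n+22) \equiv 0 \pmod{8}.$$
   Context: $(a;q)_n=(1-a)(1-aq)\cdots(1-aq^{n-1})$, $(a;q)_0=1$. The coefficients $p_\xi(n)$ are defined by $\sum_{n\ge0}p_\xi(n)q^n=\xi(q)=1+2\sum_{n\ge1}\frac{q^{6n^2-6n+1}}{(q;q^6)_n(q^5;q^6)_n}$. *)

theory Defs
  imports
    "HOL-Computational_Algebra.Formal_Power_Series"
    "HOL-Number_Theory.Cong"
begin

definition qpochhammer :: "'a::comm_ring_1 \<Rightarrow> 'a \<Rightarrow> nat \<Rightarrow> 'a" where
  "qpochhammer a q n = (\<Prod>k<n. 1 - a * q ^ k)"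

definition xi_denom :: "nat \<Rightarrow> int fps" where
  "xi_denom n = qpochhammer fps_X (fps_X ^ 6) n * qpochhammer (fps_X ^ 5) (fps_X ^ 6) n"

text \<open>Division of power series in the library needs coefficients in a field. The denominators
  have constant term 1, so \<open>fps_right_inverse _ 1\<close> is the two-sided inverse in \<open>int fps\<close>;
  see \<open>xi_term_mult_denom\<close>. The truncated subtraction is harmless, as \<open>6 * n \<le> 6 * n ^ 2\<close>.\<close>

definition xi_term :: "nat \<Rightarrow> int fps" where
  "xi_term n = fps_X ^ (6 * n ^ 2 - 6 * n + 1) * fps_right_inverse (xi_denom n) 1"

text \<open>The infinite sum is taken in the \<open>fps_X\<close>-adic topology; it converges by
  \<open>summable_xi_term\<close>. The shift by \<open>Suc\<close> makes it start at index 1.\<close>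

definition xi :: "int fps" where
  "xi = 1 + 2 * (\<Sum>n. xi_term (Suc n))"

definition p_xi :: "nat \<Rightarrow> int" where
  "p_xi n = fps_nth xi n"

lemma qpochhammer_fps_nth_0:
  fixes a q :: "'a::comm_ring_1 fps"
  assumes "fps_nth a 0 = 0"
  shows "fps_nth (qpochhammer a q n) 0 = 1"
  using assms by (induction n) (simp_all add: qpochhammer_def)

lemma xi_term_mult_denom:
  "xi_term n * xi_denom n = fps_X ^ (6 * n ^ 2 - 6 * n + 1)"
proof -
  have "fps_nth (xi_denom n) 0 = 1"
    by (simp add: xi_denom_def qpochhammer_fps_nth_0)
  then have "xi_denom n * fps_right_inverse (xi_denom n) 1 = 1"
    by (intro fps_right_inverse) simp
  then show ?thesis
    by (simp add: xi_term_def mult.assoc mult.commute[of _ "xi_denom n"])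
qed

lemma xi_term_nth_eq_0:
  assumes "k < n"
  shows "fps_nth (xi_term (Suc n)) k = 0"
proof -
  have "6 * Suc n ^ 2 - 6 * Suc n + 1 = 6 * (n * n) + 6 * n + 1"
    by (simp add: power2_eq_square algebra_simps)
  then have "k < 6 * Suc n ^ 2 - 6 * Suc n + 1"
    using assms by simp
  then show ?thesis
    unfolding xi_term_def fps_X_power_mult_nth by (rule if_P)
qed

lemma sums_xi_term:
  "(\<lambda>n. xi_term (Suc n)) sums Abs_fps (\<lambda>k. \<Sum>n\<le>k. fps_nth (xi_term (Suc n)) k)"
  unfolding sums_def
proof (rule tendsto_fpsI)
  fix k
  have "(\<Sum>n<N. fps_nth (xi_term (Suc n)) k) = (\<Sum>n\<le>k. fps_nth (xi_term (Suc n)) k)"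
    if "k < N" for N
    by (rule sum.mono_neutral_right) (use that xi_term_nth_eq_0 in auto)
  then show "\<forall>\<^sub>F N in sequentially. fps_nth (\<Sum>n<N. xi_term (Suc n)) k =
      fps_nth (Abs_fps (\<lambda>k. \<Sum>n\<le>k. fps_nth (xi_term (Suc n)) k)) k"
    by (intro eventually_mono[OF eventually_gt_at_top[of k]]) (simp add: fps_sum_nth)
qed

lemma summable_xi_term: "summable (\<lambda>n. xi_term (Suc n))"
  using sums_xi_term by (rule sums_summable)

end

theory Submission
  imports Defs "HOL-Computational_Algebra.Polynomial_Factorial"
begin

unbundle fps_syntax

text \<open>
  Write \<open>\<xi> = 1 + 2 g\<close> and \<open>E\<^sub>k = (q\<^sup>k; q\<^sup>k)\<^sub>\<infinity>\<close>, \<open>K = (q, q\<^sup>5; q\<^sup>6)\<^sub>\<infinity>\<close>, \<open>T = \<Sum> q^(3n\<^sup>2 + 2n)\<close> (sum over the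
  integers). Partial fractions for the terms of \<open>g\<close>, combined with a finite form of Cauchy's identity,
  turn \<open>g\<close> into an Appell sum divided by \<open>E\<^sub>6\<close>. Expanding the geometric series in this sum shows that two
  residue classes of the coefficients are free of the mock part: the coefficients of index \<open>3n + 1\<close> have
  generating function \<open>E\<^sub>6\<^sup>2 / (E\<^sub>2 K)\<close>, and those of index \<open>4n + 2\<close> have generating function
  \<open>E\<^sub>6\<^sup>2 T / (E\<^sub>3\<^sup>2 K)\<close>. Both evaluations are limits of finite partial fraction expansions; in the second
  case the expansion has poles at a set of nodes and at their negatives, which symmetrises the Appell sum
  under \<open>q \<mapsto> -q\<close>. It remains to show that some coefficients of these quotients are divisible by 4. Since
  \<open>f(q)\<^sup>4 \<equiv> f(q\<^sup>2)\<^sup>2\<close> modulo 4, each quotient is congruent to a product of theta functions, whose parity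
  dissections are read off from the exponents; what is left are congruences modulo 2 between eta quotients.
\<close>

subsection \<open>Convergence of formal power series\<close>

text \<open>The three progressions lie in the two mock-free classes: 24n+13 = 3(8n+4)+1, 24n+22 =
  3(8n+7)+1, 16n+14 = 4(4n+3)+2. The factor 2 in \<open>xi\<close> reduces modulus 8 to modulus 4
  for \<open>g_xi\<close>. With C = \<open>Suc k choose 2\<close>, the Appell sum has numerators of
  quadratic exponent 18C over 1 - q^(6k+1) and 1 - q^(6k+5). Both ratios are prime to 3, so
  selecting exponents 1 modulo 3 keeps the denominators and turns 18C into 6C, the exponent in the
  expansion of a reciprocal theta product with base q^6. Selecting even exponents gives only 9C,
  which is still mock; hence the second halving and the second expansion. Bilateral series are
  avoided: the summands of index k and -k-1 (or j and -j) are merged, and a series x' with x * x' =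
  q stands for q / x, so that no negative powers enter the power series. The finite identities hold
  over a field; they are applied in the fraction field of the power series ring, pulled back, and
  only then passed to the limit. Modulo 4 parity information suffices at the end because the odd
  part of \<open>phi\<close> carries a factor 2, so its cofactor matters only modulo 2.\<close>

lemma fps_tendsto_mult:
  fixes f g :: "'b \<Rightarrow> 'a::comm_ring_1 fps"
  assumes "(f \<longlongrightarrow> a) F" and "(g \<longlongrightarrow> b) F"
  shows "((\<lambda>n. f n * g n) \<longlongrightarrow> a * b) F"
proof (rule tendsto_fpsI)
  fix k
  have f: "\<forall>\<^sub>F n in F. \<forall>i\<in>{0..k}. f n $ i = a $ i"
    and g: "\<forall>\<^sub>F n in F. \<forall>i\<in>{0..k}. g n $ i = b $ i"
    using assms by (auto simp: tendsto_fps_iff eventually_ball_finite_distrib)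
  show "\<forall>\<^sub>F n in F. (f n * g n) $ k = (a * b) $ k"
    using f g by eventually_elim (auto simp: fps_mult_nth intro!: sum.cong)
qed

lemma fps_tendsto_add:
  fixes f g :: "'b \<Rightarrow> 'a::comm_ring_1 fps"
  assumes "(f \<longlongrightarrow> a) F" and "(g \<longlongrightarrow> b) F"
  shows "((\<lambda>n. f n + g n) \<longlongrightarrow> a + b) F"
  using assms unfolding tendsto_fps_iff
proof (intro allI)
  fix k
  assume "\<forall>n. \<forall>\<^sub>F x in F. f x $ n = a $ n" "\<forall>n. \<forall>\<^sub>F x in F. g x $ n = b $ n"
  then have "\<forall>\<^sub>F x in F. f x $ k = a $ k" "\<forall>\<^sub>F x in F. g x $ k = b $ k" by auto
  then show "\<forall>\<^sub>F x in F. (f x + g x) $ k = (a + b) $ k"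
    by eventually_elim simp
qed

lemma fps_tendsto_compose:
  fixes f :: "'b \<Rightarrow> 'a::comm_ring_1 fps"
  assumes "(f \<longlongrightarrow> a) F"
  shows "((\<lambda>n. f n oo c) \<longlongrightarrow> (a oo c)) F"
proof (rule tendsto_fpsI)
  fix k
  have "\<forall>\<^sub>F n in F. \<forall>i\<in>{0..k}. f n $ i = a $ i"
    using assms by (auto simp: tendsto_fps_iff eventually_ball_finite_distrib)
  then show "\<forall>\<^sub>F n in F. (f n oo c) $ k = (a oo c) $ k"
    by eventually_elim (auto simp: fps_compose_nth intro!: sum.cong)
qed

lemma fps_sums_mult_left:
  fixes f :: "nat \<Rightarrow> 'a::comm_ring_1 fps"
  assumes "f sums s"
  shows "(\<lambda>n. c * f n) sums (c * s)"
  using assms fps_tendsto_mult[of "\<lambda>_. c" c]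
  unfolding sums_def by (simp add: sum_distrib_left[symmetric])

lemma fps_sums_compose:
  fixes f :: "nat \<Rightarrow> 'a::comm_ring_1 fps"
  assumes "f sums s"
  shows "(\<lambda>n. f n oo c) sums (s oo c)"
  using fps_tendsto_compose[of _ s sequentially c] assms
  unfolding sums_def by (simp add: fps_compose_sum_distrib[symmetric])

lemma fps_summableI:
  fixes b :: "nat \<Rightarrow> 'a::comm_ring_1 fps"
  assumes "\<And>k i. i < k \<Longrightarrow> b k $ i = 0"
  shows "summable b"
proof -
  have "b sums Abs_fps (\<lambda>i. \<Sum>k\<le>i. b k $ i)"
    unfolding sums_def
  proof (rule tendsto_fpsI)
    fix i
    show "\<forall>\<^sub>F n in sequentially. (\<Sum>k<n. b k) $ i = Abs_fps (\<lambda>i. \<Sum>k\<le>i. b k $ i) $ i"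
      using eventually_gt_at_top[of i]
    proof eventually_elim
      case (elim n)
      have "(\<Sum>k<n. b k $ i) = (\<Sum>k\<le>i. b k $ i)"
        by (rule sum.mono_neutral_right) (use elim assms in auto)
      then show ?case by (simp add: fps_sum_nth)
    qed
  qed
  then show ?thesis by (rule sums_summable)
qed

text \<open>Tannery's theorem, with the summable bound on the terms replaced by a bound on their order.\<close>

lemma fps_tannery:
  fixes a :: "nat \<Rightarrow> nat \<Rightarrow> 'a::comm_ring_1 fps"
  assumes lim: "\<And>k. (\<lambda>n. a n k) \<longlonglongrightarrow> b k"
    and dom: "\<And>n k i. i < k \<Longrightarrow> k \<le> n \<Longrightarrow> a n k $ i = 0"
  shows "summable b" and "(\<lambda>n. \<Sum>k\<le>n. a n k) \<longlonglongrightarrow> suminf b"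
proof -
  have b0: "b k $ i = 0" if "i < k" for i k
  proof -
    have "\<forall>\<^sub>F n in sequentially. a n k $ i = b k $ i"
      using lim[of k] by (auto simp: tendsto_fps_iff)
    with eventually_ge_at_top[of k] have "\<forall>\<^sub>F n in sequentially. b k $ i = 0"
      by eventually_elim (use dom that in force)
    then show ?thesis by simp
  qed
  show "summable b" using b0 by (rule fps_summableI)
  show "(\<lambda>n. \<Sum>k\<le>n. a n k) \<longlonglongrightarrow> suminf b"
  proof (rule tendsto_fpsI)
    fix i
    have "\<forall>\<^sub>F n in sequentially. \<forall>k\<in>{..i}. a n k $ i = b k $ i"
      using lim by (auto simp: tendsto_fps_iff eventually_ball_finite_distrib)
    moreover have "\<forall>\<^sub>F n in sequentially. (\<Sum>k<n. b k) $ i = suminf b $ i"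
      using summable_LIMSEQ[OF \<open>summable b\<close>] by (auto simp: tendsto_fps_iff)
    ultimately show "\<forall>\<^sub>F n in sequentially. (\<Sum>k\<le>n. a n k) $ i = suminf b $ i"
      using eventually_gt_at_top[of i]
    proof eventually_elim
      case (elim n)
      have "(\<Sum>k\<le>n. a n k $ i) = (\<Sum>k\<le>i. a n k $ i)"
        by (rule sum.mono_neutral_right) (use elim dom in auto)
      also have "\<dots> = (\<Sum>k\<le>i. b k $ i)" using elim(1) by simp
      also have "\<dots> = (\<Sum>k<n. b k $ i)"
        by (rule sum.mono_neutral_left) (use elim b0 in auto)
      finally show ?case using elim(2) by (simp add: fps_sum_nth)
    qed
  qed
qed

section \<open>Inverses of power series with constant term 1\<close>

abbreviation rinv :: "'a::comm_ring_1 fps \<Rightarrow> 'a fps" where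
  "rinv f \<equiv> fps_right_inverse f 1"

lemma rinv_right: "f $ 0 = 1 \<Longrightarrow> f * rinv f = 1"
  by (rule fps_right_inverse) simp

lemma rinv_left: "f $ 0 = 1 \<Longrightarrow> rinv f * f = 1"
  using rinv_right[of f] by (simp add: mult.commute)

lemma rinv_nth_0 [simp]: "rinv f $ 0 = 1"
  by simp

lemma rinv_unique: "f $ 0 = 1 \<Longrightarrow> f * g = 1 \<Longrightarrow> rinv f = g"
proof -
  assume *: "f $ 0 = 1" "f * g = 1"
  have "rinv f = rinv f * (f * g)" using *(2) by simp
  also have "\<dots> = (rinv f * f) * g" by (simp only: mult.assoc)
  finally show "rinv f = g" using rinv_left[OF *(1)] by simp
qed

lemma rinv_mult: "f $ 0 = 1 \<Longrightarrow> g $ 0 = 1 \<Longrightarrow> rinv (f * g) = rinv f * rinv g"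
proof (rule rinv_unique)
  assume *: "f $ 0 = 1" "g $ 0 = 1"
  have "f * g * (rinv f * rinv g) = (f * rinv f) * (g * rinv g)"
    by (simp only: ac_simps)
  then show "f * g * (rinv f * rinv g) = 1"
    using * by (simp add: rinv_right)
qed simp

lemma rinv_compose:
  fixes f :: "'a::idom fps"
  assumes "f $ 0 = 1" "c $ 0 = 0"
  shows "rinv f oo c = rinv (f oo c)"
  by (rule rinv_unique[symmetric])
     (use assms in \<open>simp_all add: rinv_right flip: fps_compose_mult_distrib\<close>)

lemma fps_tendsto_rinv:
  fixes f :: "'b \<Rightarrow> 'a::comm_ring_1 fps"
  assumes "(f \<longlongrightarrow> a) F"
  shows "((\<lambda>n. rinv (f n)) \<longlongrightarrow> rinv a) F"
proof (rule tendsto_fpsI)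
  fix k
  have "\<forall>\<^sub>F n in F. \<forall>i\<in>{0..k}. f n $ i = a $ i"
    using assms by (auto simp: tendsto_fps_iff eventually_ball_finite_distrib)
  then show "\<forall>\<^sub>F n in F. rinv (f n) $ k = rinv a $ k"
    by eventually_elim (auto intro!: fps_right_inverse_constructor_cong)
qed

lemma fps_compose_X_power_nth:
  fixes f :: "'a::comm_ring_1 fps"
  assumes "m > 0"
  shows "(f oo fps_X ^ m) $ n = (if m dvd n then f $ (n div m) else 0)"
proof -
  have "(f oo fps_X ^ m) $ n = (\<Sum>i\<in>{0..n}. if n = m * i then f $ i else 0)"
    by (auto simp: fps_compose_nth power_mult[symmetric] intro!: sum.cong)
  also have "\<dots> = (if m dvd n then f $ (n div m) else 0)"
  proof (cases "m dvd n")
    case True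
    then obtain j where j: "n = m * j" by (elim dvdE)
    have "(\<Sum>i\<in>{0..n}. if n = m * i then f $ i else 0) = (\<Sum>i\<in>{0..n}. if i = j then f $ i else 0)"
      using j assms by (intro sum.cong) auto
    also have "\<dots> = f $ j" using j assms by simp
    finally show ?thesis using j assms by simp
  qed (auto intro!: sum.neutral)
  finally show ?thesis .
qed

subsection \<open>Dissections and infinite products\<close>

definition dissect :: "nat \<Rightarrow> nat \<Rightarrow> 'a::zero fps \<Rightarrow> 'a fps" where
  "dissect m r f = Abs_fps (\<lambda>n. f $ (m * n + r))"

lemma dissect_nth [simp]: "dissect m r f $ n = f $ (m * n + r)"
  by (simp add: dissect_def)

lemma dissect_add: "dissect m r (f + g) = dissect m r f + dissect m r (g :: 'a::comm_ring_1 fps)"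
  by (simp add: fps_eq_iff)

lemma dissect_sum: "dissect m r (\<Sum>i\<in>A. f i) = (\<Sum>i\<in>A. dissect m r (f i :: 'a::comm_ring_1 fps))"
  by (simp add: fps_eq_iff fps_sum_nth)

lemma dissect_tendsto:
  fixes f :: "'b \<Rightarrow> 'a::comm_ring_1 fps"
  assumes "(f \<longlongrightarrow> a) F"
  shows "((\<lambda>n. dissect m r (f n)) \<longlongrightarrow> dissect m r a) F"
  using assms by (simp add: tendsto_fps_iff)

lemma dissect_sums:
  fixes f :: "nat \<Rightarrow> 'a::comm_ring_1 fps"
  assumes "f sums s"
  shows "(\<lambda>n. dissect m r (f n)) sums dissect m r s"
  using assms dissect_tendsto unfolding sums_def dissect_sum[symmetric] by blast

text \<open>Multiplying by a series in \<open>fps_X ^ m\<close> does not mix residue classes modulo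
  \<open>m\<close>, so such a factor can be pulled out of a dissection. All later dissections of
  products and quotients rest on this.\<close>

lemma dissect_mult_compose:
  fixes f g :: "'a::comm_ring_1 fps"
  assumes m: "m > 0" and r: "r < m"
  shows "dissect m r (f * (g oo fps_X ^ m)) = dissect m r f * g"
proof (rule fps_ext)
  fix n
  have "dissect m r (f * (g oo fps_X ^ m)) $ n
      = (\<Sum>i=0..m * n + r. f $ (m * n + r - i) * (g oo fps_X ^ m) $ i)"
    by (simp add: fps_mult_nth mult.commute[of f] mult.commute[of _ "f $ _"])
  also have "\<dots> = (\<Sum>i\<in>(\<lambda>j. m * j) ` {0..n}. f $ (m * n + r - i) * (g oo fps_X ^ m) $ i)"
  proof (rule sum.mono_neutral_right)
    show "(\<lambda>j. m * j) ` {0..n} \<subseteq> {0..m * n + r}"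
      by (auto intro!: trans_le_add1)
    show "\<forall>i\<in>{0..m * n + r} - (\<lambda>j. m * j) ` {0..n}. f $ (m * n + r - i) * (g oo fps_X ^ m) $ i = 0"
    proof
      fix i assume i: "i \<in> {0..m * n + r} - (\<lambda>j. m * j) ` {0..n}"
      have "\<not> m dvd i"
      proof
        assume "m dvd i"
        then obtain j where j: "i = m * j" by (elim dvdE)
        have "m * j < m * Suc n" using i j r by auto
        then have "j \<le> n" by (metis less_Suc_eq_le mult_less_cancel1)
        then show False using i j by auto
      qed
      then show "f $ (m * n + r - i) * (g oo fps_X ^ m) $ i = 0"
        by (simp add: fps_compose_X_power_nth[OF m])
    qed
  qed simp
  also have "\<dots> = (\<Sum>j=0..n. f $ (m * n + r - m * j) * g $ j)"
    using m by (subst sum.reindex) (auto simp: inj_on_def fps_compose_X_power_nth[OF m])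
  also have "\<dots> = (\<Sum>j=0..n. g $ j * f $ (m * (n - j) + r))"
    by (intro sum.cong) (auto simp: algebra_simps diff_mult_distrib2)
  also have "\<dots> = (dissect m r f * g) $ n"
    by (simp add: fps_mult_nth mult.commute[of _ g])
  finally show "dissect m r (f * (g oo fps_X ^ m)) $ n = (dissect m r f * g) $ n" .
qed

lemma dissect_dissect: "dissect m r (dissect n s f) = dissect (m * n) (n * r + s) f"
  by (simp add: fps_eq_iff algebra_simps)

text \<open>For \<open>a\<close> and \<open>q\<close> without constant term the coefficient of index \<open>n\<close> of the infinite
  product is already reached after \<open>n + 1\<close> factors.\<close>

definition qinf :: "'a::comm_ring_1 fps \<Rightarrow> 'a fps \<Rightarrow> 'a fps" where
  "qinf a q = Abs_fps (\<lambda>n. qpochhammer a q (Suc n) $ n)"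

lemma qpochhammer_0 [simp]: "qpochhammer a q 0 = 1"
  by (simp add: qpochhammer_def)

lemma qpochhammer_Suc: "qpochhammer a q (Suc n) = qpochhammer a q n * (1 - a * q ^ n)"
  by (simp add: qpochhammer_def mult.commute)

lemma fps_mult_power_nth_eq_0:
  fixes a q :: "'a::comm_ring_1 fps"
  assumes "a $ 0 = 0" "q $ 0 = 0" "i \<le> n"
  shows "(a * q ^ n) $ i = 0"
proof -
  have "(q ^ n) $ j = 0" if "j < n" for j
    using assms(2) that by (simp add: startsby_zero_power_prefix)
  then have "a $ j * (q ^ n) $ (i - j) = 0" if "j \<le> i" for j
    using assms that by (cases j) auto
  then show ?thesis by (simp add: fps_mult_nth)
qed

text \<open>The factor of index \<open>m\<close> differs from 1 only in degrees above
  \<open>m\<close>, because \<open>a\<close> and \<open>q\<close> both have order at least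
  1.\<close>

lemma qpochhammer_nth_stable:
  fixes a q :: "'a::comm_ring_1 fps"
  assumes "a $ 0 = 0" "q $ 0 = 0" "i < m"
  shows "qpochhammer a q m $ i = qinf a q $ i"
  using \<open>i < m\<close>
proof (induction m)
  case (Suc m)
  show ?case
  proof (cases "i = m")
    case False
    have "(qpochhammer a q m * (a * q ^ m)) $ i = 0"
      unfolding fps_mult_nth[of "qpochhammer a q m"]
      by (intro sum.neutral ballI)
         (use fps_mult_power_nth_eq_0[OF assms(1,2)] Suc.prems in auto)
    then show ?thesis
      using Suc False by (simp add: qpochhammer_Suc right_diff_distrib)
  qed (simp add: qinf_def)
qed simp

lemma qpochhammer_tendsto:
  fixes a q :: "'a::comm_ring_1 fps"
  assumes "a $ 0 = 0" "q $ 0 = 0"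
  shows "qpochhammer a q \<longlonglongrightarrow> qinf a q"
proof (rule tendsto_fpsI)
  fix n
  show "\<forall>\<^sub>F m in sequentially. qpochhammer a q m $ n = qinf a q $ n"
    using eventually_gt_at_top[of n]
    by eventually_elim (rule qpochhammer_nth_stable[OF assms])
qed

lemma qinf_nth_0 [simp]:
  assumes "a $ 0 = 0"
  shows "qinf a q $ 0 = 1"
  using assms by (simp add: qinf_def qpochhammer_def)

text \<open>Product identities are obtained along a subsequence of the partial products; for
  instance \<open>2 * n\<close> factors split evenly into two progressions.\<close>

lemma qinf_eqI:
  fixes a q :: "'a::comm_ring_1 fps"
  assumes "a $ 0 = 0" "q $ 0 = 0" "filterlim m at_top sequentially"
    and "(\<lambda>n. qpochhammer a q (m n)) \<longlonglongrightarrow> f"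
  shows "qinf a q = f"
  using filterlim_compose[OF qpochhammer_tendsto[OF assms(1,2)] assms(3)] assms(4)
  by (rule tendsto_unique[OF sequentially_bot])

lemma qinf_split2:
  fixes a q :: "'a::comm_ring_1 fps"
  assumes "a $ 0 = 0" "q $ 0 = 0"
  shows "qinf a q = qinf a (q ^ 2) * qinf (a * q) (q ^ 2)"
proof (rule qinf_eqI[OF assms, of "\<lambda>n. 2 * n"])
  have *: "qpochhammer a q (2 * n) = qpochhammer a (q ^ 2) n * qpochhammer (a * q) (q ^ 2) n" for n
  proof (induction n)
    case (Suc n)
    have "2 * Suc n = Suc (Suc (2 * n))" by simp
    then show ?case
      by (simp only: qpochhammer_Suc Suc.IH) (simp add: ac_simps flip: power_mult)
  qed simp
  show "(\<lambda>n. qpochhammer a q (2 * n)) \<longlonglongrightarrow> qinf a (q ^ 2) * qinf (a * q) (q ^ 2)"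
    unfolding * by (intro fps_tendsto_mult qpochhammer_tendsto) (use assms in \<open>simp_all add: power2_eq_square\<close>)
  show "filterlim (\<lambda>n::nat. 2 * n) sequentially sequentially"
    by (rule filterlim_subseq) (auto simp: strict_mono_def)
qed

lemma qinf_split3:
  fixes a q :: "'a::comm_ring_1 fps"
  assumes "a $ 0 = 0" "q $ 0 = 0"
  shows "qinf a q = qinf a (q ^ 3) * qinf (a * q) (q ^ 3) * qinf (a * q ^ 2) (q ^ 3)"
proof (rule qinf_eqI[OF assms, of "\<lambda>n. 3 * n"])
  have *: "qpochhammer a q (3 * n) = qpochhammer a (q ^ 3) n * qpochhammer (a * q) (q ^ 3) n
      * qpochhammer (a * q ^ 2) (q ^ 3) n" for n
  proof (induction n)
    case (Suc n)
    have "3 * Suc n = Suc (Suc (Suc (3 * n)))" by simp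
    then show ?case
      by (simp only: qpochhammer_Suc Suc.IH) (simp add: ac_simps power2_eq_square flip: power_mult)
  qed simp
  show "(\<lambda>n. qpochhammer a q (3 * n)) \<longlonglongrightarrow>
      qinf a (q ^ 3) * qinf (a * q) (q ^ 3) * qinf (a * q ^ 2) (q ^ 3)"
    unfolding * by (intro fps_tendsto_mult qpochhammer_tendsto) (use assms in \<open>simp_all add: power3_eq_cube\<close>)
  show "filterlim (\<lambda>n::nat. 3 * n) sequentially sequentially"
    by (rule filterlim_subseq) (auto simp: strict_mono_def)
qed

lemma qinf_mult_uminus:
  fixes a q :: "'a::comm_ring_1 fps"
  assumes "a $ 0 = 0" "q $ 0 = 0"
  shows "qinf a q * qinf (- a) q = qinf (a ^ 2) (q ^ 2)"
proof (rule sym, rule qinf_eqI[of _ _ "\<lambda>n. n"])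
  have *: "qpochhammer (a ^ 2) (q ^ 2) n = qpochhammer a q n * qpochhammer (- a) q n" for n
    by (induction n) (simp_all add: qpochhammer_Suc algebra_simps power2_eq_square power_mult_distrib)
  show "(\<lambda>n. qpochhammer (a ^ 2) (q ^ 2) n) \<longlonglongrightarrow> qinf a q * qinf (- a) q"
    unfolding * by (intro fps_tendsto_mult qpochhammer_tendsto) (use assms in simp_all)
qed (use assms in \<open>simp_all add: power2_eq_square filterlim_ident\<close>)

lemma qpochhammer_compose:
  fixes a q :: "'a::idom fps"
  assumes "c $ 0 = 0"
  shows "qpochhammer a q n oo c = qpochhammer (a oo c) (q oo c) n"
  using assms
  by (simp add: qpochhammer_def fps_compose_prod_distrib fps_compose_sub_distrib
      fps_compose_mult_distrib fps_compose_power)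

lemma qinf_compose:
  fixes a q :: "'a::idom fps"
  assumes "a $ 0 = 0" "q $ 0 = 0" "c $ 0 = 0"
  shows "qinf a q oo c = qinf (a oo c) (q oo c)"
proof (rule sym, rule qinf_eqI[of _ _ "\<lambda>n. n"])
  show "(\<lambda>n. qpochhammer (a oo c) (q oo c) n) \<longlonglongrightarrow> (qinf a q oo c)"
    unfolding qpochhammer_compose[OF assms(3), symmetric]
    by (intro fps_tendsto_compose qpochhammer_tendsto assms)
qed (use assms in \<open>simp_all add: filterlim_ident\<close>)

subsection \<open>Finite partial fraction identities\<close>

lemma Suc_choose_2: "Suc k choose 2 = k + (k choose 2)"
  by (simp add: numeral_2_eq_2)

lemma qpochhammer_nonzero:
  fixes q :: "'a::field"
  assumes "\<And>n. n > 0 \<Longrightarrow> q ^ n \<noteq> 1"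
  shows "qpochhammer q q n \<noteq> 0"
proof -
  have "q * q ^ k \<noteq> 1" for k
    using assms[of "Suc k"] by simp
  then show ?thesis by (simp add: qpochhammer_def)
qed

text \<open>This is the reciprocal of the product of the other factors of
  \<open>partial_fractions\<close> at \<open>z = 1 / q ^ k + q ^ (k + 1)\<close>, the zero of factor
  \<open>k\<close>. There factor j becomes (1 - q^(j-k)) (1 - q^(j+k+1)); the negative powers for j
  < k produce the sign and \<open>q ^ (Suc k choose 2)\<close>.\<close>

definition pf_coeff :: "'a::field \<Rightarrow> nat \<Rightarrow> nat \<Rightarrow> 'a" where
  "pf_coeff q n k = (-1) ^ k * q ^ (Suc k choose 2) * (1 - q ^ (2 * k + 1)) /
     (qpochhammer q q (n - k) * qpochhammer q q (n + 1 + k))"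

text \<open>The sum telescopes: the closed form is checked by adding one term at a time. The bound
  \<open>m < N\<close> stops just before the last term, which \<open>sum_pf_coeff\<close> treats
  separately.\<close>

lemma sum_pf_coeff_partial:
  fixes q :: "'a::field"
  assumes q: "\<And>n. n > 0 \<Longrightarrow> q ^ n \<noteq> 1" and "q \<noteq> 0" and "m < N"
  shows "(\<Sum>k\<le>m. pf_coeff q N k / q ^ k) = (-1) ^ m * q ^ (Suc m choose 2) * (1 - q ^ (m + 1)) /
     ((1 - q ^ N) * qpochhammer q q (N - m - 1) * qpochhammer q q (N + 1 + m))"
  using \<open>m < N\<close>
proof (induction m)
  case 0
  then obtain r where N: "N = Suc r" by (cases N) auto
  show ?case
    using q[of N] by (simp add: N pf_coeff_def qpochhammer_Suc binomial_eq_0)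
next
  case (Suc m)
  then obtain r where N: "N = Suc (Suc (m + r))" by (auto simp: less_iff_Suc_add)
  define A where "A = qpochhammer q q r"
  define B where "B = qpochhammer q q (N + 1 + m)"
  define s where "s = q ^ (Suc m choose 2)"
  define a where "a = q ^ m"
  define b where "b = q ^ r"
  have A: "A \<noteq> 0" and B: "B \<noteq> 0"
    unfolding A_def B_def by (intro qpochhammer_nonzero q; simp)+
  have e1: "qpochhammer q q (N - m - 1) = A * (1 - q * b)"
    by (simp add: N A_def b_def qpochhammer_Suc)
  have e2: "qpochhammer q q (N + 1 + Suc m) = B * (1 - q ^ 4 * a ^ 2 * b)"
    by (simp add: B_def qpochhammer_Suc a_def b_def N power_add power2_eq_square eval_nat_numeral ac_simps)
  have e3: "q ^ N = q ^ 2 * a * b"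
    by (simp add: N a_def b_def power_add power2_eq_square)
  have n1: "1 - q * b \<noteq> 0" using q[of "Suc r"] by (simp add: b_def)
  have n2: "1 - q ^ 4 * a ^ 2 * b \<noteq> 0" using q[of "4 + 2 * m + r"]
    by (simp add: a_def b_def power_add flip: power_mult) (simp add: mult.commute)
  have "q ^ N \<noteq> 1" by (rule q) (simp add: N)
  then have n3: "1 - q ^ 2 * a * b \<noteq> 0" by (simp add: e3)
  have a0: "a \<noteq> 0" using \<open>q \<noteq> 0\<close> by (simp add: a_def)
  have c: "q ^ (Suc (Suc m) choose 2) = q * a * s"
    by (simp only: Suc_choose_2[of "Suc m"] power_add s_def a_def power_Suc)
  have c1: "q ^ (m + 1) = q * a" and c2: "q ^ (2 * Suc m + 1) = q ^ 3 * a ^ 2"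
    and c3: "q ^ (Suc m + 1) = q ^ 2 * a"
    by (simp_all add: a_def power2_eq_square power3_eq_cube power_add mult_2)
  have r: "N - Suc m = Suc (N - Suc m - 1)" "N - Suc m - 1 = r" "N - m - 1 = Suc r" by (simp_all add: N)
  have P1: "qpochhammer q q (N - Suc m) = A * (1 - q * b)" using e1 by (simp add: N)
  have IH: "(\<Sum>k\<le>m. pf_coeff q N k / q ^ k) = (-1) ^ m * s * (1 - q * a) /
     ((1 - q ^ 2 * a * b) * (A * (1 - q * b)) * B)"
    using Suc by (simp only: Suc.IH s_def c1 e3 e1 B_def Suc_lessD)
  have new: "pf_coeff q N (Suc m) / q ^ Suc m =
      - ((-1) ^ m) * s * (1 - q ^ 3 * a ^ 2) / ((A * (1 - q * b)) * (B * (1 - q ^ 4 * a ^ 2 * b)))"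
    unfolding pf_coeff_def c c2 P1 e2
    using a0 \<open>q \<noteq> 0\<close> by (simp add: a_def mult.assoc)
  have goal: "(-1) ^ Suc m * (q * a * s) * (1 - q ^ 2 * a) /
     ((1 - q ^ 2 * a * b) * A * (B * (1 - q ^ 4 * a ^ 2 * b))) =
     (-1) ^ m * s * (1 - q * a) /
     ((1 - q ^ 2 * a * b) * (A * (1 - q * b)) * B) +
      - ((-1) ^ m) * s * (1 - q ^ 3 * a ^ 2) / ((A * (1 - q * b)) * (B * (1 - q ^ 4 * a ^ 2 * b)))"
    using A B n1 n2 n3 by (simp add: divide_simps) algebra
  show ?case
    by (simp only: sum.atMost_Suc IH new c c3 e2 e3 r(2) flip: A_def) (simp only: goal)
qed

text \<open>Since factor \<open>k\<close> grows like \<open>- z * q ^ k\<close>, this sum is up to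
  sign the coefficient of 1/z at infinity of the partial fraction sum. It must vanish, because a
  reciprocal of at least two linear factors decays faster. Here the last term is seen to cancel the
  closed form of the others.\<close>

lemma sum_pf_coeff:
  fixes q :: "'a::field"
  assumes q: "\<And>n. n > 0 \<Longrightarrow> q ^ n \<noteq> 1" and "q \<noteq> 0" and "N > 0"
  shows "(\<Sum>k\<le>N. pf_coeff q N k / q ^ k) = 0"
proof -
  obtain m where N: "N = Suc m" using \<open>N > 0\<close> by (cases N) auto
  have n: "q ^ Suc m \<noteq> 1" "q ^ (m + Suc m + 2) \<noteq> 1" using q[of "Suc m"] q[of "m + Suc m + 2"] by simp_all
  have n0: "qpochhammer q q (m + Suc m + 1) \<noteq> 0" by (intro qpochhammer_nonzero q)
  have "(\<Sum>k\<le>m. pf_coeff q N k / q ^ k) = (-1) ^ m * q ^ (Suc m choose 2) / qpochhammer q q (m + Suc m + 1)"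
    using sum_pf_coeff_partial[OF q \<open>q \<noteq> 0\<close>, of m N] n by (simp add: N add_ac)
  moreover have "pf_coeff q N N / q ^ N = - ((-1) ^ m * q ^ (Suc m choose 2) / qpochhammer q q (m + Suc m + 1))"
  proof -
    have "qpochhammer q q (N + 1 + N) = qpochhammer q q (m + Suc m + 1) * (1 - q ^ (2 * N + 1))"
      by (simp add: N qpochhammer_Suc mult_2)
    moreover have "q ^ (2 * N + 1) \<noteq> 1" using q[of "2 * N + 1"] by simp
    moreover have "q ^ (Suc N choose 2) = q ^ N * q ^ (Suc m choose 2)"
      by (simp only: N Suc_choose_2[of "Suc m"] power_add)
    ultimately show ?thesis using \<open>q \<noteq> 0\<close> n0 by (simp add: pf_coeff_def N)
  qed
  ultimately show ?thesis by (simp add: N)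
qed

text \<open>The partial fraction decomposition of the reciprocal of \<open>\<Prod>k\<le>n. 1 + q ^ (2 * k + 1) - z * q ^ k\<close>
  as a function of \<open>z\<close>, with denominators cleared. With \<open>z = x + q / x\<close> the factors become
  \<open>(1 - x * q ^ k) * (1 - q ^ (k + 1) / x)\<close>.\<close>

lemma partial_fractions:
  fixes q z :: "'a::field"
  assumes q: "\<And>n. n > 0 \<Longrightarrow> q ^ n \<noteq> 1" and "q \<noteq> 0"
  defines "u \<equiv> \<lambda>k. 1 + q ^ (2 * k + 1) - z * q ^ k"
  shows "(\<Sum>k\<le>n. pf_coeff q n k * (\<Prod>j\<in>{..n} - {k}. u j)) = 1"
proof (induction n)
  case 0
  show ?case using q[of 1] by (simp add: pf_coeff_def qpochhammer_Suc binomial_eq_0)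
next
  case (Suc n)
  \<comment> \<open>Both factors are affine in \<open>z\<close>, so \<open>u (Suc n)\<close> is
    \<open>q ^ (Suc n - k) * u k\<close> plus a constant. The constant turns the coefficient for
    \<open>Suc n\<close> into the one for \<open>n\<close>; the multiple of \<open>u k\<close>
    completes the full product and is annihilated by \<open>sum_pf_coeff\<close>.\<close>
  have step: "pf_coeff q (Suc n) k * u (Suc n)
      = pf_coeff q (Suc n) k / q ^ k * q ^ Suc n * u k + pf_coeff q n k" if k: "k \<le> n" for k
  proof -
    obtain r where n: "n = k + r" using k by (auto simp: le_iff_add)
    define A where "A = qpochhammer q q (n - k)"
    define B where "B = qpochhammer q q (n + 1 + k)"
    define a where "a = q ^ k"
    define b where "b = q ^ r"
    have AB: "A \<noteq> 0" "B \<noteq> 0" unfolding A_def B_def by (intro qpochhammer_nonzero q; simp)+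
    have a0: "a \<noteq> 0" using \<open>q \<noteq> 0\<close> by (simp add: a_def)
    have e1: "qpochhammer q q (Suc n - k) = A * (1 - q * b)"
      by (simp add: n A_def b_def Suc_diff_le qpochhammer_Suc)
    have e2: "qpochhammer q q (Suc n + 1 + k) = B * (1 - q ^ 2 * a ^ 2 * b)"
      by (simp add: B_def qpochhammer_Suc a_def b_def n power_add power2_eq_square ac_simps)
    have n1: "1 - q * b \<noteq> 0" using q[of "Suc r"] by (simp add: b_def)
    have "q ^ 2 * a ^ 2 * b = q ^ (2 + 2 * k + r)"
      by (simp only: a_def b_def power_add power_even_eq)
    then have n2: "1 - q ^ 2 * a ^ 2 * b \<noteq> 0" using q[of "2 + 2 * k + r"] by simp
    have uu: "u (Suc n) * a = q * a * b * u k + (1 - q * b) * (1 - q ^ 2 * a ^ 2 * b) * a"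
    proof -
      have "q ^ (2 * Suc n + 1) = q ^ 3 * a ^ 2 * b ^ 2" "q ^ Suc n = q * a * b"
           "q ^ (2 * k + 1) = q * a ^ 2"
        by (simp_all add: n a_def b_def power_add mult_2 power2_eq_square power3_eq_cube)
      then have "u (Suc n) * a - (q * a * b * u k + (1 - q * b) * (1 - q ^ 2 * a ^ 2 * b) * a) =
          (1 + q ^ 3 * a ^ 2 * b ^ 2 - z * (q * a * b)) * a -
          (q * a * b * (1 + q * a ^ 2 - z * a) + (1 - q * b) * (1 - q ^ 2 * a ^ 2 * b) * a)"
        by (simp only: u_def flip: a_def)
      also have "\<dots> = 0" by (simp add: algebra_simps power2_eq_square power3_eq_cube)
      finally show ?thesis by simp
    qed
    have "u (Suc n) = q * b * u k + (1 - q * b) * (1 - q ^ 2 * a ^ 2 * b)"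
      using uu a0 by (metis (no_types, lifting) mult.assoc mult.commute mult_cancel_right distrib_right)
    moreover define c where "c = (-1) ^ k * q ^ (Suc k choose 2) * (1 - q ^ (2 * k + 1))"
    moreover have "pf_coeff q (Suc n) k = c / ((A * (1 - q * b)) * (B * (1 - q ^ 2 * a ^ 2 * b)))"
      by (simp only: pf_coeff_def c_def e1 e2)
    moreover have "pf_coeff q n k = c / (A * B)"
      by (simp only: pf_coeff_def c_def A_def B_def)
    moreover have "q ^ Suc n = q * a * b" by (simp add: n a_def b_def power_add)
    moreover have "c / ((A * X) * (B * Y)) * (q * b * v + X * Y)
        = c / ((A * X) * (B * Y)) / a * (q * a * b) * v + c / (A * B)" if "X \<noteq> 0" "Y \<noteq> 0" for X Y v
      using AB a0 that by (simp add: divide_simps) (simp add: algebra_simps)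
    ultimately show ?thesis
      using n1 n2 by (simp only: flip: a_def)
  qed
  have "(\<Sum>k\<le>Suc n. pf_coeff q (Suc n) k * (\<Prod>j\<in>{..Suc n} - {k}. u j))
      = (\<Sum>k\<le>n. pf_coeff q (Suc n) k * (u (Suc n) * (\<Prod>j\<in>{..n} - {k}. u j)))
        + pf_coeff q (Suc n) (Suc n) * (\<Prod>j\<le>n. u j)"
  proof -
    have "{..Suc n} - {k} = insert (Suc n) ({..n} - {k})" if "k \<le> n" for k
      using that by auto
    moreover have "{..Suc n} - {Suc n} = {..n}" by auto
    ultimately show ?thesis by simp
  qed
  also have "(\<Sum>k\<le>n. pf_coeff q (Suc n) k * (u (Suc n) * (\<Prod>j\<in>{..n} - {k}. u j)))
      = (\<Sum>k\<le>n. pf_coeff q (Suc n) k / q ^ k * q ^ Suc n * (\<Prod>j\<le>n. u j)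
          + pf_coeff q n k * (\<Prod>j\<in>{..n} - {k}. u j))"
  proof (rule sum.cong)
    fix k assume "k \<in> {..n}"
    then have k: "k \<le> n" by simp
    have "(\<Prod>j\<le>n. u j) = u k * (\<Prod>j\<in>{..n} - {k}. u j)"
      using k by (intro prod.remove) auto
    moreover have "pf_coeff q (Suc n) k * (u (Suc n) * P) = (pf_coeff q (Suc n) k * u (Suc n)) * P" for P
      by simp
    ultimately show "pf_coeff q (Suc n) k * (u (Suc n) * (\<Prod>j\<in>{..n} - {k}. u j)) =
        pf_coeff q (Suc n) k / q ^ k * q ^ Suc n * (\<Prod>j\<le>n. u j)
          + pf_coeff q n k * (\<Prod>j\<in>{..n} - {k}. u j)"
      by (simp only: step[OF k] distrib_right mult.assoc)
  qed simp
  also have "\<dots> = (\<Sum>k\<le>n. pf_coeff q (Suc n) k / q ^ k) * (q ^ Suc n * (\<Prod>j\<le>n. u j)) + 1"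
    by (simp only: sum.distrib Suc.IH sum_distrib_right mult.assoc)
  also have "\<dots> + pf_coeff q (Suc n) (Suc n) * (\<Prod>j\<le>n. u j)
      = (\<Sum>k\<le>Suc n. pf_coeff q (Suc n) k / q ^ k) * (q ^ Suc n * (\<Prod>j\<le>n. u j)) + 1"
    using \<open>q \<noteq> 0\<close> by (simp add: distrib_right)
  also have "\<dots> = 1"
    using sum_pf_coeff[OF q \<open>q \<noteq> 0\<close>, of "Suc n"] by simp
  finally show ?case .
qed

lemma partial_fractions_div:
  fixes q z :: "'a::field"
  assumes q: "\<And>n. n > 0 \<Longrightarrow> q ^ n \<noteq> 1" and "q \<noteq> 0"
  defines "u \<equiv> \<lambda>k. 1 + q ^ (2 * k + 1) - z * q ^ k"
  assumes u: "\<And>k. u k \<noteq> 0"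
  shows "(\<Sum>k\<le>n. pf_coeff q n k / u k) = 1 / (\<Prod>k\<le>n. u k)"
proof -
  have "pf_coeff q n k / u k = pf_coeff q n k * (\<Prod>j\<in>{..n} - {k}. u j) / (\<Prod>k\<le>n. u k)"
    if "k \<le> n" for k
    using that u by (subst (2) prod.remove[of _ k]) auto
  then have "(\<Sum>k\<le>n. pf_coeff q n k / u k)
      = (\<Sum>k\<le>n. pf_coeff q n k * (\<Prod>j\<in>{..n} - {k}. u j)) / (\<Prod>k\<le>n. u k)"
    by (simp add: sum_divide_distrib)
  then show ?thesis
    using partial_fractions[OF q \<open>q \<noteq> 0\<close>] by (simp add: u_def)
qed

text \<open>A q-Vandermonde sum whose limit is Cauchy's Durfee rectangle identity. After
  multiplication by \<open>qpochhammer q q N\<close> it follows by induction on \<open>N\<close> for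
  all \<open>r\<close> at once: Pascal's rule splits the sum for (N + 1, r) into those for (N, r)
  and (N, r + 1).\<close>

lemma finite_cauchy:
  fixes q :: "'a::field"
  assumes q: "\<And>n. n > 0 \<Longrightarrow> q ^ n \<noteq> 1"
  shows "(\<Sum>m\<le>N. q ^ (m * (m + r)) /
      (qpochhammer q q m * qpochhammer q q (m + r) * qpochhammer q q (N - m)))
      = 1 / (qpochhammer q q N * qpochhammer q q (N + r))"
proof -
  \<comment> \<open>Gaussian binomial coefficients as quotients; the value 0 for
    \<open>k > n\<close> removes the extra top term after Pascal's rule has been applied.\<close>
  define g where "g = (\<lambda>n k. if k \<le> n then qpochhammer q q n /
    (qpochhammer q q k * qpochhammer q q (n - k)) else 0)"
  have nz: "qpochhammer q q n \<noteq> 0" for n by (intro qpochhammer_nonzero q)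
  have g0: "g n 0 = 1" for n by (simp add: g_def nz)
  have pascal: "g (Suc n) (Suc k) = g n (Suc k) + q ^ (n - k) * g n k" if "k \<le> n" for n k
  proof (cases "k = n")
    case False
    then obtain r where n: "n = Suc (k + r)"
      using \<open>k \<le> n\<close> less_iff_Suc_add[of k n] by auto
    have n': "q * q ^ k \<noteq> 1" "q * q ^ r \<noteq> 1" using q[of "Suc k"] q[of "Suc r"] by auto
    define A B C a b where d: "A = qpochhammer q q k" "B = qpochhammer q q r" "C = qpochhammer q q n"
      "a = q ^ k" "b = q ^ r"
    have nz': "A \<noteq> 0" "B \<noteq> 0" "1 - q * a \<noteq> 0" "1 - q * b \<noteq> 0" using nz n' by (auto simp: d)
    have "g (Suc n) (Suc k) = C * (1 - q ^ 2 * a * b) / (A * (1 - q * a) * (B * (1 - q * b)))"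
         "g n (Suc k) = C / (A * (1 - q * a) * B)" "g n k = C / (A * (B * (1 - q * b)))"
         "q ^ (n - k) = q * b"
      by (simp_all add: g_def d qpochhammer_Suc n Suc_diff_le power_add power2_eq_square ac_simps)
    moreover have "C * (1 - q ^ 2 * a * b) / (A * (1 - q * a) * (B * (1 - q * b)))
        = C / (A * (1 - q * a) * B) + q * b * (C / (A * (B * (1 - q * b))))"
      using nz' by (simp add: divide_simps del: right_minus_eq) (simp add: algebra_simps power2_eq_square)
    ultimately show ?thesis by simp
  qed (simp add: g_def nz)
  have "(\<Sum>m\<le>N. q ^ (m * (m + r)) * g N m / qpochhammer q q (m + r)) = 1 / qpochhammer q q (N + r)" for N r
  proof (induction N arbitrary: r)
    case (Suc N)
    define f where "f = (\<lambda>m. q ^ (m * (m + r)) / qpochhammer q q (m + r))"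
    have "(\<Sum>m\<le>Suc N. q ^ (m * (m + r)) * g (Suc N) m / qpochhammer q q (m + r))
        = f 0 + (\<Sum>m\<le>N. f (Suc m) * g (Suc N) (Suc m))"
      by (subst sum.atMost_Suc_shift) (simp add: f_def g0)
    also have "\<dots> = f 0 + (\<Sum>m\<le>N. f (Suc m) * g N (Suc m)) + (\<Sum>m\<le>N. f (Suc m) * q ^ (N - m) * g N m)"
      by (simp add: pascal algebra_simps sum.distrib cong: sum.cong_simp)
    also have "f 0 + (\<Sum>m\<le>N. f (Suc m) * g N (Suc m)) = (\<Sum>m\<le>Suc N. f m * g N m)"
      by (simp only: sum.atMost_Suc_shift[of "\<lambda>m. f m * g N m"] g0 mult_1_right)
    also have "\<dots> = (\<Sum>m\<le>N. f m * g N m)" by (simp add: g_def)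
    also have "\<dots> = 1 / qpochhammer q q (N + r)"
      using Suc.IH[of r] by (simp add: f_def)
    also have "(\<Sum>m\<le>N. f (Suc m) * q ^ (N - m) * g N m)
        = q ^ (N + r + 1) * (\<Sum>m\<le>N. q ^ (m * (m + Suc r)) * g N m / qpochhammer q q (m + Suc r))"
      unfolding sum_distrib_left
    proof (rule sum.cong)
      fix m assume "m \<in> {..N}"
      then obtain s where N: "N = m + s" by (auto simp: le_iff_add)
      have "q ^ (Suc m * (Suc m + r)) * q ^ (N - m) = q ^ (N + r + 1) * q ^ (m * (m + Suc r))"
        by (simp add: N algebra_simps flip: power_add power_Suc)
      then show "f (Suc m) * q ^ (N - m) * g N m =
          q ^ (N + r + 1) * (q ^ (m * (m + Suc r)) * g N m / qpochhammer q q (m + Suc r))"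
        by (auto simp: f_def divide_simps nz)
    qed simp
    also have "\<dots> = q ^ (N + r + 1) / qpochhammer q q (N + Suc r)"
      by (simp only: Suc.IH) simp
    also have "1 / qpochhammer q q (N + r) + q ^ (N + r + 1) / qpochhammer q q (N + Suc r)
        = 1 / qpochhammer q q (Suc N + r)"
    proof -
      have "q * q ^ (N + r) \<noteq> 1" using q[of "Suc (N + r)"] by simp
      then show ?thesis using nz by (simp add: qpochhammer_Suc divide_simps)
    qed
    finally show ?case .
  qed (simp add: g_def nz)
  from this[of r N] have "(\<Sum>m\<le>N. q ^ (m * (m + r)) * g N m / qpochhammer q q (m + r)) / qpochhammer q q N
      = 1 / (qpochhammer q q N * qpochhammer q q (N + r))"
    by simp
  then show ?thesis
    by (simp add: sum_divide_distrib g_def nz ac_simps cong: sum.cong_simp)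
qed

text \<open>A finite Bailey lemma relative to a = q. By \<open>partial_fractions_div\<close>, the
  reciprocal products and the numerators of \<open>pf_coeff\<close> over \<open>u k\<close> form a
  Bailey pair; inserting the expansion and interchanging the sums leaves an inner sum over m = n -
  k, which is \<open>finite_cauchy\<close> with \<open>r = 2 * k + 1\<close>.\<close>

lemma finite_bailey:
  fixes q z :: "'a::field"
  assumes q: "\<And>n. n > 0 \<Longrightarrow> q ^ n \<noteq> 1" and "q \<noteq> 0"
  defines "u \<equiv> \<lambda>k. 1 + q ^ (2 * k + 1) - z * q ^ k"
  assumes u: "\<And>k. u k \<noteq> 0"
  shows "(\<Sum>n\<le>L. q ^ (n * (n + 1)) / ((\<Prod>k\<le>n. u k) * qpochhammer q q (L - n)))
    = (\<Sum>k\<le>L. q ^ (k * (k + 1)) * pf_coeff q L k / u k)"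
proof -
  define Q where "Q = qpochhammer q q"
  define c where "c = (\<lambda>k. (-1) ^ k * q ^ (Suc k choose 2) * (1 - q ^ (2 * k + 1)) / u k)"
  have "(\<Sum>n\<le>L. q ^ (n * (n + 1)) / ((\<Prod>k\<le>n. u k) * Q (L - n)))
      = (\<Sum>n\<le>L. \<Sum>k\<le>n. q ^ (n * (n + 1)) * (c k / (Q (n - k) * Q (n + 1 + k))) / Q (L - n))"
  proof (rule sum.cong)
    fix n
    have "1 / (\<Prod>k\<le>n. u k) = (\<Sum>k\<le>n. c k / (Q (n - k) * Q (n + 1 + k)))"
      using partial_fractions_div[OF q \<open>q \<noteq> 0\<close> u[unfolded u_def], of n]
      by (simp add: pf_coeff_def c_def u_def Q_def ac_simps)
    then have "q ^ (n * (n + 1)) * (1 / (\<Prod>k\<le>n. u k)) / Q (L - n)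
        = (\<Sum>k\<le>n. q ^ (n * (n + 1)) * (c k / (Q (n - k) * Q (n + 1 + k))) / Q (L - n))"
      by (simp only: sum_distrib_left sum_divide_distrib)
    then show "q ^ (n * (n + 1)) / ((\<Prod>k\<le>n. u k) * Q (L - n))
        = (\<Sum>k\<le>n. q ^ (n * (n + 1)) * (c k / (Q (n - k) * Q (n + 1 + k))) / Q (L - n))" by simp
  qed simp
  also have "\<dots> = (\<Sum>(n, k)\<in>(SIGMA n:{..L}. {..n}). q ^ (n * (n + 1)) * (c k / (Q (n - k) * Q (n + 1 + k))) / Q (L - n))"
    by (subst sum.Sigma) auto
  also have "\<dots> = (\<Sum>(k, m)\<in>(SIGMA k:{..L}. {..L - k}). q ^ ((k + m) * (k + m + 1)) *
      (c k / (Q m * Q (m + (2 * k + 1)))) / Q (L - k - m))"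
    by (rule sum.reindex_bij_witness[where i = "\<lambda>(k, m). (k + m, k)" and j = "\<lambda>(n, k). (k, n - k)"])
       (auto simp: add_ac mult_2)
  also have "\<dots> = (\<Sum>k\<le>L. \<Sum>m\<le>L - k. q ^ ((k + m) * (k + m + 1)) *
      (c k / (Q m * Q (m + (2 * k + 1)))) / Q (L - k - m))"
    by (subst sum.Sigma) auto
  also have "\<dots> = (\<Sum>k\<le>L. q ^ (k * (k + 1)) * c k *
      (\<Sum>m\<le>L - k. q ^ (m * (m + (2 * k + 1))) / (Q m * Q (m + (2 * k + 1)) * Q (L - k - m))))"
    unfolding sum_distrib_left
  proof (intro sum.cong refl)
    fix k m
    have "q ^ ((k + m) * (k + m + 1)) = q ^ (k * (k + 1)) * q ^ (m * (m + (2 * k + 1)))"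
      by (simp add: algebra_simps mult_2_right flip: power_add)
    then show "q ^ ((k + m) * (k + m + 1)) * (c k / (Q m * Q (m + (2 * k + 1)))) / Q (L - k - m) =
       q ^ (k * (k + 1)) * c k * (q ^ (m * (m + (2 * k + 1))) / (Q m * Q (m + (2 * k + 1)) * Q (L - k - m)))"
      by simp
  qed
  also have "\<dots> = (\<Sum>k\<le>L. q ^ (k * (k + 1)) * c k * (1 / (Q (L - k) * Q (L - k + (2 * k + 1)))))"
    unfolding Q_def using finite_cauchy[OF q] by (intro sum.cong arg_cong2[of _ _ _ _ "(*)"] refl)
  also have "\<dots> = (\<Sum>k\<le>L. q ^ (k * (k + 1)) * pf_coeff q L k / u k)"
  proof (intro sum.cong refl)
    fix k assume "k \<in> {..L}"
    then have "L - k + (2 * k + 1) = L + 1 + k" by auto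
    then show "q ^ (k * (k + 1)) * c k * (1 / (Q (L - k) * Q (L - k + (2 * k + 1)))) =
        q ^ (k * (k + 1)) * pf_coeff q L k / u k"
      by (simp only:) (simp add: c_def pf_coeff_def Q_def)
  qed
  finally show ?thesis by (simp add: Q_def)
qed

section \<open>Partial fractions with poles at the nodes and at their negatives\<close>

text \<open>Up to elementary factors, the value of \<open>\<Prod>j<n. 1 + q ^ (8 * j + 8) + q ^ (4 * j + 3) * z\<close>
  at the node \<open>z = 1 / q ^ (2 * k) + q ^ (2 * k + 2)\<close>; see lemma \<open>node_prod\<close>.\<close>

definition node_prod :: "'a::field \<Rightarrow> nat \<Rightarrow> nat \<Rightarrow> 'a" where
  "node_prod q n k = (if even k
     then qpochhammer (- (q ^ 3)) (q ^ 4) (n - k div 2) * qpochhammer (- q) (q ^ 4) (n + k div 2 + 1)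
     else qpochhammer (- q) (q ^ 4) (n - k div 2) * qpochhammer (- (q ^ 3)) (q ^ 4) (n + k div 2 + 1))"

text \<open>Here \<open>e\<close> is the parity of \<open>k\<close>, and \<open>a\<close> and
  \<open>1 + 2 * e\<close> are 3 and 1 in the order that it dictates. The induction raises
  \<open>k\<close> by 2, which shifts both products by exactly one factor. The first product then
  gains a factor with negative exponent; its denominator \<open>q ^ (2 * k + 1)\<close> is the
  growth of \<open>q ^ (k choose 2)\<close>.\<close>

lemma node_prod_aux:
  fixes q :: "'a::field"
  assumes q: "\<And>m. m > 0 \<Longrightarrow> q ^ m \<noteq> 1" and "q \<noteq> 0" and e: "a + 2 * e = 3" and "l \<le> n"
  defines "k \<equiv> 2 * l + e"
  shows "(\<Prod>j<n. 1 + q ^ (4 * j + 3) / q ^ (2 * k)) * (\<Prod>j<n. 1 + q ^ (4 * j + 5 + 2 * k)) *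
      q ^ (k choose 2) * (1 + q ^ (2 * k + 1)) =
      qpochhammer (- (q ^ a)) (q ^ 4) (n - l) * qpochhammer (- (q ^ (1 + 2 * e))) (q ^ 4) (n + l + 1)"
  using \<open>l \<le> n\<close> unfolding k_def
proof (induction l)
  case 0
  have a: "a = 3 \<and> e = 0 \<or> a = 1 \<and> e = 1" using e by presburger
  have 1: "(\<Prod>j<n. 1 + q ^ (4 * j + 3) / q ^ (2 * e)) = qpochhammer (- (q ^ a)) (q ^ 4) n"
    unfolding qpochhammer_def
  proof (rule prod.cong)
    fix j
    have "q ^ (4 * j + 3) = q ^ (4 * j + a) * q ^ (2 * e)"
      by (simp only: e[symmetric] add.assoc flip: power_add)
    moreover have "q ^ a * (q ^ 4) ^ j = q ^ (4 * j + a)"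
      by (simp only: add.commute[of "4 * j"] power_add power_mult)
    ultimately show "1 + q ^ (4 * j + 3) / q ^ (2 * e) = 1 - - (q ^ a) * (q ^ 4) ^ j"
      using \<open>q \<noteq> 0\<close> by simp
  qed simp
  have 2: "(\<Prod>j<n. 1 + q ^ (4 * j + 5 + 2 * e)) * (1 + q ^ (2 * e + 1))
      = qpochhammer (- (q ^ (1 + 2 * e))) (q ^ 4) (n + 1)"
  proof -
    have "1 - - (q ^ (1 + 2 * e)) * (q ^ 4) ^ j = 1 + q ^ (4 * j + (1 + 2 * e))" for j
      by (simp only: add.commute[of "4 * j"] power_add power_mult) simp
    then have "qpochhammer (- (q ^ (1 + 2 * e))) (q ^ 4) (n + 1) = (\<Prod>j<Suc n. 1 + q ^ (4 * j + (1 + 2 * e)))"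
      by (simp only: qpochhammer_def Suc_eq_plus1)
    moreover have "4 * Suc j + (1 + 2 * e) = 4 * j + 5 + 2 * e" for j by simp
    ultimately show ?thesis
      by (simp only: prod.lessThan_Suc_shift) (simp add: mult.commute)
  qed
  have 3: "e choose 2 = 0" using a by auto
  show ?case
    using 1 2 by (simp only: 3 mult_0_right add_0 add_0_right diff_zero power_0 mult_1_right mult.assoc)
next
  case (Suc l)
  define k where "k = 2 * l + e"
  obtain r where n: "n = Suc (l + r)" using Suc.prems by (auto simp: Suc_le_eq less_iff_Suc_add)
  have nz: "1 + q ^ m \<noteq> 0" if "m > 0" for m
  proof
    assume "1 + q ^ m = 0"
    then have "q ^ m = -1" by (metis add_eq_0_iff)
    then have "q ^ (2 * m) = 1" by (simp add: power_even_eq)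
    then show False using q[of "2 * m"] that by simp
  qed
  define P1 where "P1 = (\<lambda>k. \<Prod>j<n. 1 + q ^ (4 * j + 3) / q ^ (2 * k))"
  define P2 where "P2 = (\<lambda>k. \<Prod>j<n. 1 + q ^ (4 * j + 5 + 2 * k))"
  have k2: "2 * Suc l + e = k + 2" by (simp add: k_def)
  have s1: "P1 (k + 2) * (1 + q ^ (4 * r + a)) = P1 k * (1 + q ^ (2 * k + 1)) / q ^ (2 * k + 1)"
  proof -
    define h where "h = (\<lambda>j. 1 + q ^ (4 * j + 3) / q ^ (2 * (k + 2)))"
    have hS: "h (Suc j) = 1 + q ^ (4 * j + 3) / q ^ (2 * k)" for j
    proof -
      have "q ^ (4 * Suc j + 3) = q ^ (4 * j + 3) * q ^ 4" "q ^ (2 * (k + 2)) = q ^ (2 * k) * q ^ 4"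
        unfolding power_add[symmetric] by (rule arg_cong[of _ _ "(^) q"], simp)+
      then show ?thesis using \<open>q \<noteq> 0\<close> by (simp only: h_def) simp
    qed
    have "(\<Prod>j<n. h j) * h n = h 0 * (\<Prod>j<n. h (Suc j))"
      by (metis prod.lessThan_Suc prod.lessThan_Suc_shift)
    moreover have "h n = 1 + q ^ (4 * r + a)"
    proof -
      have "4 * n + 3 = (4 * r + a) + 2 * (k + 2)" using e by (simp add: n k_def)
      then have "q ^ (4 * n + 3) = q ^ (4 * r + a) * q ^ (2 * (k + 2))"
        unfolding power_add[symmetric] by (rule arg_cong)
      then show ?thesis using \<open>q \<noteq> 0\<close> by (simp only: h_def) simp
    qed
    moreover have "h 0 = (1 + q ^ (2 * k + 1)) / q ^ (2 * k + 1)"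
    proof -
      have "q ^ (2 * (k + 2)) = q ^ (2 * k + 1) * q ^ 3"
        unfolding power_add[symmetric] by (rule arg_cong[of _ _ "(^) q"], simp)
      moreover have "1 + q ^ 3 / (a * q ^ 3) = (1 + a) / a" if "a \<noteq> 0" for a
        using that \<open>q \<noteq> 0\<close> by (simp add: divide_simps)
      moreover have "q ^ (2 * k + 1) \<noteq> 0" using \<open>q \<noteq> 0\<close> by simp
      ultimately show ?thesis by (simp only: h_def mult_0_right add_0)
    qed
    moreover have "P1 (k + 2) = (\<Prod>j<n. h j)" "P1 k = (\<Prod>j<n. h (Suc j))"
      by (simp_all only: P1_def h_def hS[unfolded h_def])
    ultimately show ?thesis by (simp only: times_divide_eq_right ac_simps)
  qed
  have s2: "P2 (k + 2) * (1 + q ^ (2 * k + 5)) = P2 k * (1 + q ^ (4 * n + 5 + 2 * k))"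
  proof -
    define h where "h = (\<lambda>j. 1 + q ^ (4 * j + 5 + 2 * k))"
    have "(\<Prod>j<n. h j) * h n = h 0 * (\<Prod>j<n. h (Suc j))"
      by (metis prod.lessThan_Suc prod.lessThan_Suc_shift)
    moreover have "h (Suc j) = 1 + q ^ (4 * j + 5 + 2 * (k + 2))" for j
      unfolding h_def by (rule arg_cong[of _ _ "\<lambda>i. 1 + q ^ i"]) simp
    moreover have "h 0 = 1 + q ^ (2 * k + 5)"
      unfolding h_def by (rule arg_cong[of _ _ "\<lambda>i. 1 + q ^ i"]) simp
    ultimately show ?thesis by (simp only: P2_def h_def ac_simps)
  qed
  have c: "(k + 2 choose 2) = (k choose 2) + (2 * k + 1)"
    by (simp add: numeral_2_eq_2)
  have IH: "P1 k * P2 k * q ^ (k choose 2) * (1 + q ^ (2 * k + 1)) =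
      qpochhammer (- (q ^ a)) (q ^ 4) (n - l) * qpochhammer (- (q ^ (1 + 2 * e))) (q ^ 4) (n + l + 1)"
    using Suc by (simp only: P1_def P2_def k_def Suc_leD)
  have nl: "n - l = Suc r" "n - Suc l = r" "n + Suc l + 1 = Suc (n + l + 1)" by (simp_all add: n)
  \<comment> \<open>The factor \<open>1 + q ^ (4 * r + a)\<close> that the first product loses is
    multiplied in, to avoid a division, and cancelled at the end.\<close>
  have "P1 (k + 2) * P2 (k + 2) * q ^ (k + 2 choose 2) * (1 + q ^ (2 * (k + 2) + 1)) * (1 + q ^ (4 * r + a))
      = (P1 (k + 2) * (1 + q ^ (4 * r + a))) * (P2 (k + 2) * (1 + q ^ (2 * k + 5))) *
        (q ^ (k choose 2) * q ^ (2 * k + 1))"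
  proof -
    have "2 * (k + 2) + 1 = 2 * k + 5" by simp
    moreover have "q ^ (k + 2 choose 2) = q ^ (k choose 2) * q ^ (2 * k + 1)"
      unfolding c by (rule power_add)
    ultimately show ?thesis by (simp only: mult_ac)
  qed
  also have "\<dots> = (P1 k * P2 k * q ^ (k choose 2) * (1 + q ^ (2 * k + 1))) * (1 + q ^ (4 * n + 5 + 2 * k))"
    unfolding s1 s2 using \<open>q \<noteq> 0\<close> by simp
  also have "\<dots> = qpochhammer (- (q ^ a)) (q ^ 4) r *
      qpochhammer (- (q ^ (1 + 2 * e))) (q ^ 4) (n + Suc l + 1) * (1 + q ^ (4 * r + a))"
  proof -
    have "1 - - (q ^ a) * (q ^ 4) ^ r = 1 + q ^ (4 * r + a)"
      by (simp add: power_add power_mult)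
    moreover have "1 - - (q ^ (1 + 2 * e)) * (q ^ 4) ^ (n + l + 1) = 1 + q ^ (4 * n + 5 + 2 * k)"
    proof -
      have "q ^ (1 + 2 * e) * (q ^ 4) ^ (n + l + 1) = q ^ (4 * n + 5 + 2 * k)"
        unfolding power_mult[symmetric] power_add[symmetric]
        by (rule arg_cong[of _ _ "(^) q"]) (simp add: k_def)
      then show ?thesis by (simp only: mult_minus_left diff_minus_eq_add)
    qed
    ultimately show ?thesis unfolding IH nl qpochhammer_Suc by (simp only: mult_ac)
  qed
  finally have *: "P1 (k + 2) * P2 (k + 2) * q ^ (k + 2 choose 2) * (1 + q ^ (2 * (k + 2) + 1)) * (1 + q ^ (4 * r + a))
      = qpochhammer (- (q ^ a)) (q ^ 4) r *
      qpochhammer (- (q ^ (1 + 2 * e))) (q ^ 4) (n + Suc l + 1) * (1 + q ^ (4 * r + a))" .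
  have "a > 0" using e by presburger
  then have "1 + q ^ (4 * r + a) \<noteq> 0" by (intro nz) simp
  with * show ?case
    unfolding k2 nl(2) P1_def P2_def mult_cancel_right by blast
qed

lemma node_prod:
  fixes q :: "'a::field"
  assumes q: "\<And>m. m > 0 \<Longrightarrow> q ^ m \<noteq> 1" and "q \<noteq> 0" and "k \<le> 2 * n + 1"
  shows "(\<Prod>j<n. 1 + q ^ (8 * j + 8) + q ^ (4 * j + 3) * (1 / q ^ (2 * k) + q ^ (2 * k + 2))) *
      q ^ (k choose 2) * (1 + q ^ (2 * k + 1)) = node_prod q n k"
proof -
  have eq: "1 + q ^ (8 * j + 8) + q ^ (4 * j + 3) * (1 / q ^ (2 * k) + q ^ (2 * k + 2))
      = (1 + q ^ (4 * j + 3) / q ^ (2 * k)) * (1 + q ^ (4 * j + 5 + 2 * k))" for j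
  proof -
    have "8 * j + 8 = (4 * j + 3) + (4 * j + 5)" by simp
    then have "q ^ (8 * j + 8) * q ^ (2 * k) = q ^ (4 * j + 3) * q ^ (4 * j + 5 + 2 * k)"
      by (simp only: power_add ac_simps)
    moreover have "q ^ (4 * j + 3) * q ^ (2 * k + 2) = q ^ (4 * j + 5 + 2 * k)"
      by (simp only: add_ac flip: power_add) simp
    ultimately show ?thesis using \<open>q \<noteq> 0\<close> by (simp add: field_simps)
  qed
  show ?thesis
    unfolding eq prod.distrib
  proof (cases "even k")
    case True
    then obtain l where k: "k = 2 * l + 0" by (elim evenE) simp
    then have l: "k div 2 = l" "l \<le> n" using assms(3) by auto
    show "(\<Prod>j<n. 1 + q ^ (4 * j + 3) / q ^ (2 * k)) * (\<Prod>j<n. 1 + q ^ (4 * j + 5 + 2 * k)) *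
        q ^ (k choose 2) * (1 + q ^ (2 * k + 1)) = node_prod q n k"
      using node_prod_aux[OF q \<open>q \<noteq> 0\<close>, of 3 0 l n, folded k] l True
      by (simp only: node_prod_def if_True) simp
  next
    case False
    then obtain l where k: "k = 2 * l + 1" by (elim oddE)
    then have l: "k div 2 = l" "l \<le> n" using assms(3) by auto
    show "(\<Prod>j<n. 1 + q ^ (4 * j + 3) / q ^ (2 * k)) * (\<Prod>j<n. 1 + q ^ (4 * j + 5 + 2 * k)) *
        q ^ (k choose 2) * (1 + q ^ (2 * k + 1)) = node_prod q n k"
      using node_prod_aux[OF q \<open>q \<noteq> 0\<close>, of 1 1 l n, folded k] l False
      by (simp only: node_prod_def if_False) (simp add: numeral_3_eq_3)
  qed
qed

text \<open>At the node, the numerator's value times \<open>pf_coeff (q ^ 4) n k\<close>, divided by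
  \<open>1 + q ^ (4 * k + 2)\<close>, which is half of the nonvanishing factor
  \<open>u (- z) k\<close>. The exponent is \<open>4 * (Suc k choose 2) - (k choose 2)\<close>, the
  subtracted part being absorbed by \<open>node_prod\<close>.\<close>

definition pf_coeff2 :: "'a::field \<Rightarrow> nat \<Rightarrow> nat \<Rightarrow> 'a" where
  "pf_coeff2 q n k = (-1) ^ k * q ^ (3 * (Suc k choose 2) + k) * (1 - q ^ (2 * k + 1)) * node_prod q n k /
     (qpochhammer (q ^ 4) (q ^ 4) (n - k) * qpochhammer (q ^ 4) (q ^ 4) (n + 1 + k))"

text \<open>At node \<open>k\<close> the factor \<open>u z k\<close> vanishes, so only the summand
  \<open>i = k\<close> survives. The remaining product is evaluated by applying
  \<open>partial_fractions\<close> with base \<open>q ^ 4\<close> at the same point, where again a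
  single summand survives.\<close>

lemma partial_fractions2_node:
  fixes q :: "'a::field"
  assumes q: "\<And>m. m > 0 \<Longrightarrow> q ^ m \<noteq> 1" and "q \<noteq> 0" and "k \<le> n"
  defines "u \<equiv> \<lambda>z k. 1 + q ^ (4 * k + 2) - z * q ^ (2 * k)"
  defines "z \<equiv> 1 / q ^ (2 * k) + q ^ (2 * k + 2)"
  shows "2 * (\<Prod>j<n. 1 + q ^ (8 * j + 8) + q ^ (4 * j + 3) * z) =
    (\<Sum>i\<le>n. (pf_coeff2 q n i * u (- z) i + pf_coeff2 (- q) n i * u z i) * (\<Prod>j\<in>{..n} - {i}. u z j * u (- z) j))"
proof -
  have uk: "u z k = 0"
  proof -
    have "q ^ (2 * k + 2) * q ^ (2 * k) = q ^ (4 * k + 2)" by (simp flip: power_add)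
    then show ?thesis using \<open>q \<noteq> 0\<close> by (simp add: u_def z_def field_simps)
  qed
  have umk: "u (- z) k = 2 * (1 + q ^ (4 * k + 2))"
    using uk by (simp add: u_def)
  define W where "W = (\<Prod>j\<in>{..n} - {k}. u z j * u (- z) j)"
  have q4: "(q ^ 4) ^ m \<noteq> 1" if "m > 0" for m
    using q[of "4 * m"] that by (simp add: power_mult)
  have uu: "u z j * u (- z) j = 1 + (q ^ 4) ^ (2 * j + 1) - (z ^ 2 - 2 * q ^ 2) * (q ^ 4) ^ j" for j
  proof -
    define a where "a = q ^ (2 * j)"
    have "q ^ (4 * j + 2) = a ^ 2 * q ^ 2" "(q ^ 4) ^ (2 * j + 1) = a ^ 4 * q ^ 4" "(q ^ 4) ^ j = a ^ 2"
      by (simp_all only: a_def power_add mult_1_right flip: power_mult)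
         (simp_all add: ac_simps flip: power_mult)
    then show ?thesis
      by (simp only: u_def flip: a_def) (simp add: algebra_simps power2_eq_square eval_nat_numeral)
  qed
  have sum: "(\<Sum>i\<le>n. pf_coeff (q ^ 4) n i * (\<Prod>j\<in>{..n} - {i}. u z j * u (- z) j)) = 1"
    using partial_fractions[OF q4, where z = "z ^ 2 - 2 * q ^ 2" and n = n] \<open>q \<noteq> 0\<close> by (simp add: uu)
  have vanish: "(\<Prod>j\<in>{..n} - {i}. u z j * u (- z) j) = 0" if "i \<noteq> k" for i
    using that \<open>k \<le> n\<close> uk by (intro prod_zero) auto
  have W: "pf_coeff (q ^ 4) n k * W = 1"
  proof -
    have "(\<Sum>i\<le>n. pf_coeff (q ^ 4) n i * (\<Prod>j\<in>{..n} - {i}. u z j * u (- z) j))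
        = (\<Sum>i\<in>{k}. pf_coeff (q ^ 4) n i * (\<Prod>j\<in>{..n} - {i}. u z j * u (- z) j))"
      by (rule sum.mono_neutral_right) (use \<open>k \<le> n\<close> vanish in auto)
    then show ?thesis using sum by (simp add: W_def)
  qed
  have "(\<Sum>i\<le>n. (pf_coeff2 q n i * u (- z) i + pf_coeff2 (- q) n i * u z i) * (\<Prod>j\<in>{..n} - {i}. u z j * u (- z) j))
      = (\<Sum>i\<in>{k}. (pf_coeff2 q n i * u (- z) i + pf_coeff2 (- q) n i * u z i) * (\<Prod>j\<in>{..n} - {i}. u z j * u (- z) j))"
    by (rule sum.mono_neutral_right) (use \<open>k \<le> n\<close> vanish in auto)
  also have "\<dots> = 2 * (pf_coeff2 q n k * (1 + q ^ (4 * k + 2))) * W"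
    by (simp add: uk umk W_def)
  also have "pf_coeff2 q n k * (1 + q ^ (4 * k + 2)) =
      (\<Prod>j<n. 1 + q ^ (8 * j + 8) + q ^ (4 * j + 3) * z) * pf_coeff (q ^ 4) n k"
  proof -
    define N where "N = (\<Prod>j<n. 1 + q ^ (8 * j + 8) + q ^ (4 * j + 3) * z)"
    have M: "node_prod q n k = N * q ^ (k choose 2) * (1 + q ^ (2 * k + 1))"
      using node_prod[OF q \<open>q \<noteq> 0\<close>, of k n] \<open>k \<le> n\<close> by (simp add: N_def z_def)
    have e: "q ^ (3 * (Suc k choose 2) + k) * q ^ (k choose 2) = (q ^ 4) ^ (Suc k choose 2)"
    proof -
      have "3 * (Suc k choose 2) + k + (k choose 2) = 4 * (Suc k choose 2)"
        by (simp add: Suc_choose_2)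
      then show ?thesis by (simp only: flip: power_add power_mult)
    qed
    have f: "(1 - q ^ (2 * k + 1)) * (1 + q ^ (2 * k + 1)) * (1 + q ^ (4 * k + 2)) = 1 - (q ^ 4) ^ (2 * k + 1)"
    proof -
      define a where "a = q ^ (2 * k + 1)"
      have "q ^ (4 * k + 2) = a ^ 2" "(q ^ 4) ^ (2 * k + 1) = a ^ 4"
        unfolding a_def power_mult[symmetric] by (rule arg_cong[of _ _ "(^) q"], simp)+
      then show ?thesis by (simp only: flip: a_def) (simp add: algebra_simps eval_nat_numeral)
    qed
    show ?thesis
      unfolding pf_coeff2_def pf_coeff_def M f[symmetric] e[symmetric] N_def[symmetric]
      by (simp only: times_divide_eq_left times_divide_eq_right ac_simps)
  qed
  finally show ?thesis using W by (simp add: mult.assoc)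
qed

text \<open>Both sides are polynomials in \<open>z\<close> of degree at most \<open>2 * n + 1\<close>, so it suffices to compare them
  at the nodes \<open>1 / q ^ (2 * k) + q ^ (2 * k + 2)\<close> with \<open>k \<le> n\<close> and at their negatives. Changing the
  sign of \<open>q\<close> exchanges the two kinds of nodes.\<close>

lemma partial_fractions2_poly:
  fixes q z :: "'a::field"
  assumes q: "\<And>m. m > 0 \<Longrightarrow> q ^ m \<noteq> 1" and "q \<noteq> 0" and two: "(2 :: 'a) \<noteq> 0"
  defines "u \<equiv> \<lambda>z k. 1 + q ^ (4 * k + 2) - z * q ^ (2 * k)"
  shows "2 * (\<Prod>j<n. 1 + q ^ (8 * j + 8) + q ^ (4 * j + 3) * z) =
    (\<Sum>i\<le>n. (pf_coeff2 q n i * u (- z) i + pf_coeff2 (- q) n i * u z i) * (\<Prod>j\<in>{..n} - {i}. u z j * u (- z) j))"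
proof -
  define L where "L = smult 2 (\<Prod>j<n. [:1 + q ^ (8 * j + 8), q ^ (4 * j + 3):])"
  define pu where "pu = (\<lambda>k. [:1 + q ^ (4 * k + 2), - (q ^ (2 * k)):])"
  define pv where "pv = (\<lambda>k. [:1 + q ^ (4 * k + 2), q ^ (2 * k):])"
  define R where "R = (\<Sum>i\<le>n. (smult (pf_coeff2 q n i) (pv i) + smult (pf_coeff2 (- q) n i) (pu i)) *
      (\<Prod>j\<in>{..n} - {i}. pu j * pv j))"
  have pu: "poly (pu k) z = u z k" and pv: "poly (pv k) z = u (- z) k" for k z
    by (simp_all add: pu_def pv_def u_def)
  have L: "poly L z = 2 * (\<Prod>j<n. 1 + q ^ (8 * j + 8) + q ^ (4 * j + 3) * z)" for z
    by (simp add: L_def poly_prod mult.commute)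
  have R: "poly R z = (\<Sum>i\<le>n. (pf_coeff2 q n i * u (- z) i + pf_coeff2 (- q) n i * u z i) *
      (\<Prod>j\<in>{..n} - {i}. u z j * u (- z) j))" for z
    by (simp add: R_def poly_sum poly_prod pu pv)
  define t where "t = (\<lambda>k. 1 / q ^ (2 * k) + q ^ (2 * k + 2))"
  define A where "A = t ` {..n} \<union> (\<lambda>k. - t k) ` {..n}"
  have pos: "poly L (t k) = poly R (t k)" if "k \<le> n" for k
    unfolding L R t_def u_def using partial_fractions2_node[OF q \<open>q \<noteq> 0\<close> that] by simp
  have mq: "(- q) ^ m \<noteq> 1" if "m > 0" for m
  proof
    assume "(- q) ^ m = 1"
    then have "q ^ (2 * m) = 1" by (metis power_even_eq power2_minus power_mult mult.commute power_one)
    then show False using q[of "2 * m"] that by simp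
  qed
  have neg: "poly L (- t k) = poly R (- t k)" if "k \<le> n" for k
  proof -
    have "(- q) ^ (4 * j + 3) = - (q ^ (4 * j + 3))" for j by simp
    moreover have "(- q) ^ (8 * j + 8) = q ^ (8 * j + 8)" for j by simp
    moreover have "1 / (- q) ^ (2 * k) + (- q) ^ (2 * k + 2) = t k" by (simp add: t_def)
    moreover have "1 + (- q) ^ (4 * i + 2) - y * (- q) ^ (2 * i) = u y i" for i y
      by (simp add: u_def)
    ultimately have "2 * (\<Prod>j<n. 1 + q ^ (8 * j + 8) + - (q ^ (4 * j + 3)) * t k) =
      (\<Sum>i\<le>n. (pf_coeff2 (- q) n i * u (- t k) i + pf_coeff2 (- (- q)) n i * u (t k) i) *
        (\<Prod>j\<in>{..n} - {i}. u (t k) j * u (- t k) j))"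
      using partial_fractions2_node[OF mq, of k n] \<open>q \<noteq> 0\<close> that
      by (simp only: neg_equal_0_iff_equal not_False_eq_True)
    then show ?thesis
      unfolding L R minus_minus by (simp only: mult_minus_left mult_minus_right ac_simps)
  qed
  \<comment> \<open>For \<open>s = 1\<close> this separates the nodes, for \<open>s = -1\<close> it
    separates nodes from negatives of nodes. With denominators cleared, equality factors into two
    equations whose squares say that a power of \<open>q\<close> is 1. Only \<open>j = k\<close>
    with \<open>s = -1\<close> remains, and there characteristic 2 would be forced.\<close>
  have inj: "t k \<noteq> s * t j" if "s ^ 2 = 1" "s = -1 \<or> j < k" "j \<le> k" for j k s
  proof
    assume eq: "t k = s * t j"
    obtain r where k: "k = j + r" using \<open>j \<le> k\<close> by (auto simp: le_iff_add)
    define a where "a = q ^ (2 * j)"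
    define b where "b = q ^ (2 * r)"
    have a0: "a \<noteq> 0" "b \<noteq> 0" using \<open>q \<noteq> 0\<close> by (auto simp: a_def b_def)
    have pw: "q ^ (2 * k) = a * b" "q ^ (2 * j + 2) = a * q ^ 2" "q ^ (2 * k + 2) = a * b * q ^ 2"
      by (simp_all only: k a_def b_def power_add add_mult_distrib2)
    have "1 / (a * b) + a * b * q ^ 2 - s * (1 / a + a * q ^ 2) = 0"
      using eq by (simp only: t_def pw) (simp add: a_def)
    moreover have "1 / (a * b) + a * b * q ^ 2 - s * (1 / a + a * q ^ 2)
        = ((1 + a * b * (a * b) * q ^ 2) - s * (b + a * a * b * q ^ 2)) / (a * b)"
      using a0 by (simp add: divide_simps) (simp add: algebra_simps)
    ultimately have "(1 + a * b * (a * b) * q ^ 2) - s * (b + a * a * b * q ^ 2) = 0"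
      using a0 by simp
    moreover have "(1 - s * b) * (1 - s * (a * a * b * q ^ 2)) =
        1 + (s ^ 2) * a * b * (a * b) * q ^ 2 - s * (b + a * a * b * q ^ 2)"
      by (simp add: algebra_simps power2_eq_square)
    ultimately have "(1 - s * b) * (1 - s * (a * a * b * q ^ 2)) = 0"
      using that(1) by simp
    then have "s * b = 1 \<or> s * (a * a * b * q ^ 2) = 1"
      by (simp only: mult_eq_0_iff right_minus_eq) metis
    then have "(s * b) ^ 2 = 1 \<or> (s * (a * a * b * q ^ 2)) ^ 2 = 1" by auto
    then have "b ^ 2 = 1 \<or> (a * a * b * q ^ 2) ^ 2 = 1"
      using that(1) by (simp add: power_mult_distrib)
    moreover have "(a * a * b * q ^ 2) ^ 2 \<noteq> 1"
    proof -
      have "(a * a * b * q ^ 2) ^ 2 = q ^ (2 * (2 * j + 2 * j + 2 * r + 2))"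
        by (simp only: power_add power_even_eq[of q "_ + _"] flip: a_def b_def)
      then show ?thesis using q[of "2 * (2 * j + 2 * j + 2 * r + 2)"] by simp
    qed
    ultimately have "b ^ 2 = 1" by blast
    then have "q ^ (4 * r) = 1" by (simp add: b_def flip: power_mult)
    then have r: "r = 0" using q[of "4 * r"] by auto
    then have "s = -1" using that k by auto
    moreover have "s * b = 1 \<or> s * (a * a * b * q ^ 2) = 1" by fact
    ultimately have "a * a * b * q ^ 2 = -1 \<or> (2::'a) = 0"
      using r by (auto simp: b_def minus_equation_iff)
    then have "a * a * b * q ^ 2 = -1" using two by simp
    then have "(a * a * b * q ^ 2) ^ 2 = 1" by simp
    then show False using \<open>(a * a * b * q ^ 2) ^ 2 \<noteq> 1\<close> by simp
  qed
  have "inj_on t {..n}"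
  proof (rule linorder_inj_onI)
    fix j k :: nat assume "j < k" then show "t j \<noteq> t k" using inj[of 1 j k] by auto
  qed auto
  moreover have ne: "t j \<noteq> - t k" for j k
  proof (cases "j \<le> k")
    case True
    then show ?thesis using inj[of "-1" j k] by (auto simp: minus_equation_iff)
  next
    case False
    then show ?thesis using inj[of "-1" k j] by auto
  qed
  ultimately have "card A = 2 * (n + 1)"
    unfolding A_def by (subst card_Un_disjoint) (auto simp: card_image inj_on_def)
  moreover have "degree L \<le> n"
  proof -
    have "degree (\<Prod>j<n. [:1 + q ^ (8 * j + 8), q ^ (4 * j + 3):]) \<le> (\<Sum>j<n. 1)"
      by (rule order_trans[OF degree_prod_sum_le sum_mono]) auto
    then show ?thesis by (simp add: L_def)
  qed
  moreover have "degree R \<le> 2 * n + 1"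
    unfolding R_def
  proof (rule degree_sum_le)
    fix i assume "i \<in> {..n}"
    have "degree (\<Prod>j\<in>{..n} - {i}. pu j * pv j) \<le> (\<Sum>j\<in>{..n} - {i}. 2)"
    proof (rule order_trans[OF degree_prod_sum_le sum_mono])
      fix j
      show "(degree \<circ> (\<lambda>j. pu j * pv j)) j \<le> 2"
        using degree_mult_le[of "pu j" "pv j"] by (auto simp: pu_def pv_def split: if_splits)
    qed simp
    also have "\<dots> = 2 * n" using \<open>i \<in> {..n}\<close> by simp
    finally have "degree (\<Prod>j\<in>{..n} - {i}. pu j * pv j) \<le> 2 * n" .
    moreover have "degree (smult (pf_coeff2 q n i) (pv i) + smult (pf_coeff2 (- q) n i) (pu i)) \<le> 1"
      by (intro degree_add_le order_trans[OF degree_smult_le]) (auto simp: pu_def pv_def)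
    ultimately show "degree ((smult (pf_coeff2 q n i) (pv i) + smult (pf_coeff2 (- q) n i) (pu i)) *
        (\<Prod>j\<in>{..n} - {i}. pu j * pv j)) \<le> 2 * n + 1"
      using degree_mult_le[of "smult (pf_coeff2 q n i) (pv i) + smult (pf_coeff2 (- q) n i) (pu i)"
         "\<Prod>j\<in>{..n} - {i}. pu j * pv j"] by linarith
  qed simp
  ultimately have "L = R"
    by (intro poly_eqI_degree[of A]) (auto simp: A_def pos neg)
  then show ?thesis using L[of z] R[of z] by simp
qed

lemma partial_fractions2:
  fixes q z :: "'a::field"
  assumes q: "\<And>m. m > 0 \<Longrightarrow> q ^ m \<noteq> 1" and "q \<noteq> 0" and two: "(2 :: 'a) \<noteq> 0"
  defines "u \<equiv> \<lambda>z k. 1 + q ^ (4 * k + 2) - z * q ^ (2 * k)"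
  assumes u: "\<And>k. u z k \<noteq> 0" "\<And>k. u (- z) k \<noteq> 0"
  shows "2 * (\<Prod>j<n. 1 + q ^ (8 * j + 8) + q ^ (4 * j + 3) * z) / (\<Prod>k\<le>n. u z k * u (- z) k) =
    (\<Sum>k\<le>n. pf_coeff2 q n k / u z k + pf_coeff2 (- q) n k / u (- z) k)"
proof -
  define W where "W = (\<Prod>k\<le>n. u z k * u (- z) k)"
  have "2 * (\<Prod>j<n. 1 + q ^ (8 * j + 8) + q ^ (4 * j + 3) * z) / W
      = (\<Sum>i\<le>n. (pf_coeff2 q n i * u (- z) i + pf_coeff2 (- q) n i * u z i) *
        (\<Prod>j\<in>{..n} - {i}. u z j * u (- z) j) / W)"
    using partial_fractions2_poly[OF q \<open>q \<noteq> 0\<close> two, where n = n and z = z] by (simp add: u_def sum_divide_distrib)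
  also have "\<dots> = (\<Sum>k\<le>n. pf_coeff2 q n k / u z k + pf_coeff2 (- q) n k / u (- z) k)"
  proof (rule sum.cong)
    fix i assume "i \<in> {..n}"
    define V where "V = (\<Prod>j\<in>{..n} - {i}. u z j * u (- z) j)"
    have "V \<noteq> 0" using u by (simp add: V_def)
    moreover have "W = u z i * u (- z) i * V"
      unfolding W_def V_def using \<open>i \<in> {..n}\<close> by (intro prod.remove) auto
    moreover have "(a * y + b * x) * V / (x * y * V) = a / x + b / y" if "V \<noteq> 0" "x \<noteq> 0" "y \<noteq> 0" for a b x y
      using that by (simp add: field_simps)
    ultimately show "(pf_coeff2 q n i * u (- z) i + pf_coeff2 (- q) n i * u z i) *
        (\<Prod>j\<in>{..n} - {i}. u z j * u (- z) j) / W = pf_coeff2 q n i / u z i + pf_coeff2 (- q) n i / u (- z) i"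
      using u by (simp only: simp_thms flip: V_def)
  qed simp
  finally show ?thesis by (simp add: W_def)
qed

subsection \<open>Limits of the finite identities\<close>

lemma to_fract_power [simp]: "to_fract (x ^ n) = to_fract x ^ n"
  by (induction n) simp_all

lemma to_fract_sum [simp]: "to_fract (\<Sum>i\<in>A. f i) = (\<Sum>i\<in>A. to_fract (f i))"
  by (induction A rule: infinite_finite_induct) simp_all

lemma to_fract_prod [simp]: "to_fract (\<Prod>i\<in>A. f i) = (\<Prod>i\<in>A. to_fract (f i))"
  by (induction A rule: infinite_finite_induct) simp_all

lemma to_fract_of_nat [simp]: "to_fract (of_nat n) = of_nat n"
  by (induction n) simp_all

lemma fps_prod_nth_0: "(\<Prod>i\<in>A. f i) $ 0 = (\<Prod>i\<in>A. f i $ 0 :: 'a::comm_ring_1)"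
  by (induction A rule: infinite_finite_induct) simp_all

lemma to_fract_qpochhammer [simp]:
  "to_fract (qpochhammer a q n) = qpochhammer (to_fract a) (to_fract q) n"
  by (simp add: qpochhammer_def)

text \<open>The finite identities need a field; they are applied in the fraction field and pulled
  back along the injective \<open>to_fract\<close>. This works because every denominator has
  constant term 1 and is thus already invertible as a series.\<close>

lemma to_fract_rinv:
  fixes f :: "'a::idom fps"
  assumes "f $ 0 = 1"
  shows "to_fract (rinv f) = 1 / to_fract f"
proof -
  have "to_fract f * to_fract (rinv f) = 1"
    using rinv_right[OF assms] by (metis to_fract_1 to_fract_mult)
  moreover have "f \<noteq> 0" using assms by auto
  ultimately show ?thesis by (simp add: field_simps)
qed

lemma fps_power_neq_1:
  fixes q :: "'a::idom fps"
  assumes "q $ 0 = 0" "n > 0"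
  shows "q ^ n \<noteq> 1"
proof
  assume "q ^ n = 1"
  then have "(q ^ n) $ 0 = 1" by simp
  then show False using assms by (simp add: fps_nth_power_0 zero_power)
qed

lemma to_fract_power_neq_1:
  fixes q :: "'a::idom fps"
  assumes "q $ 0 = 0" "n > 0"
  shows "to_fract q ^ n \<noteq> 1"
  using fps_power_neq_1[OF assms] by (metis to_fract_1 to_fract_eq_iff to_fract_power)

lemma fps_power_mult_nth_eq_0:
  fixes q f :: "'a::comm_ring_1 fps"
  assumes "q $ 0 = 0" "i < m"
  shows "(q ^ m * f) $ i = 0"
  using assms startsby_zero_power_prefix[of q m]
  by (auto simp: fps_mult_nth intro!: sum.neutral)

lemma Suc_choose_2_ge: "k \<le> Suc k choose 2"
  by (simp add: Suc_choose_2)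

lemma tendsto_shift_sub: "f \<longlonglongrightarrow> l \<Longrightarrow> (\<lambda>n. f (n - k)) \<longlonglongrightarrow> l"
  by (rule filterlim_compose[OF _ filterlim_minus_const_nat_at_top])

lemma tendsto_shift_add: "f \<longlonglongrightarrow> l \<Longrightarrow> (\<lambda>n. f (n + k)) \<longlonglongrightarrow> l"
  by (rule LIMSEQ_ignore_initial_segment)

definition fps_pf_coeff :: "'a::idom fps \<Rightarrow> nat \<Rightarrow> nat \<Rightarrow> 'a fps" where
  "fps_pf_coeff q n k = (-1) ^ k * q ^ (Suc k choose 2) * (1 - q ^ (2 * k + 1)) *
     rinv (qpochhammer q q (n - k) * qpochhammer q q (n + 1 + k))"

lemma to_fract_pf_coeff:
  assumes "q $ 0 = 0"
  shows "to_fract (fps_pf_coeff q n k) = pf_coeff (to_fract q) n k"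
  using assms
  by (simp add: fps_pf_coeff_def pf_coeff_def to_fract_rinv qpochhammer_fps_nth_0)

lemma fps_pf_coeff_tendsto:
  assumes "q $ 0 = 0"
  shows "(\<lambda>n. fps_pf_coeff q n k) \<longlonglongrightarrow>
     (-1) ^ k * q ^ (Suc k choose 2) * (1 - q ^ (2 * k + 1)) * rinv (qinf q q ^ 2)"
proof -
  have "(\<lambda>n. qpochhammer q q (n - k)) \<longlonglongrightarrow> qinf q q"
    by (rule tendsto_shift_sub[OF qpochhammer_tendsto[OF assms assms]])
  moreover have "(\<lambda>n. qpochhammer q q (n + (1 + k))) \<longlonglongrightarrow> qinf q q"
    by (rule tendsto_shift_add[OF qpochhammer_tendsto[OF assms assms]])
  ultimately show ?thesis
    unfolding fps_pf_coeff_def power2_eq_square[of "qinf q q"] add.assoc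
    by (intro fps_tendsto_mult fps_tendsto_rinv tendsto_const)
qed

section \<open>Two Appell sums, with \<open>x'\<close> playing the part of q / x\<close>

context
  fixes q x x' :: "'a::idom fps" and u
  assumes xx': "x * x' = q" and q0: "q \<noteq> 0" and x0: "x $ 0 = 0" and x0': "x' $ 0 = 0"
  defines "u \<equiv> \<lambda>k. (1 - x * q ^ k) * (1 - x' * q ^ k)"
begin

lemma q_nth_0: "q $ 0 = 0"
  using x0 by (simp flip: xx')

lemma u_nth_0: "u k $ 0 = 1"
  by (simp add: u_def x0 x0')

lemma u_eq: "u k = 1 + q ^ (2 * k + 1) - (x + x') * q ^ k"
proof -
  have "(1 - x * q ^ k) * (1 - x' * q ^ k) = 1 + x * x' * q ^ (2 * k) - (x + x') * q ^ k"
    by (simp add: algebra_simps mult_2_right power_add)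
  then show ?thesis by (simp add: u_def xx')
qed

lemma to_fract_u: "to_fract (u k) = 1 + to_fract q ^ (2 * k + 1) - (to_fract (x + x')) * to_fract q ^ k"
  by (simp add: u_eq)

lemma to_fract_u_neq_0: "1 + to_fract q ^ (2 * k + 1) - (to_fract (x + x')) * to_fract q ^ k \<noteq> 0"
  unfolding to_fract_u[symmetric] using u_nth_0[of k] by auto

lemma prod_u: "(\<Prod>k\<le>n. u k) = qpochhammer x q (n + 1) * qpochhammer x' q (n + 1)"
  by (simp add: u_def qpochhammer_def prod.distrib lessThan_Suc_atMost)

lemma fps_partial_fractions:
  "(\<Sum>k\<le>n. fps_pf_coeff q n k * rinv (u k)) =
    rinv (qpochhammer x q (n + 1) * qpochhammer x' q (n + 1))"
proof -
  have "to_fract (\<Sum>k\<le>n. fps_pf_coeff q n k * rinv (u k)) = to_fract (rinv (\<Prod>k\<le>n. u k))"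
    using partial_fractions_div[where q = "to_fract q" and z = "to_fract (x + x')" and n = n]
      to_fract_power_neq_1[OF q_nth_0] q0 to_fract_u_neq_0
    by (simp add: to_fract_pf_coeff q_nth_0 to_fract_rinv u_nth_0 fps_prod_nth_0 to_fract_u del: to_fract_add)
  then show ?thesis unfolding to_fract_eq_iff prod_u .
qed

lemma fps_finite_bailey:
  "(\<Sum>n\<le>L. q ^ (n * (n + 1)) * rinv (qpochhammer x q (n + 1) * qpochhammer x' q (n + 1)) *
      rinv (qpochhammer q q (L - n)))
    = (\<Sum>k\<le>L. q ^ (k * (k + 1)) * fps_pf_coeff q L k * rinv (u k))"
proof -
  have "to_fract (\<Sum>n\<le>L. q ^ (n * (n + 1)) * rinv (\<Prod>k\<le>n. u k) * rinv (qpochhammer q q (L - n)))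
    = to_fract (\<Sum>k\<le>L. q ^ (k * (k + 1)) * fps_pf_coeff q L k * rinv (u k))"
    using finite_bailey[where q = "to_fract q" and z = "to_fract (x + x')" and L = L]
      to_fract_power_neq_1[OF q_nth_0] q0 to_fract_u_neq_0
    by (simp add: to_fract_pf_coeff q_nth_0 to_fract_rinv u_nth_0 fps_prod_nth_0 to_fract_u
        qpochhammer_fps_nth_0 del: to_fract_add)
  then show ?thesis unfolding to_fract_eq_iff prod_u .
qed

text \<open>The limit of \<open>fps_partial_fractions\<close>, multiplied by
  \<open>qinf q q ^ 2\<close> to clear the limits of the two finite products in each coefficient.
  The power \<open>q ^ (Suc k choose 2)\<close> supplies the order bound for
  \<open>fps_tannery\<close>.\<close>

lemma sums_reciprocal_theta:
  "(\<lambda>k. (-1) ^ k * q ^ (Suc k choose 2) * (1 - q ^ (2 * k + 1)) * rinv (u k))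
     sums (qinf q q ^ 2 * rinv (qinf x q * qinf x' q))"
proof -
  define c where "c = (\<lambda>k. (-1) ^ k * q ^ (Suc k choose 2) * (1 - q ^ (2 * k + 1)))"
  define b where "b = (\<lambda>k. c k * rinv (qinf q q ^ 2) * rinv (u k))"
  have lim: "(\<lambda>n. fps_pf_coeff q n k * rinv (u k)) \<longlonglongrightarrow> b k" for k
    unfolding b_def c_def by (intro fps_tendsto_mult fps_pf_coeff_tendsto tendsto_const q_nth_0)
  have dom: "(fps_pf_coeff q n k * rinv (u k)) $ i = 0" if "i < k" "k \<le> n" for n k i
  proof -
    have "fps_pf_coeff q n k * rinv (u k) = q ^ (Suc k choose 2) * ((-1) ^ k *
        (1 - q ^ (2 * k + 1)) * rinv (qpochhammer q q (n - k) * qpochhammer q q (n + 1 + k)) * rinv (u k))"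
      by (simp only: fps_pf_coeff_def mult_ac)
    then show ?thesis
      using fps_power_mult_nth_eq_0[OF q_nth_0, of i] that Suc_choose_2_ge[of k] by (simp only:)
  qed
  note tannery = fps_tannery[where a = "\<lambda>n k. fps_pf_coeff q n k * rinv (u k)" and b = b, OF lim dom]
  have "(\<lambda>n. rinv (qpochhammer x q (n + 1) * qpochhammer x' q (n + 1))) \<longlonglongrightarrow> rinv (qinf x q * qinf x' q)"
    by (intro fps_tendsto_mult fps_tendsto_rinv LIMSEQ_ignore_initial_segment qpochhammer_tendsto x0 x0' q_nth_0)
  then have "suminf b = rinv (qinf x q * qinf x' q)"
    using tannery(2) unfolding fps_partial_fractions
    by (intro tendsto_unique[OF sequentially_bot]) auto
  then have "b sums rinv (qinf x q * qinf x' q)"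
    using tannery(1) by (simp add: sums_iff)
  then have "(\<lambda>k. qinf q q ^ 2 * b k) sums (qinf q q ^ 2 * rinv (qinf x q * qinf x' q))"
    by (rule fps_sums_mult_left)
  moreover have "qinf q q ^ 2 * b k = c k * rinv (u k)" for k
  proof -
    have "qinf q q ^ 2 * b k = (qinf q q ^ 2 * rinv (qinf q q ^ 2)) * (c k * rinv (u k))"
      by (simp only: b_def mult_ac)
    also have "\<dots> = c k * rinv (u k)"
      by (subst rinv_right) (simp_all add: q_nth_0 fps_nth_power_0)
    finally show ?thesis .
  qed
  ultimately show ?thesis by (simp add: c_def)
qed

text \<open>\<open>G\<close> is the universal mock theta function g_3. Both sides of
  \<open>fps_finite_bailey\<close> are passed to the limit: the left side acquires one inverse
  factor \<open>qinf q q\<close>, the right side two, so a single one remains.\<close>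

lemma sums_universal_mock_theta:
  assumes "(\<lambda>n. q ^ (n * (n + 1)) * rinv (qpochhammer x q (n + 1) * qpochhammer x' q (n + 1))) sums G"
  shows "(\<lambda>k. (-1) ^ k * q ^ (k * (k + 1) + (Suc k choose 2)) * (1 - q ^ (2 * k + 1)) * rinv (u k))
     sums (qinf q q * G)"
proof -
  define c where "c = (\<lambda>k. (-1) ^ k * q ^ (k * (k + 1) + (Suc k choose 2)) * (1 - q ^ (2 * k + 1)))"
  define b where "b = (\<lambda>k. q ^ (k * (k + 1)) * ((-1) ^ k * q ^ (Suc k choose 2) *
     (1 - q ^ (2 * k + 1)) * rinv (qinf q q ^ 2)) * rinv (u k))"
  define g where "g = (\<lambda>n. q ^ (n * (n + 1)) * rinv (qpochhammer x q (n + 1) * qpochhammer x' q (n + 1)))"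
  have lim: "(\<lambda>n. q ^ (k * (k + 1)) * fps_pf_coeff q n k * rinv (u k)) \<longlonglongrightarrow> b k" for k
    unfolding b_def by (intro fps_tendsto_mult fps_pf_coeff_tendsto tendsto_const q_nth_0)
  have dom: "(q ^ (k * (k + 1)) * fps_pf_coeff q n k * rinv (u k)) $ i = 0" if "i < k" "k \<le> n" for n k i
    unfolding mult.assoc
    by (rule fps_power_mult_nth_eq_0[OF q_nth_0]) (rule less_le_trans[OF that(1)], simp)
  have lim': "(\<lambda>n. g k * rinv (qpochhammer q q (n - k))) \<longlonglongrightarrow> g k * rinv (qinf q q)" for k
    by (intro fps_tendsto_mult tendsto_const fps_tendsto_rinv tendsto_shift_sub qpochhammer_tendsto q_nth_0)
  have dom': "(g k * rinv (qpochhammer q q (n - k))) $ i = 0" if "i < k" "k \<le> n" for n k i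
    unfolding g_def mult.assoc
    by (rule fps_power_mult_nth_eq_0[OF q_nth_0]) (rule less_le_trans[OF that(1)], simp)
  note tannery = fps_tannery[where a = "\<lambda>n k. q ^ (k * (k + 1)) * fps_pf_coeff q n k * rinv (u k)" and b = b, OF lim dom]
  note tannery' = fps_tannery[where a = "\<lambda>n k. g k * rinv (qpochhammer q q (n - k))"
      and b = "\<lambda>k. g k * rinv (qinf q q)", OF lim' dom']
  have "suminf b = (\<Sum>k. g k * rinv (qinf q q))"
    using tannery(2) tannery'(2)
    unfolding g_def fps_finite_bailey by (intro tendsto_unique[OF sequentially_bot]) auto
  moreover have "(\<lambda>k. g k * rinv (qinf q q)) sums (G * rinv (qinf q q))"
    using fps_sums_mult_left[OF assms, of "rinv (qinf q q)"] unfolding g_def mult.commute[of _ "rinv (qinf q q)"] .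
  ultimately have "b sums (G * rinv (qinf q q))"
    using tannery(1) sums_unique by (metis summable_sums)
  then have "(\<lambda>k. qinf q q ^ 2 * b k) sums (qinf q q ^ 2 * (G * rinv (qinf q q)))"
    by (rule fps_sums_mult_left)
  moreover have "qinf q q ^ 2 * b k = c k * rinv (u k)" for k
  proof -
    have "qinf q q ^ 2 * b k = (qinf q q ^ 2 * rinv (qinf q q ^ 2)) * (c k * rinv (u k))"
      by (simp only: b_def c_def power_add mult_ac)
    also have "\<dots> = c k * rinv (u k)"
      by (subst rinv_right) (simp_all add: q_nth_0 fps_nth_power_0)
    finally show ?thesis .
  qed
  moreover have "qinf q q ^ 2 * (G * rinv (qinf q q)) = (qinf q q * rinv (qinf q q)) * (qinf q q * G)"
    by (simp only: power2_eq_square mult_ac)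
  then have "qinf q q ^ 2 * (G * rinv (qinf q q)) = qinf q q * G"
    by (subst (asm) rinv_right) (simp_all add: q_nth_0)
  ultimately show ?thesis by (simp add: c_def)
qed

end

section \<open>The limit of the expansion at nodes and their negatives\<close>

definition fps_node_prod :: "'a::idom fps \<Rightarrow> nat \<Rightarrow> nat \<Rightarrow> 'a fps" where
  "fps_node_prod q n k = (if even k
     then qpochhammer (- (q ^ 3)) (q ^ 4) (n - k div 2) * qpochhammer (- q) (q ^ 4) (n + k div 2 + 1)
     else qpochhammer (- q) (q ^ 4) (n - k div 2) * qpochhammer (- (q ^ 3)) (q ^ 4) (n + k div 2 + 1))"

definition fps_pf_coeff2 :: "'a::idom fps \<Rightarrow> nat \<Rightarrow> nat \<Rightarrow> 'a fps" where
  "fps_pf_coeff2 q n k = (-1) ^ k * q ^ (3 * (Suc k choose 2) + k) * (1 - q ^ (2 * k + 1)) * fps_node_prod q n k *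
     rinv (qpochhammer (q ^ 4) (q ^ 4) (n - k) * qpochhammer (q ^ 4) (q ^ 4) (n + 1 + k))"

lemma to_fract_pf_coeff2:
  assumes "q $ 0 = 0"
  shows "to_fract (fps_pf_coeff2 q n k) = pf_coeff2 (to_fract q) n k"
  using assms
  by (simp add: fps_pf_coeff2_def pf_coeff2_def fps_node_prod_def node_prod_def to_fract_rinv
      qpochhammer_fps_nth_0 fps_nth_power_0 if_distrib[of to_fract])

text \<open>The parity of \<open>k\<close> only decides which of the two progressions gets more
  factors; in the limit both together exhaust the odd exponents.\<close>

lemma fps_node_prod_tendsto:
  assumes q: "q $ 0 = 0"
  shows "(\<lambda>n. fps_node_prod q n k) \<longlonglongrightarrow> qinf (- q) (q ^ 2)"
proof -
  have q': "(- q) $ 0 = 0" "(- (q ^ 3)) $ 0 = 0" "(q ^ 4) $ 0 = 0" "(q ^ 2) $ 0 = 0"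
    using q by (simp_all add: fps_nth_power_0)
  have "qinf (- q) (q ^ 2) = qinf (- q) (q ^ 4) * qinf (- (q ^ 3)) (q ^ 4)"
  proof -
    have "(q ^ 2) ^ 2 = q ^ 4" "- q * q ^ 2 = - (q ^ 3)"
      by (simp_all add: power3_eq_cube power2_eq_square eval_nat_numeral)
    then show ?thesis using qinf_split2[OF q'(1,4)] by simp
  qed
  moreover have "(\<lambda>n. qpochhammer (- q) (q ^ 4) (n - k div 2)) \<longlonglongrightarrow> qinf (- q) (q ^ 4)"
    "(\<lambda>n. qpochhammer (- (q ^ 3)) (q ^ 4) (n - k div 2)) \<longlonglongrightarrow> qinf (- (q ^ 3)) (q ^ 4)"
    by (intro tendsto_shift_sub qpochhammer_tendsto q')+
  moreover have "(\<lambda>n. qpochhammer (- q) (q ^ 4) (n + (k div 2 + 1))) \<longlonglongrightarrow> qinf (- q) (q ^ 4)"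
    "(\<lambda>n. qpochhammer (- (q ^ 3)) (q ^ 4) (n + (k div 2 + 1))) \<longlonglongrightarrow> qinf (- (q ^ 3)) (q ^ 4)"
    by (intro tendsto_shift_add qpochhammer_tendsto q')+
  ultimately show ?thesis
    unfolding fps_node_prod_def add.assoc
    by (cases "even k") (simp_all only: if_True if_False fps_tendsto_mult
        mult.commute[of "qinf (- q) (q ^ 4)"] mult.commute[of "qpochhammer (- q) (q ^ 4) _"])
qed

lemma fps_pf_coeff2_tendsto:
  assumes q: "q $ 0 = 0"
  shows "(\<lambda>n. fps_pf_coeff2 q n k) \<longlonglongrightarrow>
     (-1) ^ k * q ^ (3 * (Suc k choose 2) + k) * (1 - q ^ (2 * k + 1)) * qinf (- q) (q ^ 2) *
       rinv (qinf (q ^ 4) (q ^ 4) ^ 2)"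
proof -
  have q4: "(q ^ 4) $ 0 = 0" using q by (simp add: fps_nth_power_0)
  have "(\<lambda>n. qpochhammer (q ^ 4) (q ^ 4) (n - k)) \<longlonglongrightarrow> qinf (q ^ 4) (q ^ 4)"
    by (rule tendsto_shift_sub[OF qpochhammer_tendsto[OF q4 q4]])
  moreover have "(\<lambda>n. qpochhammer (q ^ 4) (q ^ 4) (n + (1 + k))) \<longlonglongrightarrow> qinf (q ^ 4) (q ^ 4)"
    by (rule tendsto_shift_add[OF qpochhammer_tendsto[OF q4 q4]])
  ultimately show ?thesis
    unfolding fps_pf_coeff2_def power2_eq_square[of "qinf (q ^ 4) (q ^ 4)"] add.assoc[of _ 1]
    by (intro fps_tendsto_mult fps_tendsto_rinv tendsto_const fps_node_prod_tendsto q)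
qed

definition mock_term :: "'a::idom fps \<Rightarrow> 'a fps \<Rightarrow> 'a fps \<Rightarrow> nat \<Rightarrow> 'a fps" where
  "mock_term q y y' k = (-1) ^ k * q ^ (3 * (Suc k choose 2) + k) * (1 - q ^ (2 * k + 1)) *
     rinv ((1 - y * q ^ (2 * k)) * (1 - y' * q ^ (2 * k)))"

lemma summable_mock_term:
  assumes "q $ 0 = 0"
  shows "summable (mock_term q y y')"
proof (rule fps_summableI)
  fix i k :: nat assume "i < k"
  have "mock_term q y y' k = q ^ (3 * (Suc k choose 2) + k) * ((-1) ^ k * (1 - q ^ (2 * k + 1)) *
     rinv ((1 - y * q ^ (2 * k)) * (1 - y' * q ^ (2 * k))))"
    by (simp only: mock_term_def mult_ac)
  then show "mock_term q y y' k $ i = 0"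
    using fps_power_mult_nth_eq_0[OF assms, of i] \<open>i < k\<close> by (simp only:)
qed

text \<open>The limit of \<open>partial_fractions2\<close> at \<open>z = y + y'\<close>. Because
  \<open>y * y' = q ^ 2\<close>, each numerator factor and each product of opposite poles splits
  into linear factors, giving infinite products. The two halves of the sum are exchanged when
  \<open>q\<close>, \<open>y\<close> and \<open>y'\<close> all change sign.\<close>

lemma mock_theta_identity:
  fixes q y y' :: "'a::idom fps"
  assumes yy': "y * y' = q ^ 2" and q0: "q \<noteq> 0" "q $ 0 = 0" and y0: "y $ 0 = 0" and y0': "y' $ 0 = 0"
    and two: "(2 :: 'a) \<noteq> 0"
  shows "2 * (qinf (- (q ^ 3 * y)) (q ^ 4) * qinf (- (q ^ 3 * y')) (q ^ 4) *
      rinv (qinf (y ^ 2) (q ^ 4) * qinf (y' ^ 2) (q ^ 4))) * qinf (q ^ 4) (q ^ 4) ^ 2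
    = qinf (- q) (q ^ 2) * suminf (mock_term q y y') + qinf q (q ^ 2) * suminf (mock_term (- q) (- y) (- y'))"
proof -
  define z where "z = y + y'"
  define u where "u = (\<lambda>y y' k. (1 - y * q ^ (2 * k)) * (1 - y' * q ^ (2 * k)))"
  have u_eq: "u y y' k = 1 + q ^ (4 * k + 2) - z * q ^ (2 * k)"
    "u (- y) (- y') k = 1 + q ^ (4 * k + 2) - (- z) * q ^ (2 * k)" for k
  proof -
    have "u y y' k = 1 + y * y' * q ^ (4 * k) - (y + y') * q ^ (2 * k)" for y y'
      by (simp add: u_def algebra_simps flip: power_add)
    from this[of y y'] this[of "-y" "-y'"]
    show "u y y' k = 1 + q ^ (4 * k + 2) - z * q ^ (2 * k)"
      "u (- y) (- y') k = 1 + q ^ (4 * k + 2) - (- z) * q ^ (2 * k)"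
      by (simp_all add: yy' z_def algebra_simps power_add power2_eq_square)
  qed
  have u0: "u y y' k $ 0 = 1" "u (- y) (- y') k $ 0 = 1" for k
    using y0 y0' by (simp_all add: u_def)
  have fu: "to_fract (u y y' k) = 1 + to_fract q ^ (4 * k + 2) - to_fract z * to_fract q ^ (2 * k)"
    "to_fract (u (- y) (- y') k) = 1 + to_fract q ^ (4 * k + 2) - (- to_fract z) * to_fract q ^ (2 * k)" for k
    by (simp_all add: u_eq)
  have fu0: "to_fract (u y y' k) \<noteq> 0" "to_fract (u (- y) (- y') k) \<noteq> 0" for k
    using u0[of k] by auto
  have mq: "(- q) $ 0 = 0" using q0 by simp
  have two_fps: "(2 :: 'a fps) \<noteq> 0"
    using two by (metis fps_numeral_nth_0 fps_zero_nth)
  then have two_fract: "(2 :: 'a fps fract) \<noteq> 0"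
    using to_fract_of_nat[of 2, where 'a = "'a fps"] to_fract_eq_0_iff[of "2 :: 'a fps"] by simp
  define N where "N = (\<lambda>n. \<Prod>j<n. 1 + q ^ (8 * j + 8) + q ^ (4 * j + 3) * z)"
  have finite_id: "2 * N n * rinv (\<Prod>k\<le>n. u y y' k * u (- y) (- y') k)
    = (\<Sum>k\<le>n. fps_pf_coeff2 q n k * rinv (u y y' k) + fps_pf_coeff2 (- q) n k * rinv (u (- y) (- y') k))" for n
  proof -
    have "to_fract (2 * N n * rinv (\<Prod>k\<le>n. u y y' k * u (- y) (- y') k))
      = to_fract (\<Sum>k\<le>n. fps_pf_coeff2 q n k * rinv (u y y' k) + fps_pf_coeff2 (- q) n k * rinv (u (- y) (- y') k))"
    proof -
      have "2 * (\<Prod>j<n. 1 + to_fract q ^ (8 * j + 8) + to_fract q ^ (4 * j + 3) * to_fract z) /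
          (\<Prod>k\<le>n. to_fract (u y y' k) * to_fract (u (- y) (- y') k))
        = (\<Sum>k\<le>n. pf_coeff2 (to_fract q) n k / to_fract (u y y' k) +
            pf_coeff2 (- to_fract q) n k / to_fract (u (- y) (- y') k))"
        using partial_fractions2[where q = "to_fract q" and z = "to_fract z" and n = n,
            OF to_fract_power_neq_1[OF q0(2)] _ two_fract] q0 fu0 unfolding fu by simp
      then show ?thesis
        using to_fract_of_nat[of 2, where 'a = "'a fps"]
        by (simp add: N_def to_fract_rinv u0 fps_prod_nth_0 to_fract_pf_coeff2 mq q0)
    qed
    then show ?thesis unfolding to_fract_eq_iff .
  qed
  have N_eq: "N n = qpochhammer (- (q ^ 3 * y)) (q ^ 4) n * qpochhammer (- (q ^ 3 * y')) (q ^ 4) n" for n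
    unfolding N_def qpochhammer_def prod.distrib[symmetric]
  proof (rule prod.cong)
    fix j
    define a where "a = q ^ (4 * j + 3)"
    have "q ^ 3 * (q ^ 4) ^ j = a" by (simp add: a_def power_add power_mult)
    then have "(1 - - (q ^ 3 * y) * (q ^ 4) ^ j) * (1 - - (q ^ 3 * y') * (q ^ 4) ^ j) = (1 + a * y) * (1 + a * y')"
      by (simp add: mult_ac)
    also have "\<dots> = 1 + a * a * (y * y') + a * z" by (simp add: z_def algebra_simps)
    also have "a * a * (y * y') = q ^ (8 * j + 8)"
      unfolding yy' a_def power_add[symmetric] by (rule arg_cong[of _ _ "(^) q"]) simp
    finally show "1 + q ^ (8 * j + 8) + q ^ (4 * j + 3) * z =
        (1 - - (q ^ 3 * y) * (q ^ 4) ^ j) * (1 - - (q ^ 3 * y') * (q ^ 4) ^ j)" by (simp add: a_def)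
  qed simp
  have D_eq: "(\<Prod>k\<le>n. u y y' k * u (- y) (- y') k)
      = qpochhammer (y ^ 2) (q ^ 4) (n + 1) * qpochhammer (y' ^ 2) (q ^ 4) (n + 1)" for n
    unfolding qpochhammer_def prod.distrib[symmetric] Suc_eq_plus1[symmetric] lessThan_Suc_atMost
  proof (rule prod.cong)
    fix k
    have "(q ^ 4) ^ k = (q ^ (2 * k)) ^ 2"
      unfolding power_mult[symmetric] by (rule arg_cong[of _ _ "(^) q"]) simp
    then show "u y y' k * u (- y) (- y') k = (1 - y ^ 2 * (q ^ 4) ^ k) * (1 - y' ^ 2 * (q ^ 4) ^ k)"
      by (simp only: u_def) (simp add: algebra_simps power2_eq_square)
  qed simp
  have q4: "(q ^ 4) $ 0 = 0" "(- (q ^ 3 * y)) $ 0 = 0" "(- (q ^ 3 * y')) $ 0 = 0"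
    "(y ^ 2) $ 0 = 0" "(y' ^ 2) $ 0 = 0" "(q ^ 2) $ 0 = 0"
    using q0 y0 y0' by (simp_all add: fps_nth_power_0)
  define R where "R = rinv (qinf (q ^ 4) (q ^ 4) ^ 2)"
  have lhs: "(\<lambda>n. 2 * N n * rinv (\<Prod>k\<le>n. u y y' k * u (- y) (- y') k)) \<longlonglongrightarrow>
      2 * (qinf (- (q ^ 3 * y)) (q ^ 4) * qinf (- (q ^ 3 * y')) (q ^ 4)) *
      rinv (qinf (y ^ 2) (q ^ 4) * qinf (y' ^ 2) (q ^ 4))"
    unfolding N_eq D_eq
    by (intro fps_tendsto_mult tendsto_const fps_tendsto_rinv LIMSEQ_ignore_initial_segment
        qpochhammer_tendsto q4)
  \<comment> \<open>Stated for arbitrary \<open>q\<close>, \<open>y\<close>, \<open>y'\<close>, so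
    that it also serves the half with all signs changed; \<open>R\<close> depends on
    \<open>q ^ 4\<close> only and is common to both.\<close>
  have rhs: "(\<lambda>n. \<Sum>k\<le>n. fps_pf_coeff2 q n k * rinv ((1 - y * q ^ (2 * k)) * (1 - y' * q ^ (2 * k)))) \<longlonglongrightarrow>
      qinf (- q) (q ^ 2) * R * suminf (mock_term q y y')"
    if q: "q $ 0 = 0" and R: "R = rinv (qinf (q ^ 4) (q ^ 4) ^ 2)" for q y y'
  proof -
    have "fps_pf_coeff2 q n k * rinv ((1 - y * q ^ (2 * k)) * (1 - y' * q ^ (2 * k)))
       = q ^ (3 * (Suc k choose 2) + k) * ((-1) ^ k * (1 - q ^ (2 * k + 1)) * fps_node_prod q n k *
      rinv (qpochhammer (q ^ 4) (q ^ 4) (n - k) * qpochhammer (q ^ 4) (q ^ 4) (n + 1 + k)) *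
      rinv ((1 - y * q ^ (2 * k)) * (1 - y' * q ^ (2 * k))))" for n k
      by (simp only: fps_pf_coeff2_def mult_ac)
    then have dom: "(fps_pf_coeff2 q n k * rinv ((1 - y * q ^ (2 * k)) * (1 - y' * q ^ (2 * k)))) $ i = 0"
      if "i < k" "k \<le> n" for n k i
      using fps_power_mult_nth_eq_0[OF q, of i] \<open>i < k\<close> by (simp only:)
    have lim: "(\<lambda>n. fps_pf_coeff2 q n k * rinv ((1 - y * q ^ (2 * k)) * (1 - y' * q ^ (2 * k)))) \<longlonglongrightarrow>
        qinf (- q) (q ^ 2) * R * mock_term q y y' k" for k
    proof -
      have "(\<lambda>n. fps_pf_coeff2 q n k * rinv ((1 - y * q ^ (2 * k)) * (1 - y' * q ^ (2 * k)))) \<longlonglongrightarrow>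
        (-1) ^ k * q ^ (3 * (Suc k choose 2) + k) * (1 - q ^ (2 * k + 1)) * qinf (- q) (q ^ 2) *
       rinv (qinf (q ^ 4) (q ^ 4) ^ 2) * rinv ((1 - y * q ^ (2 * k)) * (1 - y' * q ^ (2 * k)))"
        by (intro fps_tendsto_mult tendsto_const fps_pf_coeff2_tendsto q)
      also have "(-1) ^ k * q ^ (3 * (Suc k choose 2) + k) * (1 - q ^ (2 * k + 1)) * qinf (- q) (q ^ 2) *
         rinv (qinf (q ^ 4) (q ^ 4) ^ 2) * rinv ((1 - y * q ^ (2 * k)) * (1 - y' * q ^ (2 * k)))
         = qinf (- q) (q ^ 2) * R * mock_term q y y' k"
        by (simp only: mock_term_def R mult_ac)
      finally show ?thesis .
    qed
    have "(\<lambda>k. qinf (- q) (q ^ 2) * R * mock_term q y y' k) sums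
        (qinf (- q) (q ^ 2) * R * suminf (mock_term q y y'))"
      by (intro fps_sums_mult_left summable_sums summable_mock_term q)
    then have eq: "(\<Sum>k. qinf (- q) (q ^ 2) * R * mock_term q y y' k) =
        qinf (- q) (q ^ 2) * R * suminf (mock_term q y y')"
      by (rule sums_unique[symmetric])
    show ?thesis
      using fps_tannery(2)[where a = "\<lambda>n k. fps_pf_coeff2 q n k * rinv ((1 - y * q ^ (2 * k)) * (1 - y' * q ^ (2 * k)))"
          and b = "\<lambda>k. qinf (- q) (q ^ 2) * R * mock_term q y y' k", OF lim dom]
      unfolding eq .
  qed
  have "(\<lambda>n. \<Sum>k\<le>n. fps_pf_coeff2 q n k * rinv (u y y' k) + fps_pf_coeff2 (- q) n k * rinv (u (- y) (- y') k)) \<longlonglongrightarrow>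
      qinf (- q) (q ^ 2) * R * suminf (mock_term q y y') + qinf q (q ^ 2) * R * suminf (mock_term (- q) (- y) (- y'))"
  proof -
    have "R = rinv (qinf ((- q) ^ 4) ((- q) ^ 4) ^ 2)" by (simp add: R_def)
    from fps_tendsto_add[OF rhs[OF q0(2) R_def, of y y'] rhs[OF mq this, of "- y" "- y'"]]
    moreover have "(- q) ^ (2 * k) = q ^ (2 * k)" for k by simp
    ultimately show ?thesis unfolding sum.distrib[symmetric] minus_minus power2_minus u_def by (simp only:)
  qed
  with lhs have "2 * (qinf (- (q ^ 3 * y)) (q ^ 4) * qinf (- (q ^ 3 * y')) (q ^ 4)) *
      rinv (qinf (y ^ 2) (q ^ 4) * qinf (y' ^ 2) (q ^ 4)) = qinf (- q) (q ^ 2) * R * suminf (mock_term q y y') +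
      qinf q (q ^ 2) * R * suminf (mock_term (- q) (- y) (- y'))"
    unfolding finite_id by (rule tendsto_unique[OF sequentially_bot])
  then have *: "2 * (qinf (- (q ^ 3 * y)) (q ^ 4) * qinf (- (q ^ 3 * y')) (q ^ 4) *
      rinv (qinf (y ^ 2) (q ^ 4) * qinf (y' ^ 2) (q ^ 4))) = R * (qinf (- q) (q ^ 2) * suminf (mock_term q y y') +
      qinf q (q ^ 2) * suminf (mock_term (- q) (- y) (- y')))"
    by (simp only: distrib_left mult_ac)
  have "R * qinf (q ^ 4) (q ^ 4) ^ 2 = 1"
    unfolding R_def by (rule rinv_left) (simp only: fps_nth_power_0 qinf_nth_0[OF q4(1)] power_one)
  then have "R * S * qinf (q ^ 4) (q ^ 4) ^ 2 = S" for S
    by (simp only: mult.assoc mult.commute[of S] mult.left_commute[of R S]) (simp flip: mult.assoc)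
  then show ?thesis unfolding * .
qed

subsection \<open>The Jacobi triple product\<close>

text \<open>Pascal's recursion avoids division, so the coefficients exist in every commutative ring;
  the quotient form is \<open>gauss_binomial_fact\<close>.\<close>

fun gauss_binomial :: "'a::comm_ring_1 \<Rightarrow> nat \<Rightarrow> nat \<Rightarrow> 'a" where
  "gauss_binomial q n 0 = 1"
| "gauss_binomial q 0 (Suc k) = 0"
| "gauss_binomial q (Suc n) (Suc k) = gauss_binomial q n k + q ^ Suc k * gauss_binomial q n (Suc k)"

lemma gauss_binomial_eq_0: "n < k \<Longrightarrow> gauss_binomial q n k = 0"
  by (induction q n k rule: gauss_binomial.induct) auto

lemma gauss_binomial_self: "gauss_binomial q n n = 1"
  by (induction n) (simp_all add: gauss_binomial_eq_0)

lemma gauss_binomial_fact: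
  "gauss_binomial q (i + j) i * (qpochhammer q q i * qpochhammer q q j) = qpochhammer q q (i + j)"
proof (induction "i + j" arbitrary: i j)
  case (Suc n)
  show ?case
  proof (cases i)
    case (Suc i')
    show ?thesis
    proof (cases j)
      case (Suc j')
      have 1: "gauss_binomial q (i' + j) i' * (qpochhammer q q i' * qpochhammer q q j) = qpochhammer q q (i' + j)"
        using Suc.hyps \<open>i = Suc i'\<close> by (intro Suc.hyps) simp
      have 2: "gauss_binomial q (i + j') i * (qpochhammer q q i * qpochhammer q q j') = qpochhammer q q (i + j')"
        using Suc.hyps \<open>j = Suc j'\<close> by (intro Suc.hyps) simp
      have g: "gauss_binomial q (i + j) i = gauss_binomial q (i' + j) i' + q ^ i * gauss_binomial q (i + j') i"
        by (simp add: \<open>i = Suc i'\<close> \<open>j = Suc j'\<close>)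
      have p: "qpochhammer q q i = qpochhammer q q i' * (1 - q ^ i)" "qpochhammer q q j = qpochhammer q q j' * (1 - q ^ j)"
        "i' + j = i + j'" "qpochhammer q q (i + j) = qpochhammer q q (i + j') * (1 - q ^ i * q ^ j)"
        by (simp_all add: \<open>i = Suc i'\<close> \<open>j = Suc j'\<close> qpochhammer_Suc power_add mult_ac)
      have "gauss_binomial q (i + j) i * (qpochhammer q q i * qpochhammer q q j)
          = (gauss_binomial q (i' + j) i' * (qpochhammer q q i' * qpochhammer q q j)) * (1 - q ^ i)
            + q ^ i * (gauss_binomial q (i + j') i * (qpochhammer q q i * qpochhammer q q j')) * (1 - q ^ j)"
        unfolding g distrib_right by (simp only: p(1,2) mult_ac)
      also have "\<dots> = qpochhammer q q (i + j') * ((1 - q ^ i) + q ^ i * (1 - q ^ j))"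
        unfolding 1 2 unfolding p(3) by (simp add: algebra_simps)
      also have "\<dots> = qpochhammer q q (i + j)"
        unfolding p(4) by (simp add: algebra_simps)
      finally show ?thesis .
    qed (simp add: gauss_binomial_self)
  qed simp
qed simp

text \<open>The recursion hides the symmetry; it comes from cancelling the nonzero denominator in
  \<open>gauss_binomial_fact\<close>.\<close>

lemma gauss_binomial_symmetric:
  fixes q :: "'a::idom fps"
  assumes "q $ 0 = 0"
  shows "gauss_binomial q (i + j) i = gauss_binomial q (i + j) j"
proof -
  have "qpochhammer q q k \<noteq> 0" for k
    using qpochhammer_fps_nth_0[OF assms, of q k] by auto
  moreover have "gauss_binomial q (i + j) i * (qpochhammer q q i * qpochhammer q q j)
      = gauss_binomial q (i + j) j * (qpochhammer q q i * qpochhammer q q j)"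
    using gauss_binomial_fact[of q i j] gauss_binomial_fact[of q j i] by (simp add: ac_simps)
  ultimately show ?thesis by simp
qed

lemma q_binomial_theorem:
  "(\<Prod>k<n. a + b * q ^ k) = (\<Sum>k\<le>n. gauss_binomial q n k * q ^ (k choose 2) * b ^ k * a ^ (n - k))"
proof (induction n arbitrary: b)
  case (Suc n)
  define f where "f = (\<lambda>k. gauss_binomial q n k * q ^ (k choose 2) * (b * q) ^ k * a ^ (n - k))"
  have "(\<Prod>k<Suc n. a + b * q ^ k) = (a + b) * (\<Prod>k<n. a + (b * q) * q ^ k)"
    by (simp add: prod.lessThan_Suc_shift mult_ac del: prod.lessThan_Suc)
  also have "\<dots> = (\<Sum>k\<le>n. f k * a) + (\<Sum>k\<le>n. f k * b)"
    unfolding Suc.IH by (simp add: f_def distrib_right sum_distrib_left sum.distrib mult_ac)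
  also have "(\<Sum>k\<le>n. f k * a) = (\<Sum>k\<le>Suc n. gauss_binomial q n k * q ^ (k choose 2) * (b * q) ^ k * a ^ (Suc n - k))"
    by (simp add: f_def gauss_binomial_eq_0 Suc_diff_le mult_ac)
  also have "\<dots> = a ^ Suc n + (\<Sum>k\<le>n. gauss_binomial q n (Suc k) * q ^ (Suc k choose 2) * (b * q) ^ Suc k * a ^ (n - k))"
    by (simp add: sum.atMost_Suc_shift binomial_eq_0 del: sum.atMost_Suc power_Suc)
  also have "\<dots> + (\<Sum>k\<le>n. f k * b) = a ^ Suc n +
      (\<Sum>k\<le>n. gauss_binomial q (Suc n) (Suc k) * q ^ (Suc k choose 2) * b ^ Suc k * a ^ (n - k))"
    unfolding add.assoc sum.distrib[symmetric]
    by (intro arg_cong2[of _ _ _ _ "(+)"] sum.cong refl)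
       (simp add: f_def Suc_choose_2 power_add power_mult_distrib algebra_simps)
  also have "\<dots> = (\<Sum>k\<le>Suc n. gauss_binomial q (Suc n) k * q ^ (k choose 2) * b ^ k * a ^ (Suc n - k))"
    by (simp add: sum.atMost_Suc_shift binomial_eq_0 del: sum.atMost_Suc power_Suc gauss_binomial.simps(3))
  finally show ?case .
qed (simp add: binomial_eq_0)

lemma sum_atMost_double:
  fixes f :: "nat \<Rightarrow> 'a::comm_monoid_add"
  shows "(\<Sum>k\<le>2 * n. f k) = (\<Sum>j\<le>n. if j = 0 then f n else f (n + j) + f (n - j))"
proof -
  have "(\<Sum>k\<le>2 * n. f k) = (\<Sum>k\<in>{n} \<union> ((\<lambda>j. n + j) ` {1..n} \<union> (\<lambda>j. n - j) ` {1..n}). f k)"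
  proof (rule sum.cong)
    show "{..2 * n} = {n} \<union> ((\<lambda>j. n + j) ` {1..n} \<union> (\<lambda>j. n - j) ` {1..n})" (is "_ = ?R")
    proof
      show "{..2 * n} \<subseteq> ?R"
      proof
        fix k assume "k \<in> {..2 * n}"
        then have "k = n \<or> k = n + (k - n) \<and> k - n \<in> {1..n} \<or> k = n - (n - k) \<and> n - k \<in> {1..n}"
          by auto
        then show "k \<in> ?R" by blast
      qed
    qed auto
  qed simp
  also have "\<dots> = f n + (\<Sum>j=1..n. f (n + j) + f (n - j))"
  proof -
    have "(\<Sum>k\<in>(\<lambda>j. n + j) ` {1..n}. f k) = (\<Sum>j=1..n. f (n + j))"
      by (subst sum.reindex) (auto simp: inj_on_def)
    moreover have "(\<Sum>k\<in>(\<lambda>j. n - j) ` {1..n}. f k) = (\<Sum>j=1..n. f (n - j))"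
      by (subst sum.reindex) (auto simp: inj_on_def)
    ultimately show ?thesis
      by (subst sum.union_disjoint; (subst sum.union_disjoint)?) (auto simp: sum.distrib)
  qed
  also have "\<dots> = (\<Sum>j\<le>n. if j = 0 then f n else f (n + j) + f (n - j))"
  proof -
    have "{..n} = insert 0 {1..n}" by auto
    then show ?thesis by (simp cong: sum.cong_simp)
  qed
  finally show ?thesis .
qed

text \<open>Merges the indices j and -j of the bilateral series with terms (-1)^n q^(n choose 2)
  x^n. Since (-j choose 2) = (j choose 2) + j, the power x^(-j) combines with q^j to
  \<open>x' ^ j\<close> when \<open>x' = q / x\<close>.\<close>

definition jacobi_term :: "'a::comm_ring_1 \<Rightarrow> 'a \<Rightarrow> 'a \<Rightarrow> nat \<Rightarrow> 'a" where
  "jacobi_term q x x' j = (if j = 0 then 1 else (-1) ^ j * q ^ (j choose 2) * (x ^ j + x' ^ j))"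

lemma choose_2_add: "(m + n) choose 2 = (m choose 2) + (n choose 2) + m * n" for m n :: nat
  by (induction n) (simp_all add: Suc_choose_2 algebra_simps)

text \<open>The q-binomial theorem for \<open>2 * n\<close> factors
  \<open>q ^ n - x * q ^ k\<close>, with the sum recentred at index \<open>n\<close>.
  \<open>C\<close> is the monomial of the central term; it is cancelled only at the end, so no
  negative powers arise.\<close>

lemma finite_jacobi_triple_product:
  fixes q x x' :: "'a::idom fps"
  assumes xx': "x * x' = q" and "q \<noteq> 0" and "q $ 0 = 0"
  shows "qpochhammer x q n * qpochhammer x' q n
    = (\<Sum>j\<le>n. jacobi_term q x x' j * gauss_binomial q (2 * n) (n + j))"
proof -
  define C where "C = q ^ (n choose 2) * q ^ (n * n) * (-x) ^ n"
  have x0: "x \<noteq> 0" using xx' \<open>q \<noteq> 0\<close> by auto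
  have C0: "C \<noteq> 0" using \<open>q \<noteq> 0\<close> x0 by (simp add: C_def)
  define f where "f = (\<lambda>k. gauss_binomial q (2 * n) k * q ^ (k choose 2) * (- x) ^ k * (q ^ n) ^ (2 * n - k))"
  have "C * (qpochhammer x q n * qpochhammer x' q n) = (\<Prod>k<2 * n. q ^ n + (- x) * q ^ k)"
  proof -
    have "(\<Prod>k<2 * n. q ^ n + (- x) * q ^ k) = (\<Prod>k<n. q ^ n + (- x) * q ^ k) * (\<Prod>k<n. q ^ n + (- x) * q ^ (n + k))"
    proof -
      have "(\<Prod>k<n + m. g k) = (\<Prod>k<n. g k) * (\<Prod>k<m. g (n + k))" for m and g :: "nat \<Rightarrow> 'a fps"
        by (induction m) (simp_all add: mult_ac)
      then show ?thesis by (simp add: mult_2)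
    qed
    also have "(\<Prod>k<n. q ^ n + (- x) * q ^ (n + k)) = q ^ (n * n) * qpochhammer x q n"
    proof -
      have "q ^ n + (- x) * q ^ (n + k) = q ^ n * (1 - x * q ^ k)" for k
        by (simp add: power_add algebra_simps)
      then show ?thesis by (simp add: prod.distrib qpochhammer_def power_mult)
    qed
    \<comment> \<open>In the lower half \<open>q = x * x'\<close> allows \<open>- x\<close> to be
      extracted instead of \<open>q ^ n\<close>; this produces the factors in \<open>x'\<close>, in
      reversed order.\<close>
    also have "(\<Prod>k<n. q ^ n + (- x) * q ^ k) = (\<Prod>k<n. q ^ k * ((- x) * (1 - x' * q ^ (n - Suc k))))"
    proof (rule prod.cong)
      fix k assume "k \<in> {..<n}"
      then have n: "n = k + Suc (n - Suc k)" by simp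
      have "q ^ n = q ^ k * (q * q ^ (n - Suc k))"
        by (subst n) (simp only: power_add power_Suc)
      then have "q ^ n = q ^ k * (x * x' * q ^ (n - Suc k))" by (simp only: xx')
      then show "q ^ n + (- x) * q ^ k = q ^ k * ((- x) * (1 - x' * q ^ (n - Suc k)))"
        by (simp only:) (simp add: algebra_simps)
    qed simp
    also have "\<dots> = q ^ (n choose 2) * (- x) ^ n * qpochhammer x' q n"
    proof -
      have "(\<Prod>k<n. q ^ k) = q ^ (n choose 2)"
        by (induction n) (simp_all add: Suc_choose_2 power_add mult_ac binomial_eq_0)
      moreover have "(\<Prod>k<n. 1 - x' * q ^ (n - Suc k)) = qpochhammer x' q n"
        unfolding qpochhammer_def by (rule prod.nat_diff_reindex)
      ultimately show ?thesis by (simp only: prod.distrib prod_constant card_lessThan mult.assoc)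
    qed
    finally show ?thesis by (simp add: C_def mult_ac)
  qed
  also have "\<dots> = (\<Sum>k\<le>2 * n. f k)"
    unfolding f_def by (rule q_binomial_theorem)
  also have "\<dots> = (\<Sum>j\<le>n. if j = 0 then f n else f (n + j) + f (n - j))"
    by (rule sum_atMost_double)
  also have "\<dots> = (\<Sum>j\<le>n. C * (jacobi_term q x x' j * gauss_binomial q (2 * n) (n + j)))"
  proof (rule sum.cong)
    fix j assume "j \<in> {..n}"
    then have j: "j \<le> n" by simp
    have plus: "f (n + j) = C * ((-1) ^ j * q ^ (j choose 2) * x ^ j) * gauss_binomial q (2 * n) (n + j)"
    proof -
      have "(n + j choose 2) + n * (2 * n - (n + j)) = (n choose 2) + n * n + (j choose 2)"
        using j by (simp add: choose_2_add diff_mult_distrib2 flip: mult_2)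
      then have "q ^ (n + j choose 2) * (q ^ n) ^ (2 * n - (n + j)) = q ^ (n choose 2) * q ^ (n * n) * q ^ (j choose 2)"
        by (simp only: flip: power_add power_mult)
      moreover have "f (n + j) = gauss_binomial q (2 * n) (n + j) * (q ^ (n + j choose 2) * (q ^ n) ^ (2 * n - (n + j))) * (- x) ^ (n + j)"
        by (simp only: f_def mult_ac)
      moreover have "(- x) ^ (n + j) = (- x) ^ n * ((- 1) ^ j * x ^ j)"
        by (simp only: power_add power_minus[of x j])
      ultimately show ?thesis by (simp only: C_def mult_ac)
    qed
    have minus: "f (n - j) = C * ((-1) ^ j * q ^ (j choose 2) * x' ^ j) * gauss_binomial q (2 * n) (n + j)"
    proof -
      obtain r where n: "n = r + j" using j by (metis le_add_diff_inverse2)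
      have "(n - j choose 2) + n * (2 * n - (n - j)) = (n choose 2) + n * n + (j choose 2) + j"
      proof -
        have "j * j = 2 * (j choose 2) + j" by (induction j) (simp_all add: Suc_choose_2)
        then show ?thesis by (simp add: n choose_2_add algebra_simps)
      qed
      then have "q ^ (n - j choose 2) * (q ^ n) ^ (2 * n - (n - j)) = q ^ (n choose 2) * q ^ (n * n) * q ^ (j choose 2) * q ^ j"
        by (simp only: flip: power_add power_mult)
      moreover have "f (n - j) = gauss_binomial q (2 * n) (n - j) * (q ^ (n - j choose 2) * (q ^ n) ^ (2 * n - (n - j))) * (- x) ^ (n - j)"
        by (simp only: f_def mult_ac)
      moreover have "gauss_binomial q (2 * n) (n - j) = gauss_binomial q (2 * n) (n + j)"
        using gauss_binomial_symmetric[OF \<open>q $ 0 = 0\<close>, of "n - j" "n + j"] j by (simp add: mult_2)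
      moreover have "q ^ j * (- x) ^ (n - j) = (- x) ^ n * ((- 1) ^ j * x' ^ j)"
      proof -
        have "(- x) * (- 1 * x') = q" by (simp add: xx')
        then have "q ^ j = ((- x) * (- 1 * x')) ^ j" by (simp only:)
        then have "q ^ j = (- x) ^ j * ((- 1) ^ j * x' ^ j)"
          by (simp only: power_mult_distrib)
        then show ?thesis by (simp add: n power_add mult_ac)
      qed
      moreover have "g * (P * Q * R * w) * y = P * Q * R * (w * y) * g" for g P Q R w y :: "'a fps"
        by (simp only: mult_ac)
      ultimately have "f (n - j) = q ^ (n choose 2) * q ^ (n * n) * q ^ (j choose 2) *
          ((- x) ^ n * ((- 1) ^ j * x' ^ j)) * gauss_binomial q (2 * n) (n + j)"
        by (simp only:)
      then show ?thesis by (simp only: C_def mult_ac)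
    qed
    show "(if j = 0 then f n else f (n + j) + f (n - j)) =
        C * (jacobi_term q x x' j * gauss_binomial q (2 * n) (n + j))"
      using plus minus by (cases "j = 0") (simp_all add: jacobi_term_def binomial_eq_0 algebra_simps)
  qed simp
  finally show ?thesis using C0 by (simp flip: sum_distrib_left)
qed

text \<open>As \<open>n\<close> grows, the Gaussian binomials near the centre tend to the inverse of
  \<open>qinf q q\<close>. The second claim holds because \<open>x ^ j\<close> and
  \<open>x' ^ j\<close> have order at least \<open>j\<close>; it makes each coefficient of the sum a
  finite sum.\<close>

lemma jacobi_triple_product:
  fixes q x x' :: "'a::idom fps"
  assumes xx': "x * x' = q" and "q \<noteq> 0" and x0: "x $ 0 = 0" and x0': "x' $ 0 = 0"
  shows "jacobi_term q x x' sums (qinf x q * qinf x' q * qinf q q)"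
    and "i < j \<Longrightarrow> jacobi_term q x x' j $ i = 0"
proof -
  have q0: "q $ 0 = 0" using x0 by (simp flip: xx')
  have nth: "(jacobi_term q x x' j * g) $ i = 0" if "i < j" for i j g
  proof -
    have "jacobi_term q x x' j * g = x ^ j * ((-1) ^ j * q ^ (j choose 2) * g) + x' ^ j * ((-1) ^ j * q ^ (j choose 2) * g)"
      using that by (simp add: jacobi_term_def algebra_simps)
    then show ?thesis using that by (simp only: fps_add_nth fps_power_mult_nth_eq_0[OF x0] fps_power_mult_nth_eq_0[OF x0']) simp
  qed
  from nth[of i j 1] show "i < j \<Longrightarrow> jacobi_term q x x' j $ i = 0" by simp
  have lim: "(\<lambda>n. jacobi_term q x x' j * gauss_binomial q (2 * n) (n + j)) \<longlonglongrightarrow> jacobi_term q x x' j * rinv (qinf q q)" for j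
  proof -
    have "(\<lambda>n. qpochhammer q q (n * 2) * rinv (qpochhammer q q (n + j) * qpochhammer q q (n - j)))
        \<longlonglongrightarrow> qinf q q * rinv (qinf q q * qinf q q)"
      by (intro fps_tendsto_mult fps_tendsto_rinv tendsto_shift_sub tendsto_shift_add qpochhammer_tendsto q0
          filterlim_compose[OF qpochhammer_tendsto[OF q0 q0]] mult_nat_right_at_top) simp_all
    moreover have "qinf q q * rinv (qinf q q * qinf q q) = rinv (qinf q q)"
      by (simp add: rinv_mult q0 rinv_right flip: mult.assoc)
    moreover have "\<forall>\<^sub>F n in sequentially. qpochhammer q q (n * 2) * rinv (qpochhammer q q (n + j) * qpochhammer q q (n - j))
        = gauss_binomial q (2 * n) (n + j)"
      using eventually_ge_at_top[of j]
    proof eventually_elim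
      case (elim n)
      define D where "D = qpochhammer q q (n + j) * qpochhammer q q (n - j)"
      have "gauss_binomial q (2 * n) (n + j) * D = qpochhammer q q (n * 2)"
        using gauss_binomial_fact[of q "n + j" "n - j"] elim by (simp add: D_def mult_2 mult_2_right)
      moreover have "D * rinv D = 1"
        by (rule rinv_right) (simp add: D_def qpochhammer_fps_nth_0 q0)
      ultimately show ?case
        unfolding D_def[symmetric] by (metis mult.assoc mult_1_right)
    qed
    ultimately have "(\<lambda>n. gauss_binomial q (2 * n) (n + j)) \<longlonglongrightarrow> rinv (qinf q q)"
      by (simp add: tendsto_cong)
    then show ?thesis by (intro fps_tendsto_mult tendsto_const)
  qed
  note tannery = fps_tannery[where a = "\<lambda>n j. jacobi_term q x x' j * gauss_binomial q (2 * n) (n + j)"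
      and b = "\<lambda>j. jacobi_term q x x' j * rinv (qinf q q)", OF lim nth]
  have "(\<lambda>n. qpochhammer x q n * qpochhammer x' q n) \<longlonglongrightarrow> qinf x q * qinf x' q"
    by (intro fps_tendsto_mult qpochhammer_tendsto x0 x0' q0)
  then have "(\<Sum>j. jacobi_term q x x' j * rinv (qinf q q)) = qinf x q * qinf x' q"
    using tannery(2) unfolding finite_jacobi_triple_product[OF xx' \<open>q \<noteq> 0\<close> q0]
    by (intro tendsto_unique[OF sequentially_bot]) auto
  then have "(\<lambda>j. jacobi_term q x x' j * rinv (qinf q q)) sums (qinf x q * qinf x' q)"
    using tannery(1) by (simp add: sums_iff)
  then have "(\<lambda>j. qinf q q * (jacobi_term q x x' j * rinv (qinf q q))) sums (qinf q q * (qinf x q * qinf x' q))"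
    by (rule fps_sums_mult_left)
  moreover have "qinf q q * (c * rinv (qinf q q)) = c" for c
    using rinv_right[OF qinf_nth_0[OF q0]] by (metis mult.left_commute mult_1_right)
  ultimately show "jacobi_term q x x' sums (qinf x q * qinf x' q * qinf q q)"
    by (simp add: mult_ac)
qed

text \<open>The sum of q^(a j^2 + b j) over all integers j, encoded by representation numbers:
  dissections then become bijections between solution sets.\<close>

definition theta :: "nat \<Rightarrow> nat \<Rightarrow> int fps" where
  "theta a b = Abs_fps (\<lambda>k. int (card {j::int. int a * j ^ 2 + int b * j = int k}))"

lemma fps_sums_nth:
  fixes f :: "nat \<Rightarrow> 'a::comm_ring_1 fps"
  assumes "f sums s" and "\<And>i k. i < k \<Longrightarrow> f k $ i = 0"
  shows "s $ i = (\<Sum>k\<le>i. f k $ i)"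
proof -
  have "\<forall>\<^sub>F n in sequentially. (\<Sum>k<n. f k) $ i = s $ i"
    using assms(1) by (auto simp: sums_def tendsto_fps_iff)
  with eventually_gt_at_top[of i] have "\<forall>\<^sub>F n in sequentially. (\<Sum>k\<le>i. f k $ i) = s $ i"
  proof eventually_elim
    case (elim n)
    have "(\<Sum>k<n. f k $ i) = (\<Sum>k\<le>i. f k $ i)"
      by (rule sum.mono_neutral_right) (use elim assms in auto)
    then show ?case using elim by (simp add: fps_sum_nth)
  qed
  then show ?thesis by simp
qed

text \<open>The form dominates (a - b) j^2, hence j^2, hence the absolute value of j.\<close>

lemma theta_bound:
  fixes j :: int
  assumes "b < a" "int a * j ^ 2 + int b * j = int k"
  shows "nat \<bar>j\<bar> \<le> k"
proof -
  have le: "\<bar>j\<bar> \<le> j ^ 2"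
  proof (cases "j = 0")
    case False
    then have "\<bar>j\<bar> * 1 \<le> \<bar>j\<bar> * \<bar>j\<bar>" by (intro mult_left_mono) auto
    then show ?thesis by (simp add: power2_eq_square)
  qed simp
  also have "j ^ 2 \<le> (int a - int b) * j ^ 2"
    using assms(1) by (simp add: mult_le_cancel_right1)
  also have "\<dots> \<le> int a * j ^ 2 - int b * \<bar>j\<bar>"
    using mult_left_mono[OF le, of "int b"] by (simp add: algebra_simps)
  also have "\<dots> \<le> int a * j ^ 2 + int b * j"
    using mult_left_mono[of "- \<bar>j\<bar>" j "int b"] by simp
  finally show ?thesis using assms(2) by simp
qed

lemma theta_finite: "b < a \<Longrightarrow> finite {j::int. int a * j ^ 2 + int b * j = int k}"
  by (rule finite_subset[of _ "{- int k..int k}"]) (auto dest!: theta_bound)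

text \<open>The triple product at \<open>x = - (fps_X ^ (a - b))\<close> and
  \<open>x' = - (fps_X ^ (a + b))\<close>; these signs cancel the alternating ones.\<close>

lemma theta_product:
  assumes "b < a"
  shows "theta a b = qinf (- (fps_X ^ (a - b))) (fps_X ^ (2 * a)) *
    qinf (- (fps_X ^ (a + b))) (fps_X ^ (2 * a)) * qinf (fps_X ^ (2 * a)) (fps_X ^ (2 * a))" (is "_ = ?P")
proof (rule fps_ext)
  fix k
  define x x' q :: "int fps" where d: "x = - (fps_X ^ (a - b))" "x' = - (fps_X ^ (a + b))" "q = fps_X ^ (2 * a)"
  have "x * x' = q" using assms by (simp add: d mult_2 flip: power_add)
  moreover have "q \<noteq> 0" "x $ 0 = 0" "x' $ 0 = 0" using assms by (simp_all add: d)
  ultimately have sums: "jacobi_term q x x' sums ?P" and zero: "i < j \<Longrightarrow> jacobi_term q x x' j $ i = 0" for i j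
    unfolding d[symmetric] by (rule jacobi_triple_product)+
  \<comment> \<open>\<open>A\<close> stands for the negative integers and \<open>B\<close> for the
    nonnegative ones, so index 0 is counted in \<open>B\<close> only.\<close>
  define A where "A = {j. j \<le> k \<and> j \<noteq> 0 \<and> (a - b) * j + 2 * a * (j choose 2) = k}"
  define B where "B = {j. j \<le> k \<and> (a + b) * j + 2 * a * (j choose 2) = k}"
  have "?P $ k = (\<Sum>j\<le>k. jacobi_term q x x' j $ k)"
    by (rule fps_sums_nth[OF sums zero])
  also have "\<dots> = (\<Sum>j\<le>k. (if j \<in> A then 1 else 0) + (if j \<in> B then 1 else 0))"
  proof (rule sum.cong)
    fix j assume "j \<in> {..k}"
    then have "j \<le> k" by simp
    have e: "(-1) ^ j * q ^ (j choose 2) * (- (fps_X ^ c)) ^ j = (fps_X ^ (c * j + 2 * a * (j choose 2)) :: int fps)" for c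
    proof -
      have "(- (fps_X ^ c) :: int fps) ^ j = (-1) ^ j * fps_X ^ (c * j)"
        by (simp only: power_minus[of "fps_X ^ c"] power_mult)
      moreover have "(-1) ^ j * (-1) ^ j = (1 :: int fps)" by (rule minus_one_mult_self)
      moreover have "m * Q * (m * Y) = (m * m) * (Y * Q)" for m Q Y :: "int fps" by (simp only: mult_ac)
      ultimately show ?thesis by (simp only: d power_add power_mult[symmetric] mult_1_left)
    qed
    show "jacobi_term q x x' j $ k = (if j \<in> A then 1 else 0) + (if j \<in> B then 1 else 0)"
    proof (cases "j = 0")
      case False
      then have "jacobi_term q x x' j = fps_X ^ ((a - b) * j + 2 * a * (j choose 2)) + fps_X ^ ((a + b) * j + 2 * a * (j choose 2))"
        by (simp only: jacobi_term_def distrib_left d(1,2) e if_False)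
      then show ?thesis
        using \<open>j \<le> k\<close> False by (simp only: fps_add_nth fps_X_power_nth A_def B_def mem_Collect_eq) auto
    qed (auto simp: jacobi_term_def A_def B_def binomial_eq_0)
  qed simp
  also have "\<dots> = int (card A) + int (card B)"
  proof -
    have "{..k} \<inter> A = A" "{..k} \<inter> B = B" by (auto simp: A_def B_def)
    then show ?thesis by (simp add: sum.distrib sum.If_cases)
  qed
  also have "\<dots> = int (card {j::int. int a * j ^ 2 + int b * j = int k})"
  proof -
    have c2: "2 * int (n choose 2) = int n ^ 2 - int n" for n
      by (induction n) (simp_all add: Suc_choose_2 power2_eq_square algebra_simps)
    have Aiff: "(a - b) * j + 2 * a * (j choose 2) = k \<longleftrightarrow> int a * (- int j) ^ 2 + int b * (- int j) = int k" for j
    proof -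
      have "int ((a - b) * j + 2 * a * (j choose 2)) = (int a - int b) * int j + int a * (2 * int (j choose 2))"
        using assms by (simp add: of_nat_diff)
      also have "\<dots> = int a * (- int j) ^ 2 + int b * (- int j)"
        unfolding c2 by (simp add: algebra_simps)
      finally show ?thesis by linarith
    qed
    have Biff: "(a + b) * j + 2 * a * (j choose 2) = k \<longleftrightarrow> int a * (int j) ^ 2 + int b * (int j) = int k" for j
    proof -
      have "int ((a + b) * j + 2 * a * (j choose 2)) = (int a + int b) * int j + int a * (2 * int (j choose 2))"
        by simp
      also have "\<dots> = int a * (int j) ^ 2 + int b * (int j)"
        unfolding c2 by (simp add: algebra_simps)
      finally show ?thesis by linarith
    qed
    have "{j::int. int a * j ^ 2 + int b * j = int k} = (\<lambda>j. - int j) ` A \<union> int ` B"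
    proof (intro set_eqI iffI)
      fix j :: int assume j: "j \<in> {j. int a * j ^ 2 + int b * j = int k}"
      show "j \<in> (\<lambda>j. - int j) ` A \<union> int ` B"
      proof (cases "j < 0")
        case True
        then have "nat (- j) \<in> A" "j = - int (nat (- j))"
          using j theta_bound[OF assms, of j k] by (auto simp: A_def Aiff)
        then show ?thesis by blast
      next
        case False
        then have "nat j \<in> B" "j = int (nat j)"
          using j theta_bound[OF assms, of j k] by (auto simp: B_def Biff)
        then show ?thesis by blast
      qed
    qed (auto simp: A_def B_def Aiff Biff)
    moreover have "(\<lambda>j. - int j) ` A \<inter> int ` B = {}" by (auto simp: A_def)
    moreover have "finite A" "finite B" by (auto simp: A_def B_def)
    ultimately show ?thesis
      by (simp add: card_Un_disjoint card_image inj_on_def)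
  qed
  finally show "theta a b $ k = ?P $ k" by (simp add: theta_def)
qed

subsection \<open>Two residue classes of the coefficients\<close>

definition geometric :: "nat \<Rightarrow> int fps" where
  "geometric m = rinv (1 - fps_X ^ m)"

lemma geometric_nth:
  assumes "m > 0"
  shows "geometric m $ n = (if m dvd n then 1 else 0)"
proof -
  define g :: "int fps" where "g = Abs_fps (\<lambda>n. if m dvd n then 1 else 0)"
  have "(1 - fps_X ^ m) * g = 1"
  proof (rule fps_ext)
    fix n
    have "((1 - fps_X ^ m) * g) $ n = g $ n - (fps_X ^ m * g) $ n"
      by (simp add: left_diff_distrib)
    also have "\<dots> = 1 $ n"
    proof (cases "n < m")
      case True
      then show ?thesis using assms by (auto simp: g_def fps_X_power_mult_nth dest: dvd_imp_le)
    next
      case False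
      then have "m dvd n - m \<longleftrightarrow> m dvd n" by (simp add: dvd_minus_self)
      then show ?thesis using False assms by (simp add: g_def fps_X_power_mult_nth)
    qed
    finally show "((1 - fps_X ^ m) * g) $ n = 1 $ n" .
  qed
  then have "geometric m = g"
    unfolding geometric_def using assms by (intro rinv_unique) simp_all
  then show ?thesis by (simp add: g_def)
qed

lemma X_power_geometric_nth:
  assumes "m > 0"
  shows "(fps_X ^ e * geometric m) $ n = (if \<exists>i. n = e + i * m then 1 else 0)"
proof -
  have "(e \<le> n \<and> m dvd n - e) \<longleftrightarrow> (\<exists>i. n = e + i * m)"
    by (auto simp: dvd_def mult.commute intro!: exI[of _ "(n - e) div m"])
  then show ?thesis by (auto simp: fps_X_power_mult_nth geometric_nth[OF assms])
qed

text \<open>As \<open>c\<close> and \<open>m\<close> are coprime, the indices i with e + i m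
  congruent to r modulo c form one class modulo c, whose least member is \<open>i0\<close>. The
  selected exponents therefore again form a progression with difference \<open>m\<close> after
  division by \<open>c\<close>.\<close>

lemma dissect_geometric:
  assumes "m > 0" "coprime c m" "i0 < c" and eq: "e + i0 * m = c * a + r"
  shows "dissect c r (fps_X ^ e * geometric m) = fps_X ^ a * geometric m"
proof (rule fps_ext)
  fix n
  have "(\<exists>i. c * n + r = e + i * m) \<longleftrightarrow> (\<exists>i. n = a + i * m)"
  proof
    assume "\<exists>i. c * n + r = e + i * m"
    then obtain i where i: "c * n + r = e + i * m" ..
    have "int c * (int n - int a) = (int i - int i0) * int m"
      using arg_cong[OF i, of int] arg_cong[OF eq, of int] by (simp add: algebra_simps)
    then have "int c dvd (int i - int i0) * int m" by (metis dvd_triv_left)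
    then have "int c dvd int i - int i0"
      using \<open>coprime c m\<close> by (simp add: coprime_dvd_mult_left_iff)
    then obtain t where t: "int i - int i0 = int c * t" by (elim dvdE)
    have "t \<ge> 0"
    proof (rule ccontr)
      assume "\<not> t \<ge> 0"
      then have "int c * t \<le> int c * (-1)" by (intro mult_left_mono) auto
      then show False using t \<open>i0 < c\<close> by simp
    qed
    have "int c * (int n - int a) = int c * (t * int m)"
      using \<open>int c * (int n - int a) = (int i - int i0) * int m\<close> t by simp
    then have "int n - int a = t * int m" using \<open>i0 < c\<close> by simp
    then have "int n = int (a + nat t * m)" using \<open>t \<ge> 0\<close> by simp
    then have "n = a + nat t * m" by (simp only: of_nat_eq_iff)
    then show "\<exists>i. n = a + i * m" ..
  next
    assume "\<exists>i. n = a + i * m"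
    then obtain i where "n = a + i * m" ..
    then have "c * n + r = e + (i0 + c * i) * m" using eq by (simp add: algebra_simps)
    then show "\<exists>i. c * n + r = e + i * m" ..
  qed
  then show "dissect c r (fps_X ^ e * geometric m) $ n = (fps_X ^ a * geometric m) $ n"
    by (simp add: X_power_geometric_nth[OF assms(1)])
qed

definition euler :: "nat \<Rightarrow> int fps" where
  "euler k = qinf (fps_X ^ k) (fps_X ^ k)"

definition kappa :: "int fps" where
  "kappa = qinf fps_X (fps_X ^ 6) * qinf (fps_X ^ 5) (fps_X ^ 6)"

definition g_xi :: "int fps" where
  "g_xi = (\<Sum>n. xi_term (Suc n))"

lemma qinf_X_compose:
  assumes "a > 0" "b > 0" "m > 0"
  shows "qinf (fps_X ^ a) (fps_X ^ b) oo fps_X ^ m = (qinf (fps_X ^ (m * a)) (fps_X ^ (m * b)) :: int fps)"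
    and "qinf (- (fps_X ^ a)) (fps_X ^ b) oo fps_X ^ m = (qinf (- (fps_X ^ (m * a))) (fps_X ^ (m * b)) :: int fps)"
proof -
  have "(fps_X ^ c oo fps_X ^ m) = (fps_X ^ (m * c) :: int fps)" for c
    using assms by (simp add: fps_compose_power[symmetric] power_mult)
  then show "qinf (fps_X ^ a) (fps_X ^ b) oo fps_X ^ m = (qinf (fps_X ^ (m * a)) (fps_X ^ (m * b)) :: int fps)"
    and "qinf (- (fps_X ^ a)) (fps_X ^ b) oo fps_X ^ m = (qinf (- (fps_X ^ (m * a))) (fps_X ^ (m * b)) :: int fps)"
    using assms by (simp_all add: qinf_compose fps_compose_uminus)
qed

lemma euler_compose: "k > 0 \<Longrightarrow> m > 0 \<Longrightarrow> euler k oo fps_X ^ m = euler (m * k)"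
  by (simp add: euler_def qinf_X_compose)

lemma euler_nth_0: "k > 0 \<Longrightarrow> euler k $ 0 = 1"
  by (simp add: euler_def)

lemma kappa_nth_0: "kappa $ 0 = 1"
  by (simp add: kappa_def)

definition u_xi :: "nat \<Rightarrow> int fps" where
  "u_xi k = (1 - fps_X * (fps_X ^ 6) ^ k) * (1 - fps_X ^ 5 * (fps_X ^ 6) ^ k)"

lemma u_xi_eq: "u_xi k = (1 - fps_X ^ (6 * k + 1)) * (1 - fps_X ^ (6 * k + 5))"
  by (simp add: u_xi_def power_mult[symmetric] power_add mult.commute)

lemma rinv_u_xi: "rinv (u_xi k) = geometric (6 * k + 1) * geometric (6 * k + 5)"
  unfolding u_xi_eq geometric_def by (rule rinv_mult) simp_all

lemma two_geometric_series:
  "(A * (1 - fps_X ^ (6 * k + 5)) + B * (1 - fps_X ^ (6 * k + 1))) * rinv (u_xi k) =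
    A * geometric (6 * k + 1) + B * geometric (6 * k + 5)"
proof -
  define a b :: "int fps" where ab: "a = 1 - fps_X ^ (6 * k + 1)" "b = 1 - fps_X ^ (6 * k + 5)"
  have a: "a * geometric (6 * k + 1) = 1" and b: "b * geometric (6 * k + 5) = 1"
    unfolding geometric_def ab by (rule rinv_right; simp)+
  have "(A * b + B * a) * (x * y) = A * x * (b * y) + B * y * (a * x)" for x y
    by (simp add: algebra_simps)
  then show ?thesis unfolding rinv_u_xi ab[symmetric] by (simp only: a b mult_1_right)
qed

text \<open>Undoes the merging of the indices k and -k-1: the two parts are the summands of the
  bilateral Appell sum.\<close>

lemma appell_numerator:
  "(1 - (fps_X ^ 6) ^ (2 * k + 1)) * rinv (u_xi k) =
    geometric (6 * k + 1) + fps_X ^ (6 * k + 5) * geometric (6 * k + 5)"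
proof -
  define a b :: "int fps" where ab: "a = fps_X ^ (6 * k + 1)" "b = fps_X ^ (6 * k + 5)"
  have "(fps_X ^ 6) ^ (2 * k + 1) = b * a"
    unfolding ab power_mult[symmetric] power_add[symmetric] by (rule arg_cong[of _ _ "(^) fps_X"]) simp
  then have "1 - (fps_X ^ 6) ^ (2 * k + 1) = 1 * (1 - b) + b * (1 - a)"
    by (simp add: algebra_simps)
  then show ?thesis
    using two_geometric_series[of 1 k b] unfolding ab by (simp only: mult_1_left)
qed

lemma twice_Suc_choose_2: "2 * (Suc k choose 2) = k * (k + 1)"
  by (induction k) (simp_all add: Suc_choose_2 numeral_2_eq_2)

text \<open>Base q^6 and x = q, x' = q^5. The exponent \<open>18 * (Suc k choose 2)\<close> is
  \<open>6 * (k * (k + 1) + (Suc k choose 2))\<close>, and the extra 1 comes from the factor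
  \<open>fps_X\<close> in \<open>xi_term_eq\<close>.\<close>

definition xi_appell_term :: "nat \<Rightarrow> int fps" where
  "xi_appell_term k = (-1) ^ k * (fps_X ^ (18 * (Suc k choose 2) + 1) * geometric (6 * k + 1) +
     fps_X ^ (18 * (Suc k choose 2) + 1 + (6 * k + 5)) * geometric (6 * k + 5))"

lemma xi_term_eq:
  "xi_term (Suc n) = fps_X * ((fps_X ^ 6) ^ (n * (n + 1)) *
     rinv (qpochhammer fps_X (fps_X ^ 6) (n + 1) * qpochhammer (fps_X ^ 5) (fps_X ^ 6) (n + 1)))"
proof -
  have "6 * Suc n ^ 2 - 6 * Suc n + 1 = Suc (6 * (n * (n + 1)))"
    by (simp add: power2_eq_square algebra_simps)
  moreover have "fps_X ^ Suc (6 * m) = fps_X * (fps_X ^ 6 :: int fps) ^ m" for m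
    by (simp only: power_mult power_Suc)
  ultimately show ?thesis
    by (simp only: xi_term_def xi_denom_def Suc_eq_plus1[of n] mult.assoc)
qed

lemma sums_xi_appell_term: "xi_appell_term sums (euler 6 * g_xi)"
proof -
  define f where "f = (\<lambda>n. (fps_X ^ 6 :: int fps) ^ (n * (n + 1)) *
     rinv (qpochhammer fps_X (fps_X ^ 6) (n + 1) * qpochhammer (fps_X ^ 5) (fps_X ^ 6) (n + 1)))"
  have "f k $ i = 0" if "i < k" for i k
    unfolding f_def using that by (intro fps_power_mult_nth_eq_0) auto
  then have "summable f" by (rule fps_summableI)
  then have f: "f sums suminf f" by (rule summable_sums)
  have "(\<lambda>n. fps_X * f n) sums (fps_X * suminf f)"
    by (rule fps_sums_mult_left[OF f])
  then have g: "g_xi = fps_X * suminf f"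
    unfolding g_xi_def xi_term_eq f_def by (rule sums_unique[symmetric])
  have "(\<lambda>k. (-1) ^ k * (fps_X ^ 6) ^ (k * (k + 1) + (Suc k choose 2)) * (1 - (fps_X ^ 6) ^ (2 * k + 1)) * rinv (u_xi k))
     sums (qinf (fps_X ^ 6) (fps_X ^ 6) * suminf f)"
    unfolding u_xi_def
    by (rule sums_universal_mock_theta[OF _ _ _ _ f[unfolded f_def], folded f_def])
       (simp_all flip: power_Suc)
  then have "(\<lambda>k. fps_X * ((-1) ^ k * (fps_X ^ 6) ^ (k * (k + 1) + (Suc k choose 2)) * (1 - (fps_X ^ 6) ^ (2 * k + 1)) * rinv (u_xi k)))
     sums (fps_X * (qinf (fps_X ^ 6) (fps_X ^ 6) * suminf f))"
    by (rule fps_sums_mult_left)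
  moreover have "fps_X * (qinf (fps_X ^ 6) (fps_X ^ 6) * suminf f) = euler 6 * g_xi"
    by (simp only: g euler_def mult_ac)
  moreover have "fps_X * ((-1) ^ k * (fps_X ^ 6) ^ (k * (k + 1) + (Suc k choose 2)) * (1 - (fps_X ^ 6) ^ (2 * k + 1)) * rinv (u_xi k))
      = xi_appell_term k" for k
  proof -
    define Y where "Y = (fps_X ^ (18 * (Suc k choose 2) + 1) :: int fps)"
    have "6 * (k * (k + 1) + (Suc k choose 2)) = 18 * (Suc k choose 2)"
      using twice_Suc_choose_2[of k] by simp
    then have Y: "fps_X * (fps_X ^ 6) ^ (k * (k + 1) + (Suc k choose 2)) = Y"
      unfolding Y_def power_mult[symmetric] by (simp only: power_add power_one_right mult.commute)
    have "fps_X * ((-1) ^ k * (fps_X ^ 6) ^ (k * (k + 1) + (Suc k choose 2)) * (1 - (fps_X ^ 6) ^ (2 * k + 1)) * rinv (u_xi k))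
      = (-1) ^ k * (Y * ((1 - (fps_X ^ 6) ^ (2 * k + 1)) * rinv (u_xi k)))"
      unfolding Y[symmetric] by (simp only: mult_ac)
    also have "(1 - (fps_X ^ 6) ^ (2 * k + 1)) * rinv (u_xi k) = geometric (6 * k + 1) + fps_X ^ (6 * k + 5) * geometric (6 * k + 5)"
      by (rule appell_numerator)
    finally show ?thesis
      by (simp only: xi_appell_term_def Y_def distrib_left power_add mult.assoc)
  qed
  ultimately show ?thesis by simp
qed

lemma dissect_minus_one_power: "dissect c r ((-1) ^ k * f) = (-1) ^ k * dissect c r (f :: int fps)"
  by (cases "even k") (simp_all add: fps_eq_iff)

lemma prime_3_nat: "prime (3 :: nat)"
  by simp

text \<open>In the first series the leading exponent is already 1 modulo 3. In the second it is 0
  and the step is 2 modulo 3, so two steps are needed. The result is the summand of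
  \<open>sums_reciprocal_theta\<close> for base \<open>fps_X ^ 6\<close>.\<close>

lemma dissect_3_1_xi_appell_term:
  "dissect 3 1 (xi_appell_term k) = (-1) ^ k * (fps_X ^ 6) ^ (Suc k choose 2) *
     (1 - (fps_X ^ 6) ^ (2 * k + 1)) * rinv (u_xi k)"
proof -
  define C where "C = Suc k choose 2"
  have "\<not> 3 dvd 6 * k + 1" "\<not> 3 dvd 6 * k + 5" by presburger+
  then have cop: "coprime 3 (6 * k + 1)" "coprime 3 (6 * k + 5)"
    using prime_imp_coprime[of "3 :: nat"] by (metis prime_3_nat)+
  have 1: "dissect 3 1 (fps_X ^ (18 * C + 1) * geometric (6 * k + 1)) = fps_X ^ (6 * C) * geometric (6 * k + 1)"
    by (rule dissect_geometric[OF _ cop(1), of 0]) simp_all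
  have 2: "dissect 3 1 (fps_X ^ (18 * C + 1 + (6 * k + 5)) * geometric (6 * k + 5)) =
      fps_X ^ (6 * C + (6 * k + 5)) * geometric (6 * k + 5)"
    by (rule dissect_geometric[OF _ cop(2), of 2]) simp_all
  show ?thesis
    unfolding xi_appell_term_def dissect_minus_one_power dissect_add C_def[symmetric] 1 2 mult.assoc appell_numerator
    by (simp only: power_mult[of fps_X 6 C] power_add[of fps_X "6 * C"] distrib_left mult.assoc)
qed

text \<open>The residue class 1 modulo 3 is free of the mock part: there the Appell sum degenerates to
  the partial fraction expansion of a reciprocal theta product.\<close>

lemma dissect_3_1_g_xi: "dissect 3 1 g_xi * euler 2 * kappa = euler 6 ^ 2"
proof -
  have "(\<lambda>k. dissect 3 1 (xi_appell_term k)) sums dissect 3 1 (euler 6 * g_xi)"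
    by (rule dissect_sums[OF sums_xi_appell_term])
  moreover have "(\<lambda>k. dissect 3 1 (xi_appell_term k)) sums (euler 6 ^ 2 * rinv kappa)"
    unfolding dissect_3_1_xi_appell_term u_xi_def euler_def kappa_def
    by (rule sums_reciprocal_theta) (simp_all flip: power_Suc)
  ultimately have "dissect 3 1 (euler 6 * g_xi) = euler 6 ^ 2 * rinv kappa"
    by (rule sums_unique2)
  moreover have "dissect 3 1 (euler 6 * g_xi) = dissect 3 1 g_xi * euler 2"
    using dissect_mult_compose[of 3 1 g_xi "euler 2"] by (simp add: euler_compose mult.commute)
  ultimately have "dissect 3 1 g_xi * euler 2 * kappa = euler 6 ^ 2 * (rinv kappa * kappa)"
    by (simp add: mult.assoc)
  then show ?thesis by (simp add: rinv_left kappa_nth_0)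
qed

text \<open>The first series needs one step to reach an even exponent, the second none. Their
  leading terms, \<open>fps_X\<close> and \<open>fps_X ^ 3\<close> up to a common power, recombine
  over the common denominator with the k-independent factor
  \<open>fps_X + fps_X ^ 3\<close>.\<close>

lemma dissect_2_0_xi_appell_term:
  "dissect 2 0 (xi_appell_term k) = (fps_X + fps_X ^ 3) * mock_term (fps_X ^ 3) fps_X (fps_X ^ 5) k"
proof -
  define C where "C = Suc k choose 2"
  have cop: "coprime 2 (6 * k + 1)" "coprime 2 (6 * k + 5)"
    by (simp_all add: coprime_left_2_iff_odd)
  have 1: "dissect 2 0 (fps_X ^ (18 * C + 1) * geometric (6 * k + 1)) = fps_X ^ (9 * C + 3 * k + 1) * geometric (6 * k + 1)"
    by (rule dissect_geometric[of _ _ 1]) (simp_all add: cop)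
  have 2: "dissect 2 0 (fps_X ^ (18 * C + 1 + (6 * k + 5)) * geometric (6 * k + 5)) =
      fps_X ^ (9 * C + 3 * k + 3) * geometric (6 * k + 5)"
    by (rule dissect_geometric[of _ _ 0]) (simp_all add: cop)
  define Y where "Y = (fps_X ^ (9 * C + 3 * k) :: int fps)"
  have u: "u_xi k = (1 - fps_X * (fps_X ^ 3) ^ (2 * k)) * (1 - fps_X ^ 5 * (fps_X ^ 3) ^ (2 * k))"
    by (simp add: u_xi_def flip: power_mult)
  have Y: "(fps_X ^ 3) ^ (3 * C + k) = Y"
    unfolding Y_def power_mult[symmetric] by (rule arg_cong[of _ _ "(^) fps_X"]) simp
  have e: "(fps_X + fps_X ^ 3) * (1 - (fps_X ^ 3) ^ (2 * k + 1)) =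
      fps_X * (1 - fps_X ^ (6 * k + 5)) + fps_X ^ 3 * (1 - fps_X ^ (6 * k + 1) :: int fps)"
  proof -
    define a :: "int fps" where "a = fps_X ^ (6 * k)"
    have "(fps_X ^ 3) ^ (2 * k + 1) = a * fps_X ^ 3" "fps_X ^ (6 * k + 5) = a * fps_X ^ 5"
      "fps_X ^ (6 * k + 1) = a * fps_X"
      unfolding a_def power_mult[symmetric] by (simp_all add: power_add)
    then show ?thesis by (simp only:) (simp add: algebra_simps eval_nat_numeral)
  qed
  have "(fps_X + fps_X ^ 3) * mock_term (fps_X ^ 3) fps_X (fps_X ^ 5) k =
      (-1) ^ k * (Y * (((fps_X + fps_X ^ 3) * (1 - (fps_X ^ 3) ^ (2 * k + 1))) * rinv (u_xi k)))"
    unfolding mock_term_def C_def[symmetric] Y u by (simp only: mult_ac)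
  also have "\<dots> = (-1) ^ k * (Y * (fps_X * geometric (6 * k + 1) + fps_X ^ 3 * geometric (6 * k + 5)))"
    unfolding e two_geometric_series ..
  finally show ?thesis
    unfolding xi_appell_term_def dissect_minus_one_power dissect_add C_def[symmetric] 1 2
    by (simp only: Y_def power_add distrib_left mult.assoc power_one_right)
qed

definition mock_xi :: "int fps" where
  "mock_xi = suminf (mock_term (fps_X ^ 3) fps_X (fps_X ^ 5))"

lemma dissect_2_0_g_xi: "dissect 2 0 g_xi * euler 3 = (fps_X + fps_X ^ 3) * mock_xi"
proof -
  have "(\<lambda>k. dissect 2 0 (xi_appell_term k)) sums dissect 2 0 (euler 6 * g_xi)"
    by (rule dissect_sums[OF sums_xi_appell_term])
  moreover have "(\<lambda>k. dissect 2 0 (xi_appell_term k)) sums ((fps_X + fps_X ^ 3) * mock_xi)"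
    unfolding dissect_2_0_xi_appell_term mock_xi_def
    by (intro fps_sums_mult_left summable_sums summable_mock_term) simp
  ultimately have "dissect 2 0 (euler 6 * g_xi) = (fps_X + fps_X ^ 3) * mock_xi"
    by (rule sums_unique2)
  moreover have "dissect 2 0 (euler 6 * g_xi) = dissect 2 0 g_xi * euler 3"
    using dissect_mult_compose[of 2 0 g_xi "euler 3"] by (simp add: euler_compose mult.commute)
  ultimately show ?thesis by simp
qed

lemma dissect_2_0_compose_minus: "dissect 2 0 (f oo - fps_X) = dissect 2 0 (f :: int fps)"
  by (simp add: fps_compose_uminus' fps_eq_iff)

lemma dissect_compose: "m > 0 \<Longrightarrow> dissect m 0 (f oo fps_X ^ m) = (f :: int fps)"
  using dissect_mult_compose[of m 0 1 f] by (simp add: fps_eq_iff fps_compose_X_power_nth)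

text \<open>The exponents 3, 1 and 5 are odd, so negating the variable changes all three signs at
  once and yields the second sum of \<open>mock_theta_identity\<close>.\<close>

lemma mock_term_compose_minus:
  "mock_term (fps_X ^ 3) fps_X (fps_X ^ 5) k oo - fps_X =
    (mock_term (- (fps_X ^ 3)) (- fps_X) (- (fps_X ^ 5)) k :: int fps)"
proof -
  have X: "(fps_X ^ n oo - fps_X) = (- fps_X :: int fps) ^ n" for n
    by (simp add: fps_compose_power[symmetric])
  have c: "- 1 oo - fps_X = (- 1 :: int fps)"
    by (simp add: fps_compose_uminus)
  have o: "(- fps_X :: int fps) ^ 3 = - (fps_X ^ 3)" "(- fps_X :: int fps) ^ 5 = - (fps_X ^ 5)"
    by simp_all
  have 0: "(- fps_X :: int fps) $ 0 = 0" by simp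
  have u: "((1 - fps_X * (fps_X ^ 3) ^ (2 * k)) * (1 - fps_X ^ 5 * (fps_X ^ 3) ^ (2 * k)) :: int fps) $ 0 = 1"
    by simp
  show ?thesis
    unfolding mock_term_def
    by (simp only: fps_compose_mult_distrib[OF 0] fps_compose_sub_distrib fps_compose_1 rinv_compose[OF u 0] c
        fps_compose_power[OF 0, symmetric] fps_X_fps_compose_startby0[OF 0] o)
qed

lemma dissect_2_1_mult_X: "dissect 2 1 (fps_X * f) = dissect 2 0 (f :: int fps)"
  by (simp add: fps_eq_iff)

lemma theta_3_2: "theta 3 2 = qinf (- fps_X) (fps_X ^ 6) * qinf (- (fps_X ^ 5)) (fps_X ^ 6) * euler 6"
  using theta_product[of 2 3] by (simp add: euler_def)

lemma qinf_shift:
  fixes a q :: "'a::comm_ring_1 fps"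
  assumes "a $ 0 = 0" "q $ 0 = 0"
  shows "qinf a q = (1 - a) * qinf (a * q) q"
proof (rule qinf_eqI[OF assms, of Suc])
  have *: "qpochhammer a q (Suc n) = (1 - a) * qpochhammer (a * q) q n" for n
    unfolding qpochhammer_def prod.lessThan_Suc_shift by (simp add: mult_ac)
  show "(\<lambda>n. qpochhammer a q (Suc n)) \<longlonglongrightarrow> (1 - a) * qinf (a * q) q"
    unfolding * by (intro fps_tendsto_mult tendsto_const qpochhammer_tendsto) (simp_all add: assms)
qed (rule filterlim_Suc)

text \<open>In the residue class 2 modulo 4 the mock parts of \<open>mock_theta_identity\<close> cancel, since
  its right-hand side is symmetrised under changing the sign of the variable.\<close>

lemma dissect_2_0_mock_xi:
  "dissect 2 0 (qinf (- (fps_X ^ 3)) (fps_X ^ 6) * mock_xi) * kappa =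
    qinf (- (fps_X ^ 5)) (fps_X ^ 6) * qinf (- (fps_X ^ 7)) (fps_X ^ 6) * euler 6 ^ 2"
proof -
  define V where "V = qinf (- (fps_X ^ 3)) (fps_X ^ 6) * mock_xi"
  have X: "fps_X ^ n oo - fps_X = (- fps_X :: int fps) ^ n" for n
    by (simp add: fps_compose_power[symmetric])
  have "qinf (- (fps_X ^ 3)) (fps_X ^ 6) oo - fps_X = (qinf (fps_X ^ 3) (fps_X ^ 6) :: int fps)"
    by (subst qinf_compose) (simp_all add: fps_compose_uminus X)
  moreover have "mock_xi oo - fps_X = suminf (mock_term (- (fps_X ^ 3)) (- fps_X) (- (fps_X ^ 5)))"
  proof -
    have "mock_term (fps_X ^ 3) fps_X (fps_X ^ 5) sums mock_xi"
      unfolding mock_xi_def by (intro summable_sums summable_mock_term) simp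
    from fps_sums_compose[OF this, of "- fps_X"] show ?thesis
      unfolding mock_term_compose_minus by (rule sums_unique)
  qed
  ultimately have V': "V oo - fps_X = qinf (fps_X ^ 3) (fps_X ^ 6) *
      suminf (mock_term (- (fps_X ^ 3)) (- fps_X) (- (fps_X ^ 5)))"
    unfolding V_def by (subst fps_compose_mult_distrib) simp_all
  \<comment> \<open>For q = X^3, y = X, y' = X^5 the product side of
    \<open>mock_theta_identity\<close> involves only X^2; \<open>L\<close> is half of that side with
    X^2 replaced by X. Thus 5 and 7 are the halves of the exponents 10 and 14 of q^3 y and q^3
    y'.\<close>
  define L where "L = qinf (- (fps_X ^ 5)) (fps_X ^ 6) * qinf (- (fps_X ^ 7)) (fps_X ^ 6) * rinv kappa * euler 6 ^ 2"
  have pow: "(fps_X ^ 3) ^ 3 * fps_X = (fps_X ^ 10 :: int fps)" "(fps_X ^ 3) ^ 3 * fps_X ^ 5 = (fps_X ^ 14 :: int fps)"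
    "(fps_X ^ 3) ^ 4 = (fps_X ^ 12 :: int fps)" "(fps_X ^ 5) ^ 2 = (fps_X ^ 10 :: int fps)"
    "(fps_X ^ 3) ^ 2 = (fps_X ^ 6 :: int fps)"
    unfolding power_mult[symmetric] power_add[symmetric] power_Suc2[symmetric] by simp_all
  have kappa2: "kappa oo fps_X ^ 2 = qinf (fps_X ^ 2) (fps_X ^ 12) * qinf (fps_X ^ 10) (fps_X ^ 12)"
    unfolding kappa_def using qinf_X_compose(1)[of 1 6 2] qinf_X_compose(1)[of 5 6 2]
    by (simp add: fps_compose_mult_distrib)
  have "L oo fps_X ^ 2 = (qinf (- (fps_X ^ 10)) (fps_X ^ 12) * qinf (- (fps_X ^ 14)) (fps_X ^ 12) *
      rinv (qinf (fps_X ^ 2) (fps_X ^ 12) * qinf (fps_X ^ 10) (fps_X ^ 12))) * qinf (fps_X ^ 12) (fps_X ^ 12) ^ 2"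
    unfolding L_def
    by (simp add: fps_compose_mult_distrib fps_compose_power[symmetric] rinv_compose kappa_nth_0 kappa2
        euler_compose qinf_X_compose) (simp add: euler_def)
  moreover have "2 * (qinf (- (fps_X ^ 10)) (fps_X ^ 12) * qinf (- (fps_X ^ 14)) (fps_X ^ 12) *
      rinv (qinf (fps_X ^ 2) (fps_X ^ 12) * qinf (fps_X ^ 10) (fps_X ^ 12))) * qinf (fps_X ^ 12) (fps_X ^ 12) ^ 2
      = V + (V oo - fps_X)"
    using mock_theta_identity[of fps_X "fps_X ^ 5" "fps_X ^ 3 :: int fps"]
    unfolding V' unfolding V_def mock_xi_def pow by (simp flip: power_Suc)
  ultimately have "2 * (L oo fps_X ^ 2) = V + (V oo - fps_X)"
    by (simp only: mult.assoc)
  then have "dissect 2 0 (2 * (L oo fps_X ^ 2)) = dissect 2 0 V + dissect 2 0 V"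
    by (simp only: dissect_add dissect_2_0_compose_minus)
  moreover have "dissect 2 0 (2 * (L oo fps_X ^ 2)) = 2 * L"
    unfolding mult_2 dissect_add by (simp add: dissect_compose)
  ultimately have L: "dissect 2 0 V = L" by (simp flip: mult_2)
  have "L * kappa = (qinf (- (fps_X ^ 5)) (fps_X ^ 6) * qinf (- (fps_X ^ 7)) (fps_X ^ 6) * euler 6 ^ 2) * (rinv kappa * kappa)"
    unfolding L_def by (simp only: mult_ac)
  then show ?thesis unfolding V_def[symmetric] L rinv_left[OF kappa_nth_0] by simp
qed

text \<open>Multiplying by the product of the \<open>1 + fps_X ^ (6 * j + 3)\<close> makes the
  cofactor of \<open>dissect 2 0 g_xi\<close> a series in \<open>fps_X ^ 2\<close>. Since X + X^3 =
  X (1 + X^2), its odd part involves only the even part of \<open>V\<close>, known from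
  \<open>dissect_2_0_mock_xi\<close>; the leftover factor \<open>1 + fps_X\<close> completes the
  theta product.\<close>

lemma dissect_4_2_g_xi: "dissect 4 2 g_xi * euler 3 ^ 2 * kappa = theta 3 2 * euler 6 ^ 2"
proof -
  define V where "V = qinf (- (fps_X ^ 3)) (fps_X ^ 6) * mock_xi"
  define W where "W = (qinf (fps_X ^ 3) (fps_X ^ 6) :: int fps)"
  have e3: "euler 3 = W * euler 6"
    using qinf_split2[of "fps_X ^ 3" "fps_X ^ 3 :: int fps"]
    by (simp add: euler_def W_def flip: power_mult power_add)
  have W2: "qinf (- (fps_X ^ 3)) (fps_X ^ 6) * W = W oo fps_X ^ 2"
    using qinf_mult_uminus[of "fps_X ^ 3" "fps_X ^ 6 :: int fps"]
    unfolding W_def by (simp add: qinf_X_compose mult.commute flip: power_mult)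
  have e6: "euler 6 = euler 3 oo fps_X ^ 2" by (simp add: euler_compose)
  have "qinf (- (fps_X ^ 3)) (fps_X ^ 6) * (dissect 2 0 g_xi * euler 3) = (fps_X + fps_X ^ 3) * V"
    unfolding dissect_2_0_g_xi V_def by (simp only: mult_ac)
  then have "dissect 2 0 g_xi * ((qinf (- (fps_X ^ 3)) (fps_X ^ 6) * W) * euler 6) = (fps_X + fps_X ^ 3) * V"
    unfolding e3 by (simp only: mult_ac)
  moreover have "(qinf (- (fps_X ^ 3)) (fps_X ^ 6) * W) * euler 6 = (W * euler 3) oo fps_X ^ 2"
    unfolding W2 e6 by (simp add: fps_compose_mult_distrib)
  moreover have "(fps_X + fps_X ^ 3) * V = fps_X * (V * ((1 + fps_X) oo fps_X ^ 2))"
    by (simp add: fps_compose_add_distrib algebra_simps eval_nat_numeral)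
  ultimately have "dissect 2 1 (dissect 2 0 g_xi * ((W * euler 3) oo fps_X ^ 2)) =
      dissect 2 1 (fps_X * (V * ((1 + fps_X) oo fps_X ^ 2)))" by simp
  then have "dissect 4 2 g_xi * (W * euler 3) = dissect 2 0 V * (1 + fps_X)"
    unfolding dissect_2_1_mult_X by (simp add: dissect_mult_compose dissect_dissect)
  then have "dissect 4 2 g_xi * (W * euler 3) * kappa * euler 6 = (dissect 2 0 V * kappa) * (1 + fps_X) * euler 6"
    by (simp only: mult_ac)
  also have "\<dots> = qinf (- (fps_X ^ 5)) (fps_X ^ 6) * ((1 + fps_X) * qinf (- (fps_X ^ 7)) (fps_X ^ 6)) * euler 6 * euler 6 ^ 2"
    unfolding V_def dissect_2_0_mock_xi by (simp only: mult_ac)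
  also have "(1 + fps_X) * qinf (- (fps_X ^ 7)) (fps_X ^ 6) = (qinf (- fps_X) (fps_X ^ 6) :: int fps)"
    using qinf_shift[of "- fps_X" "fps_X ^ 6 :: int fps"] by (simp flip: power_Suc)
  also have "qinf (- (fps_X ^ 5)) (fps_X ^ 6) * qinf (- fps_X) (fps_X ^ 6) * euler 6 * euler 6 ^ 2 = theta 3 2 * euler 6 ^ 2"
    unfolding theta_3_2 by (simp only: mult_ac)
  finally show ?thesis unfolding e3 by (simp add: power2_eq_square mult_ac)
qed

subsection \<open>Congruences between power series\<close>

definition fps_cong :: "int \<Rightarrow> int fps \<Rightarrow> int fps \<Rightarrow> bool" where
  "fps_cong m f g \<longleftrightarrow> (\<forall>n. [f $ n = g $ n] (mod m))"

lemma fps_cong_refl [simp]: "fps_cong m f f"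
  by (simp add: fps_cong_def)

lemma fps_cong_sym: "fps_cong m f g \<Longrightarrow> fps_cong m g f"
  by (auto simp: fps_cong_def intro: cong_sym)

lemma fps_cong_trans [trans]: "fps_cong m f g \<Longrightarrow> fps_cong m g h \<Longrightarrow> fps_cong m f h"
  by (auto simp: fps_cong_def intro: cong_trans)

lemma fps_cong_add: "fps_cong m f g \<Longrightarrow> fps_cong m h k \<Longrightarrow> fps_cong m (f + h) (g + k)"
  by (auto simp: fps_cong_def intro: cong_add)

lemma fps_cong_mult: "fps_cong m f g \<Longrightarrow> fps_cong m h k \<Longrightarrow> fps_cong m (f * h) (g * k)"
  by (auto simp: fps_cong_def fps_mult_nth intro!: cong_sum cong_mult)

lemma fps_cong_power: "fps_cong m f g \<Longrightarrow> fps_cong m (f ^ n) (g ^ n)"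
  by (induction n) (auto intro: fps_cong_mult)

lemma fps_cong_compose: "fps_cong m f g \<Longrightarrow> k > 0 \<Longrightarrow> fps_cong m (f oo fps_X ^ k) (g oo fps_X ^ k)"
  by (auto simp: fps_cong_def fps_compose_X_power_nth)

lemma fps_cong_dissect: "fps_cong m f g \<Longrightarrow> fps_cong m (dissect k r f) (dissect k r g)"
  by (auto simp: fps_cong_def)

lemma fps_cong_cancel:
  assumes "fps_cong m (f * u) (g * u)" "u $ 0 = 1"
  shows "fps_cong m f g"
proof -
  have "fps_cong m (f * u * rinv u) (g * u * rinv u)"
    by (intro fps_cong_mult assms(1) fps_cong_refl)
  then show ?thesis by (simp add: mult.assoc rinv_right[OF assms(2)])
qed

lemma fps_two_mult_nth: "(2 * f :: int fps) $ n = 2 * (f $ n)"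
  by (simp only: mult_2 fps_add_nth)

lemma fps_cong_2_imp_4:
  assumes "fps_cong 2 f g"
  shows "fps_cong 4 (2 * f) (2 * g)"
  unfolding fps_cong_def
proof
  fix n
  have "2 dvd f $ n - g $ n" using assms by (simp add: fps_cong_def cong_iff_dvd_diff)
  then have "2 * 2 dvd 2 * (f $ n - g $ n)" by (intro mult_dvd_mono) simp_all
  then show "[(2 * f) $ n = (2 * g) $ n] (mod 4)"
    by (simp add: fps_two_mult_nth cong_iff_dvd_diff right_diff_distrib)
qed

lemma fps_cong_4_imp_2: "fps_cong 4 f g \<Longrightarrow> fps_cong 2 f g"
  by (auto simp: fps_cong_def intro: cong_dvd_modulus[of _ _ 4 2])

text \<open>If f = g + 2h, then f^2 - g^2 = 4 (g h + h^2).\<close>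

lemma fps_cong_square:
  assumes "fps_cong 2 f g"
  shows "fps_cong 4 (f ^ 2) (g ^ 2)"
proof -
  define h where "h = Abs_fps (\<lambda>n. (f $ n - g $ n) div 2)"
  have f: "f = g + 2 * h"
  proof (rule fps_ext)
    fix n
    have "2 dvd f $ n - g $ n" using assms by (simp add: fps_cong_def cong_iff_dvd_diff)
    then show "f $ n = (g + 2 * h) $ n" by (simp add: h_def fps_two_mult_nth)
  qed
  have "f ^ 2 = g ^ 2 + 2 * (2 * (g * h + h ^ 2))"
    unfolding f by (simp add: power2_eq_square algebra_simps)
  then have "(f ^ 2) $ n = (g ^ 2) $ n + 4 * (g * h + h ^ 2) $ n" for n
    by (simp only: fps_add_nth fps_two_mult_nth)
  then show ?thesis unfolding fps_cong_def cong_iff_dvd_diff by simp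
qed

lemma dissect_2_decomp: "f = (dissect 2 0 f oo fps_X ^ 2) + fps_X * (dissect 2 1 f oo fps_X ^ 2)"
  for f :: "'a::comm_ring_1 fps"
proof (rule fps_ext)
  fix n
  show "f $ n = ((dissect 2 0 f oo fps_X ^ 2) + fps_X * (dissect 2 1 f oo fps_X ^ 2)) $ n"
  proof (cases "even n")
    case True
    then show ?thesis by (auto simp: fps_compose_X_power_nth elim!: evenE) (metis)?
  next
    case False
    then show ?thesis by (auto simp: fps_compose_X_power_nth elim!: oddE)
  qed
qed

lemma dissect_2_0_X_mult: "dissect 2 0 (fps_X * f) = fps_X * dissect 2 1 (f :: int fps)"
proof (rule fps_ext)
  fix n show "dissect 2 0 (fps_X * f) $ n = (fps_X * dissect 2 1 f) $ n"
    by (cases n) simp_all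
qed

lemma dissect_2_mult:
  fixes f g :: "int fps"
  shows "dissect 2 0 (f * g) = dissect 2 0 f * dissect 2 0 g + fps_X * (dissect 2 1 f * dissect 2 1 g)"
    and "dissect 2 1 (f * g) = dissect 2 0 f * dissect 2 1 g + dissect 2 1 f * dissect 2 0 g"
proof -
  have "f * g = f * (dissect 2 0 g oo fps_X ^ 2) + (fps_X * f) * (dissect 2 1 g oo fps_X ^ 2)"
    by (subst (1) dissect_2_decomp[of g]) (simp only: distrib_left mult_ac)
  then have *: "dissect 2 r (f * g) = dissect 2 r f * dissect 2 0 g + dissect 2 r (fps_X * f) * dissect 2 1 g" if "r < 2" for r
    using that by (simp only: dissect_add dissect_mult_compose)
  show "dissect 2 0 (f * g) = dissect 2 0 f * dissect 2 0 g + fps_X * (dissect 2 1 f * dissect 2 1 g)"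
    using *[of 0] unfolding dissect_2_0_X_mult by (simp only: mult.assoc)
  show "dissect 2 1 (f * g) = dissect 2 0 f * dissect 2 1 g + dissect 2 1 f * dissect 2 0 g"
    using *[of 1] unfolding dissect_2_1_mult_X by (simp only: add.commute)
qed

text \<open>The Frobenius map modulo 2. With even part a and odd part b of f, the square has even
  part a^2 + X b^2 and odd part 2 a b, so strong induction on the index applies to a and b.\<close>

lemma fps_square_cong: "fps_cong 2 (f ^ 2) (f oo fps_X ^ 2)"
proof -
  have "[(f ^ 2) $ n = (f oo fps_X ^ 2) $ n] (mod 2)" for n
  proof (induction n arbitrary: f rule: less_induct)
    case (less n)
    define a b where "a = dissect 2 0 f" and "b = dissect 2 1 f"
    show ?case
    proof (cases "even n")
      case True
      then obtain k where n: "n = 2 * k" by (elim evenE)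
      show ?thesis
      proof (cases "k = 0")
        case True
        have "even (f $ 0 * f $ 0 - f $ 0)" by simp
        then show ?thesis using n True by (simp add: fps_compose_X_power_nth cong_iff_dvd_diff power2_eq_square)
      next
        case False
        have "(f ^ 2) $ n = dissect 2 0 (f * f) $ k"
          by (simp add: n power2_eq_square)
        also have "\<dots> = (a ^ 2) $ k + (fps_X * b ^ 2) $ k"
          unfolding dissect_2_mult by (simp add: a_def b_def power2_eq_square)
        also have "[\<dots> = (a oo fps_X ^ 2) $ k + (fps_X * (b oo fps_X ^ 2)) $ k] (mod 2)"
        proof (rule cong_add)
          show "[(a ^ 2) $ k = (a oo fps_X ^ 2) $ k] (mod 2)"
            using False n by (intro less.IH) simp
          have "[(b ^ 2) $ (k - 1) = (b oo fps_X ^ 2) $ (k - 1)] (mod 2)"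
            using False n by (intro less.IH) simp
          then show "[(fps_X * b ^ 2) $ k = (fps_X * (b oo fps_X ^ 2)) $ k] (mod 2)"
            using False by simp
        qed
        also have "(a oo fps_X ^ 2) $ k + (fps_X * (b oo fps_X ^ 2)) $ k = f $ k"
          unfolding a_def b_def by (subst (3) dissect_2_decomp) simp
        finally show ?thesis by (simp add: n fps_compose_X_power_nth)
      qed
    next
      case False
      then obtain k where n: "n = 2 * k + 1" by (elim oddE)
      have "(f ^ 2) $ n = dissect 2 1 (f * f) $ k"
        by (simp add: n power2_eq_square)
      also have "\<dots> = 2 * (a * b) $ k"
        unfolding dissect_2_mult a_def b_def mult.commute[of "dissect 2 1 f"] mult_2[symmetric]
        by (rule fps_two_mult_nth)
      finally show ?thesis using False by (simp add: fps_compose_X_power_nth cong_iff_dvd_diff)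
    qed
  qed
  then show ?thesis by (simp add: fps_cong_def)
qed

section \<open>Parity dissections of the theta functions\<close>

lemma theta_nth: "theta a b $ k = int (card {j::int. int a * j ^ 2 + int b * j = int k})"
  by (simp add: theta_def)

lemma theta_compose_nth:
  assumes "m > 0"
  shows "(theta a b oo fps_X ^ m) $ k = int (card {j::int. int m * (int a * j ^ 2 + int b * j) = int k})"
proof (cases "m dvd k")
  case True
  then obtain l where "k = m * l" by (elim dvdE)
  then show ?thesis using assms by (simp add: fps_compose_X_power_nth theta_nth)
next
  case False
  then have "{j::int. int m * (int a * j ^ 2 + int b * j) = int k} = {}"
    by (auto simp: dvd_def) (metis False dvd_triv_left int_dvd_int_iff)
  then show ?thesis using assms False by (simp add: fps_compose_X_power_nth)
qed

text \<open>For j = 2i the exponent is 4 (3 i^2 + i), for j = -2i - 1 it is 1 + 4 (3 i^2 + 2 i). The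
  negative sign in the odd case is what reproduces the same form.\<close>

lemma dissect_theta_3_2:
  "dissect 2 0 (theta 3 2) = theta 3 1 oo fps_X ^ 2" (is ?even)
  "dissect 2 1 (theta 3 2) = theta 3 2 oo fps_X ^ 2" (is ?odd)
proof -
  have "{j::int. 3 * j ^ 2 + 2 * j = 2 * int k} = (\<lambda>j. 2 * j) ` {j. 2 * (3 * j ^ 2 + j) = int k}" for k
  proof (intro set_eqI iffI)
    fix j :: int assume j: "j \<in> {j. 3 * j ^ 2 + 2 * j = 2 * int k}"
    then have "even (3 * j ^ 2 + 2 * j)" by simp
    then obtain i where "j = 2 * i" by (auto elim!: evenE)
    then show "j \<in> (\<lambda>j. 2 * j) ` {j. 2 * (3 * j ^ 2 + j) = int k}"
      using j by (auto simp: power2_eq_square)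
  qed (auto simp: power2_eq_square)
  then show ?even
    by (intro fps_ext) (simp add: theta_nth theta_compose_nth card_image inj_on_def)
  have "{j::int. 3 * j ^ 2 + 2 * j = 1 + 2 * int k} = (\<lambda>j. - (2 * j) - 1) ` {j. 2 * (3 * j ^ 2 + 2 * j) = int k}" for k
  proof (intro set_eqI iffI)
    fix j :: int assume j: "j \<in> {j. 3 * j ^ 2 + 2 * j = 1 + 2 * int k}"
    then have "odd (3 * j ^ 2 + 2 * j)" by simp
    then have "odd j" by simp
    then obtain i where "j = 2 * i + 1" by (elim oddE)
    then have "j = - (2 * (- i - 1)) - 1" by simp
    then show "j \<in> (\<lambda>j. - (2 * j) - 1) ` {j. 2 * (3 * j ^ 2 + 2 * j) = int k}"
      using j by (intro image_eqI[of _ _ "- i - 1"]) (auto simp: power2_eq_square algebra_simps)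
  qed (auto simp: power2_eq_square algebra_simps)
  then show ?odd
    by (intro fps_ext) (simp add: theta_nth theta_compose_nth card_image inj_on_def)
qed

lemma dissect_theta_3_1: "dissect 2 1 (theta 3 1) = 0"
proof (rule fps_ext)
  fix k
  have "{j::int. 3 * j ^ 2 + j = 1 + 2 * int k} = {}"
  proof -
    have "3 * j ^ 2 + j \<noteq> 1 + 2 * int k" for j :: int
    proof
      assume "3 * j ^ 2 + j = 1 + 2 * int k"
      moreover have "even (3 * j ^ 2 + j)" by simp
      ultimately show False by simp
    qed
    then show ?thesis by blast
  qed
  then show "dissect 2 1 (theta 3 1) $ k = 0 $ k" by (simp add: theta_nth)
qed

text \<open>Every odd j is exactly one of 4i + 1 and -4i - 1, and its square is 8 (2 i^2 + i) + 1 in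
  both cases; hence the factor 2.\<close>

lemma dissect_theta_1_0:
  "dissect 2 0 (theta 1 0) = theta 1 0 oo fps_X ^ 2" (is ?even)
  "dissect 2 1 (theta 1 0) = 2 * (theta 2 1 oo fps_X ^ 4)" (is ?odd)
proof -
  have "{j::int. j ^ 2 = 2 * int k} = (\<lambda>j. 2 * j) ` {j. 2 * j ^ 2 = int k}" for k
  proof (intro set_eqI iffI)
    fix j :: int assume j: "j \<in> {j. j ^ 2 = 2 * int k}"
    then have "even (j ^ 2)" by simp
    then obtain i where "j = 2 * i" by (auto elim!: evenE)
    then show "j \<in> (\<lambda>j. 2 * j) ` {j. 2 * j ^ 2 = int k}"
      using j by (auto simp: power2_eq_square)
  qed (auto simp: power2_eq_square)
  then show ?even
    by (intro fps_ext) (simp add: theta_nth theta_compose_nth card_image inj_on_def)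
  show ?odd
  proof (rule fps_ext)
    fix k
    define S where "S = {j::int. 4 * (2 * j ^ 2 + j) = int k}"
    have "finite S"
      using theta_finite[of 4 8 k] by (simp add: S_def algebra_simps)
    have "{j::int. j ^ 2 = 1 + 2 * int k} = (\<lambda>j. 4 * j + 1) ` S \<union> (\<lambda>j. - 4 * j - 1) ` S"
    proof (intro set_eqI iffI)
      fix j :: int assume j: "j \<in> {j. j ^ 2 = 1 + 2 * int k}"
      then have "odd (j ^ 2)" by simp
      then have "odd j" by simp
      then have "j mod 4 = 1 \<or> j mod 4 = 3" by presburger
      then have "j = 4 * (j div 4) + 1 \<or> j = - 4 * (- (j div 4) - 1) - 1" by presburger
      then obtain i where "j = 4 * i + 1 \<or> j = - 4 * i - 1" by blast
      moreover have "i \<in> S" if "j = 4 * i + 1 \<or> j = - 4 * i - 1" for i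
      proof -
        have "j ^ 2 = 8 * (2 * i ^ 2 + i) + 1"
          using that by (elim disjE; hypsubst) (simp_all add: power2_eq_square algebra_simps)
        then show ?thesis using j by (simp add: S_def)
      qed
      ultimately show "j \<in> (\<lambda>j. 4 * j + 1) ` S \<union> (\<lambda>j. - 4 * j - 1) ` S"
        by blast
    qed (auto simp: S_def power2_eq_square algebra_simps)
    moreover have "(\<lambda>j. 4 * j + 1) ` S \<inter> (\<lambda>j. - 4 * j - 1) ` S = {}"
    proof -
      have "4 * i + 1 \<noteq> - 4 * j - 1" for i j :: int by presburger
      then show ?thesis by blast
    qed
    ultimately have "card {j::int. j ^ 2 = 1 + 2 * int k} = card S + card S"
      using \<open>finite S\<close> by (simp add: card_Un_disjoint card_image inj_on_def)
    then show "dissect 2 1 (theta 1 0) $ k = (2 * (theta 2 1 oo fps_X ^ 4)) $ k"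
      by (simp add: theta_nth theta_compose_nth fps_two_mult_nth S_def)
  qed
qed

subsection \<open>The congruences modulo 4\<close>

text \<open>\<open>phi\<close> and \<open>psi\<close> are Ramanujan's theta functions: 2 j^2 + j
  runs through each triangular number once as j runs through the integers.\<close>

abbreviation psi :: "int fps" where "psi \<equiv> theta 2 1"
abbreviation phi :: "int fps" where "phi \<equiv> theta 1 0"
abbreviation T_theta :: "int fps" where "T_theta \<equiv> theta 3 2"
abbreviation U_theta :: "int fps" where "U_theta \<equiv> theta 3 1"

lemma euler_split: "euler 1 = kappa * qinf (fps_X ^ 3) (fps_X ^ 6) * euler 2"
proof -
  have "euler 1 = qinf fps_X (fps_X ^ 2) * euler 2"
    using qinf_split2[of fps_X "fps_X :: int fps"] by (simp add: euler_def power2_eq_square)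
  moreover have "qinf fps_X (fps_X ^ 2) = kappa * (qinf (fps_X ^ 3) (fps_X ^ 6) :: int fps)"
    using qinf_split3[of fps_X "fps_X ^ 2 :: int fps"]
    unfolding power_mult[symmetric] power_Suc[symmetric] by (simp add: kappa_def mult_ac)
  ultimately show ?thesis by simp
qed

lemma euler_3_split: "euler 3 = qinf (fps_X ^ 3) (fps_X ^ 6) * euler 6"
  using qinf_split2[of "fps_X ^ 3" "fps_X ^ 3 :: int fps"]
  by (simp add: euler_def flip: power_mult power_add)

lemma kappa_euler: "euler 1 * euler 6 = kappa * euler 2 * euler 3"
  unfolding euler_split euler_3_split by (simp only: mult_ac)

text \<open>Each factor 1 - a of \<open>kappa\<close> meets 1 + a in the product for
  \<open>T_theta\<close>. The identity later trades 1 / \<open>kappa\<close> for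
  \<open>T_theta\<close> over a series in \<open>fps_X ^ 2\<close>.\<close>

lemma theta_3_2_kappa: "T_theta * kappa = euler 6 * (kappa oo fps_X ^ 2)"
proof -
  have "kappa oo fps_X ^ 2 = qinf (fps_X ^ 2) (fps_X ^ 12) * qinf (fps_X ^ 10) (fps_X ^ 12)"
    unfolding kappa_def using qinf_X_compose(1)[of 1 6 2] qinf_X_compose(1)[of 5 6 2]
    by (simp add: fps_compose_mult_distrib)
  moreover have "qinf fps_X (fps_X ^ 6) * qinf (- fps_X) (fps_X ^ 6) = (qinf (fps_X ^ 2) (fps_X ^ 12) :: int fps)"
    using qinf_mult_uminus[of fps_X "fps_X ^ 6 :: int fps"] by (simp flip: power_mult)
  moreover have "qinf (fps_X ^ 5) (fps_X ^ 6) * qinf (- (fps_X ^ 5)) (fps_X ^ 6) = (qinf (fps_X ^ 10) (fps_X ^ 12) :: int fps)"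
    using qinf_mult_uminus[of "fps_X ^ 5" "fps_X ^ 6 :: int fps"] by (simp flip: power_mult)
  moreover have "T_theta * kappa = euler 6 * ((qinf fps_X (fps_X ^ 6) * qinf (- fps_X) (fps_X ^ 6)) *
      (qinf (fps_X ^ 5) (fps_X ^ 6) * qinf (- (fps_X ^ 5)) (fps_X ^ 6)))"
    unfolding theta_3_2 kappa_def by (simp only: mult_ac)
  ultimately show ?thesis by simp
qed

text \<open>Gauss's product. Negating the variable gives the simplest quotient, and modulo 4 the
  sign is harmless by \<open>phi_minus_cong\<close>.\<close>

lemma phi_minus_euler: "(phi oo - fps_X) * euler 2 = euler 1 ^ 2"
proof -
  have X: "fps_X ^ n oo - fps_X = (- fps_X :: int fps) ^ n" for n
    by (simp add: fps_compose_power[symmetric])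
  have "phi = qinf (- fps_X) (fps_X ^ 2) * qinf (- fps_X) (fps_X ^ 2) * euler 2"
    using theta_product[of 0 1] by (simp add: euler_def)
  moreover have "qinf (- fps_X) (fps_X ^ 2) oo - fps_X = (qinf fps_X (fps_X ^ 2) :: int fps)"
    by (subst qinf_compose) (simp_all add: fps_compose_uminus X)
  moreover have "euler 2 oo - fps_X = euler 2"
    unfolding euler_def by (subst qinf_compose) (simp_all add: X)
  ultimately have "phi oo - fps_X = qinf fps_X (fps_X ^ 2) * qinf fps_X (fps_X ^ 2) * euler 2"
    by (simp add: fps_compose_mult_distrib)
  moreover have "euler 1 = qinf fps_X (fps_X ^ 2) * euler 2"
    using qinf_split2[of fps_X "fps_X :: int fps"] by (simp add: euler_def power2_eq_square)
  ultimately show ?thesis by (simp add: power2_eq_square mult_ac)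
qed

lemma psi_euler: "psi * euler 1 = euler 2 ^ 2"
proof -
  have "psi = qinf (- fps_X) (fps_X ^ 4) * qinf (- (fps_X ^ 3)) (fps_X ^ 4) * euler 4"
    using theta_product[of 1 2] by (simp add: euler_def)
  also have "qinf (- fps_X) (fps_X ^ 4) * qinf (- (fps_X ^ 3)) (fps_X ^ 4) = (qinf (- fps_X) (fps_X ^ 2) :: int fps)"
    using qinf_split2[of "- fps_X" "fps_X ^ 2 :: int fps"]
    unfolding power_mult[symmetric] by (simp flip: power_Suc)
  finally have "psi * euler 1 = (qinf fps_X (fps_X ^ 2) * qinf (- fps_X) (fps_X ^ 2)) * euler 4 * euler 2"
    using qinf_split2[of fps_X "fps_X :: int fps"] by (simp add: euler_def power2_eq_square mult_ac)
  also have "qinf fps_X (fps_X ^ 2) * qinf (- fps_X) (fps_X ^ 2) = (qinf (fps_X ^ 2) (fps_X ^ 4) :: int fps)"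
    using qinf_mult_uminus[of fps_X "fps_X ^ 2 :: int fps"] by (simp flip: power_mult)
  also have "qinf (fps_X ^ 2) (fps_X ^ 4) * euler 4 = euler 2"
    using qinf_split2[of "fps_X ^ 2" "fps_X ^ 2 :: int fps"] by (simp add: euler_def flip: power_mult power_add)
  finally show ?thesis by (simp add: power2_eq_square)
qed

lemma U_theta_euler: "U_theta * (qinf (fps_X ^ 2) (fps_X ^ 6) * qinf (fps_X ^ 4) (fps_X ^ 6)) =
    ((qinf (fps_X ^ 2) (fps_X ^ 6) * qinf (fps_X ^ 4) (fps_X ^ 6)) oo fps_X ^ 2) * euler 6"
proof -
  have "U_theta = qinf (- (fps_X ^ 2)) (fps_X ^ 6) * qinf (- (fps_X ^ 4)) (fps_X ^ 6) * euler 6"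
    using theta_product[of 1 3] by (simp add: euler_def)
  moreover have "qinf (fps_X ^ 2) (fps_X ^ 6) * qinf (- (fps_X ^ 2)) (fps_X ^ 6) = (qinf (fps_X ^ 4) (fps_X ^ 12) :: int fps)"
    using qinf_mult_uminus[of "fps_X ^ 2" "fps_X ^ 6 :: int fps"] by (simp flip: power_mult)
  moreover have "qinf (fps_X ^ 4) (fps_X ^ 6) * qinf (- (fps_X ^ 4)) (fps_X ^ 6) = (qinf (fps_X ^ 8) (fps_X ^ 12) :: int fps)"
    using qinf_mult_uminus[of "fps_X ^ 4" "fps_X ^ 6 :: int fps"] by (simp flip: power_mult)
  moreover have "(a' * b' * e) * (a * b) = ((a * a') * (b * b')) * e" for a a' b b' e :: "int fps"
    by (simp only: mult_ac)
  ultimately have "U_theta * (qinf (fps_X ^ 2) (fps_X ^ 6) * qinf (fps_X ^ 4) (fps_X ^ 6)) =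
      (qinf (fps_X ^ 4) (fps_X ^ 12) * qinf (fps_X ^ 8) (fps_X ^ 12)) * euler 6"
    by (simp only:)
  then show ?thesis
    by (simp add: fps_compose_mult_distrib qinf_X_compose)
qed

lemma euler_2_split: "euler 2 = qinf (fps_X ^ 2) (fps_X ^ 6) * qinf (fps_X ^ 4) (fps_X ^ 6) * euler 6"
  using qinf_split3[of "fps_X ^ 2" "fps_X ^ 2 :: int fps"]
  by (simp add: euler_def flip: power_mult power_add)

lemma euler_square_cong: "k > 0 \<Longrightarrow> fps_cong 2 (euler k ^ 2) (euler (2 * k))"
  using fps_square_cong[of "euler k"] by (simp add: euler_compose)

lemma euler_4th_cong: "k > 0 \<Longrightarrow> fps_cong 4 (euler k ^ 4) (euler (2 * k) ^ 2)"
  using fps_cong_square[OF euler_square_cong[of k]] by (simp flip: power_mult)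

lemma unit_power: "f $ 0 = 1 \<Longrightarrow> (f ^ n) $ 0 = (1 :: int)"
  by (simp add: fps_nth_power_0)

lemma U_theta_cong: "fps_cong 2 U_theta (euler 2)"
proof -
  define a :: "int fps" where "a = qinf (fps_X ^ 2) (fps_X ^ 6) * qinf (fps_X ^ 4) (fps_X ^ 6)"
  have "fps_cong 2 (U_theta * a) (a ^ 2 * euler 6)"
    unfolding a_def U_theta_euler by (intro fps_cong_mult fps_cong_sym[OF fps_square_cong] fps_cong_refl)
  also have "a ^ 2 * euler 6 = euler 2 * a"
    unfolding euler_2_split a_def by (simp only: power2_eq_square mult_ac)
  finally show ?thesis by (rule fps_cong_cancel) (simp add: a_def)
qed

lemma psi_cong: "fps_cong 2 psi (euler 1 ^ 3)"
proof -
  have "fps_cong 2 (psi * euler 1) (euler 1 ^ 4)"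
    unfolding psi_euler using euler_4th_cong[of 1] by (auto intro: fps_cong_sym fps_cong_4_imp_2)
  also have "euler 1 ^ 4 = euler 1 ^ 3 * euler 1" by (simp add: eval_nat_numeral mult_ac)
  finally show ?thesis by (rule fps_cong_cancel) (simp add: euler_nth_0)
qed

text \<open>By Frobenius \<open>theta_3_2_kappa\<close> gives T = E_6 K modulo 2. With K = E_1 E_6 /
  (E_2 E_3) this yields T E_1 = E_1^2 E_6^2 / (E_2 E_3) = E_6^2 / E_3 = E_3^3. The proof carries the
  factor E_1 E_3 instead of dividing.\<close>

lemma T_theta_cong: "fps_cong 2 (T_theta * euler 1) (euler 3 ^ 3)"
proof -
  have "fps_cong 2 (T_theta * kappa) (euler 6 * kappa ^ 2)"
    unfolding theta_3_2_kappa by (intro fps_cong_mult fps_cong_sym[OF fps_square_cong] fps_cong_refl)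
  also have "euler 6 * kappa ^ 2 = (euler 6 * kappa) * kappa" by (simp add: power2_eq_square mult_ac)
  finally have T: "fps_cong 2 T_theta (euler 6 * kappa)"
    by (rule fps_cong_cancel) (simp add: kappa_nth_0)
  have "fps_cong 2 (T_theta * euler 1 ^ 2 * euler 3) (T_theta * euler 2 * euler 3)"
    using euler_square_cong[of 1] by (intro fps_cong_mult fps_cong_refl) simp
  also have "fps_cong 2 \<dots> ((euler 6 * kappa) * euler 2 * euler 3)"
    by (intro fps_cong_mult fps_cong_refl T)
  also have "(euler 6 * kappa) * euler 2 * euler 3 = euler 6 ^ 2 * euler 1"
    using kappa_euler by (simp add: power2_eq_square mult_ac)
  also have "fps_cong 2 (euler 6 ^ 2 * euler 1) (euler 3 ^ 4 * euler 1)"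
    using euler_4th_cong[of 3] by (intro fps_cong_mult fps_cong_refl) (auto intro: fps_cong_sym fps_cong_4_imp_2)
  also have "euler 3 ^ 4 * euler 1 = euler 3 ^ 3 * (euler 1 * euler 3)" by (simp add: eval_nat_numeral mult_ac)
  finally have "fps_cong 2 (T_theta * euler 1 * (euler 1 * euler 3)) (euler 3 ^ 3 * (euler 1 * euler 3))"
    by (simp add: power2_eq_square mult_ac)
  then show ?thesis by (rule fps_cong_cancel) (simp add: euler_nth_0)
qed

text \<open>Both sides are E_2 E_3^3 modulo 2. In the class 24n + 22 this makes two summands equal,
  so that they cancel modulo 2.\<close>

lemma psi_T_theta_cong: "fps_cong 2 (psi * T_theta) ((psi oo fps_X ^ 3) * U_theta)"
proof -
  have "fps_cong 2 (psi * T_theta) (euler 1 ^ 3 * T_theta)"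
    by (intro fps_cong_mult psi_cong fps_cong_refl)
  also have "euler 1 ^ 3 * T_theta = euler 1 ^ 2 * (T_theta * euler 1)" by (simp add: eval_nat_numeral mult_ac)
  also have "fps_cong 2 \<dots> (euler 2 * euler 3 ^ 3)"
    using euler_square_cong[of 1] by (intro fps_cong_mult T_theta_cong) simp
  also have "euler 2 * euler 3 ^ 3 = (euler 1 ^ 3 oo fps_X ^ 3) * euler 2"
    by (simp add: fps_compose_power[symmetric] euler_compose mult.commute)
  also have "fps_cong 2 \<dots> ((psi oo fps_X ^ 3) * U_theta)"
    by (intro fps_cong_mult fps_cong_compose fps_cong_sym[OF psi_cong] fps_cong_sym[OF U_theta_cong]) simp
  finally show ?thesis .
qed

text \<open>Both sides are E_6^3 modulo 2: the left one is (T E_1)^2 by Frobenius. It gives the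
  final cancellation in the class 16n + 14.\<close>

lemma T_theta_U_theta_cong: "fps_cong 2 ((T_theta oo fps_X ^ 2) * U_theta) (psi oo fps_X ^ 6)"
proof -
  have "fps_cong 2 ((T_theta oo fps_X ^ 2) * U_theta) (T_theta ^ 2 * euler 1 ^ 2)"
    using fps_cong_sym[OF euler_square_cong[of 1]]
    by (intro fps_cong_mult fps_cong_sym[OF fps_square_cong] fps_cong_trans[OF U_theta_cong]) simp
  also have "T_theta ^ 2 * euler 1 ^ 2 = (T_theta * euler 1) ^ 2" by (simp add: power_mult_distrib)
  also have "fps_cong 2 \<dots> ((euler 3 ^ 3) ^ 2)"
    by (intro fps_cong_power T_theta_cong)
  also have "fps_cong 2 \<dots> (euler 3 ^ 3 oo fps_X ^ 2)"
    by (rule fps_square_cong)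
  also have "\<dots> = euler 1 ^ 3 oo fps_X ^ 6"
    by (simp add: fps_compose_power[symmetric] euler_compose)
  also have "fps_cong 2 \<dots> (psi oo fps_X ^ 6)"
    by (intro fps_cong_compose fps_cong_sym[OF psi_cong]) simp
  finally show ?thesis .
qed

text \<open>Odd coefficients of \<open>phi\<close> are even, and an even number agrees with its
  negative modulo 4.\<close>

lemma phi_minus_cong: "fps_cong 4 (phi oo - fps_X) phi"
  unfolding fps_cong_def
proof
  fix n
  show "[(phi oo - fps_X) $ n = phi $ n] (mod 4)"
  proof (cases "even n")
    case False
    then obtain k where n: "n = 2 * k + 1" by (elim oddE)
    have "phi $ n = dissect 2 1 phi $ k" by (simp add: n)
    also have "even \<dots>" unfolding dissect_theta_1_0 fps_two_mult_nth by simp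
    finally obtain m where "phi $ n = 2 * m" by (elim evenE)
    then show ?thesis using False by (simp add: fps_compose_uminus' cong_iff_dvd_diff)
  qed (simp add: fps_compose_uminus')
qed

lemma phi_cong: "fps_cong 2 phi 1"
proof -
  have "fps_cong 2 (phi * euler 2) ((phi oo - fps_X) * euler 2)"
    by (intro fps_cong_mult fps_cong_refl fps_cong_4_imp_2 fps_cong_sym[OF phi_minus_cong])
  also have "fps_cong 2 \<dots> (1 * euler 2)"
    unfolding phi_minus_euler using euler_square_cong[of 1] by simp
  finally show ?thesis by (rule fps_cong_cancel) (simp add: euler_nth_0)
qed

lemma compose_X_compose_X:
  fixes f :: "int fps"
  assumes "a > 0" "b > 0"
  shows "(f oo fps_X ^ a) oo fps_X ^ b = f oo fps_X ^ (b * a)"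
proof -
  have "(f oo fps_X ^ a) oo fps_X ^ b = f oo (fps_X ^ a oo fps_X ^ b)"
    using assms by (intro fps_compose_assoc[symmetric]) simp_all
  also have "fps_X ^ a oo fps_X ^ b = (fps_X ^ (b * a) :: int fps)"
    using assms by (simp add: fps_compose_power[symmetric] power_mult)
  finally show ?thesis .
qed

lemma dissect_2_mult_compose:
  fixes f g :: "int fps"
  shows "dissect 2 0 (f * (g oo fps_X ^ 2)) = dissect 2 0 f * g"
    and "dissect 2 1 (f * (g oo fps_X ^ 2)) = dissect 2 1 f * g"
  by (rule dissect_mult_compose; simp)+

text \<open>Tripling keeps parity, and 3 (2i + 1) = 2 (3i + 1) + 1 accounts for the extra factor
  \<open>fps_X\<close> in the odd part.\<close>

lemma dissect_2_compose_3:
  "dissect 2 0 (f oo fps_X ^ 3) = dissect 2 0 f oo fps_X ^ 3"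
  "dissect 2 1 (f oo fps_X ^ 3) = fps_X * (dissect 2 1 (f :: int fps) oo fps_X ^ 3)"
proof -
  define a b where "a = dissect 2 0 f" and "b = dissect 2 1 f"
  have "f oo fps_X ^ 3 = ((a oo fps_X ^ 2) + fps_X * (b oo fps_X ^ 2)) oo fps_X ^ 3"
    unfolding a_def b_def by (subst (1) dissect_2_decomp[of f]) (rule refl)
  also have "\<dots> = ((a oo fps_X ^ 3) oo fps_X ^ 2) + fps_X * ((fps_X * (b oo fps_X ^ 3)) oo fps_X ^ 2)"
  proof -
    have swap: "(g oo fps_X ^ 2) oo fps_X ^ 3 = (g oo fps_X ^ 3) oo (fps_X ^ 2 :: int fps)" for g
      by (simp only: compose_X_compose_X zero_less_numeral) simp
    have "fps_X oo fps_X ^ 3 = fps_X * (fps_X oo (fps_X ^ 2 :: int fps))"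
      by (simp add: eval_nat_numeral)
    moreover have "(fps_X * (b oo fps_X ^ 2)) oo fps_X ^ 3 = (fps_X oo fps_X ^ 3) * ((b oo fps_X ^ 2) oo fps_X ^ 3)"
      "(fps_X * (b oo fps_X ^ 3)) oo fps_X ^ 2 = (fps_X oo fps_X ^ 2) * ((b oo fps_X ^ 3) oo fps_X ^ 2)"
      by (rule fps_compose_mult_distrib; simp)+
    ultimately show ?thesis
      unfolding fps_compose_add_distrib swap by (simp only: swap mult.assoc)
  qed
  finally have *: "f oo fps_X ^ 3 = 1 * ((a oo fps_X ^ 3) oo fps_X ^ 2) + fps_X * ((fps_X * (b oo fps_X ^ 3)) oo fps_X ^ 2)"
    by (simp only: mult_1_left)
  have one: "dissect 2 0 (1 :: int fps) = 1" "dissect 2 1 (1 :: int fps) = 0"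
    "dissect 2 0 (fps_X :: int fps) = 0" "dissect 2 1 (fps_X :: int fps) = 1"
    by (auto simp: fps_eq_iff)
  show "dissect 2 0 (f oo fps_X ^ 3) = dissect 2 0 f oo fps_X ^ 3"
    "dissect 2 1 (f oo fps_X ^ 3) = fps_X * (dissect 2 1 f oo fps_X ^ 3)"
    unfolding * dissect_add dissect_2_mult_compose one a_def b_def by simp_all
qed

abbreviation phi3 :: "int fps" where "phi3 \<equiv> phi oo fps_X ^ 3"

lemma dissect_phi3:
  "dissect 2 0 phi3 = phi oo fps_X ^ 6"
  "dissect 2 1 phi3 = fps_X * (2 * (psi oo fps_X ^ 12))"
proof -
  have "(2 * (psi oo fps_X ^ 4)) oo fps_X ^ 3 = 2 * ((psi oo fps_X ^ 4) oo fps_X ^ 3)"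
    unfolding mult_2 by (rule fps_compose_add_distrib)
  then show "dissect 2 0 phi3 = phi oo fps_X ^ 6" "dissect 2 1 phi3 = fps_X * (2 * (psi oo fps_X ^ 12))"
    unfolding dissect_2_compose_3 dissect_theta_1_0 by (simp_all add: compose_X_compose_X)
qed

lemma phi3_euler: "fps_cong 4 (phi3 * euler 6) (euler 3 ^ 2)"
proof -
  have "((phi oo - fps_X) * euler 2) oo fps_X ^ 3 = euler 3 ^ 2"
    unfolding phi_minus_euler by (simp add: fps_compose_power[symmetric] euler_compose)
  then have "((phi oo - fps_X) oo fps_X ^ 3) * euler 6 = euler 3 ^ 2"
    by (simp add: fps_compose_mult_distrib euler_compose)
  moreover have "fps_cong 4 (phi3 * euler 6) (((phi oo - fps_X) oo fps_X ^ 3) * euler 6)"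
    by (intro fps_cong_mult fps_cong_refl fps_cong_compose fps_cong_sym[OF phi_minus_cong]) simp
  ultimately show ?thesis by simp
qed

text \<open>\<open>c_even\<close> is defined so that the generating function of the residue class 1 modulo 3 is the
  product of \<open>T_theta\<close> and an even series.\<close>

definition c_even :: "int fps" where
  "c_even = euler 3 ^ 2 * euler 2 * rinv (euler 1 ^ 2 * euler 6)"

text \<open>From E_1^4 = E_2^2 modulo 4, the quotient E_2 / E_1^2 becomes E_1^2 / E_2, which is
  \<open>phi\<close> at the negated variable; E_3^2 / E_6 is the same at X^3.\<close>

lemma c_even_cong: "fps_cong 4 c_even (phi * phi3)"
proof -
  define D where "D = euler 1 ^ 2 * euler 6"
  have D: "D $ 0 = 1" by (simp add: D_def euler_nth_0 unit_power)
  have "fps_cong 4 (phi * phi3 * D * euler 2) ((phi oo - fps_X) * phi3 * D * euler 2)"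
    by (intro fps_cong_mult fps_cong_refl fps_cong_sym[OF phi_minus_cong])
  also have "(phi oo - fps_X) * phi3 * D * euler 2 = ((phi oo - fps_X) * euler 2) * (phi3 * euler 6) * euler 1 ^ 2"
    by (simp only: D_def mult_ac)
  also have "\<dots> = euler 1 ^ 4 * (phi3 * euler 6)"
    unfolding phi_minus_euler by (simp add: eval_nat_numeral mult_ac)
  also have "fps_cong 4 \<dots> (euler 2 ^ 2 * euler 3 ^ 2)"
    using euler_4th_cong[of 1] by (intro fps_cong_mult phi3_euler) simp
  also have "euler 2 ^ 2 * euler 3 ^ 2 = euler 3 ^ 2 * euler 2 * euler 2 * (rinv D * D)"
    unfolding rinv_left[OF D] by (simp add: power2_eq_square mult_ac)
  also have "\<dots> = c_even * D * euler 2"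
    unfolding c_even_def D_def[symmetric] by (simp only: mult_ac)
  finally have "fps_cong 4 (phi * phi3 * (D * euler 2)) (c_even * (D * euler 2))"
    by (simp only: mult.assoc)
  then have "fps_cong 4 (phi * phi3) c_even"
    by (rule fps_cong_cancel) (simp add: D euler_nth_0)
  then show ?thesis by (rule fps_cong_sym)
qed

text \<open>Multiplying \<open>dissect_3_1_g_xi\<close> by \<open>T_theta\<close> replaces
  \<open>kappa\<close> by its value at X^2, which \<open>kappa_euler\<close> turns into an eta
  quotient.\<close>

lemma dissect_3_1_g_xi_theta: "dissect 3 1 g_xi = T_theta * (c_even oo fps_X ^ 2)"
proof -
  define A where "A = dissect 3 1 g_xi"
  define K2 where "K2 = kappa oo fps_X ^ 2"
  define D where "D = euler 2 ^ 2 * euler 12"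
  have D: "D $ 0 = 1" by (simp add: D_def euler_nth_0 unit_power)
  have nz: "euler 6 \<noteq> 0"
    using euler_nth_0[of 6] by auto
  have K2: "euler 2 * euler 12 = K2 * euler 4 * euler 6"
    using arg_cong[OF kappa_euler, of "\<lambda>f. f oo fps_X ^ 2"]
    by (simp add: K2_def fps_compose_mult_distrib euler_compose)
  have "A * euler 2 * (T_theta * kappa) = euler 6 ^ 2 * T_theta"
    using dissect_3_1_g_xi by (simp add: A_def mult_ac)
  then have "A * euler 2 * (euler 6 * K2) = euler 6 ^ 2 * T_theta"
    unfolding theta_3_2_kappa K2_def .
  then have "A * euler 2 * (K2 * euler 4 * euler 6) * euler 6 = (euler 6 ^ 2 * euler 4 * T_theta) * euler 6"
    by (simp add: mult_ac)
  then have "A * D = euler 6 ^ 2 * euler 4 * T_theta"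
    unfolding K2[symmetric] using nz by (simp add: D_def power2_eq_square mult_ac)
  then have "A * (D * rinv D) = T_theta * (euler 6 ^ 2 * euler 4 * rinv D)"
    by (simp only: mult_ac flip: mult.assoc[of A])
  moreover have "c_even oo fps_X ^ 2 = euler 6 ^ 2 * euler 4 * rinv D"
    unfolding c_even_def D_def
    by (simp add: fps_compose_mult_distrib rinv_compose fps_compose_power[symmetric] euler_compose
        euler_nth_0 unit_power)
  ultimately show ?thesis by (simp add: rinv_right[OF D] A_def)
qed

lemma fps_cong_0_nth: "fps_cong m f 0 \<Longrightarrow> [f $ n = 0] (mod m)"
  by (simp add: fps_cong_def)

lemma fps_cong_two_mult: "fps_cong 2 f 1 \<Longrightarrow> fps_cong 4 (2 * g * f) (2 * g)"
  using fps_cong_2_imp_4[OF fps_cong_mult[OF fps_cong_refl, of 2 f 1 g]] by (simp add: mult.assoc)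

text \<open>The index 8n + 4 calls for the even, even, odd parts. The even part of
  \<open>T_theta\<close> is \<open>U_theta\<close> at X^2. In the even part of
  \<open>phi * phi3\<close> the product of the two odd parts carries the factor 4, leaving a series
  in X^2; and \<open>U_theta\<close> has no odd exponents.\<close>

lemma g_xi_24_13: "[g_xi $ (24 * n + 13) = 0] (mod 4)"
proof -
  have even: "dissect 2 0 (dissect 3 1 g_xi) = (U_theta oo fps_X ^ 2) * c_even"
    unfolding dissect_3_1_g_xi_theta dissect_2_mult_compose dissect_theta_3_2 ..
  have "fps_cong 4 (dissect 2 0 c_even) (dissect 2 0 (phi * phi3))"
    by (intro fps_cong_dissect c_even_cong)
  also have "dissect 2 0 (phi * phi3) = ((phi * phi3) oo fps_X ^ 2) +
      fps_X * (2 * (psi oo fps_X ^ 4) * (fps_X * (2 * (psi oo fps_X ^ 12))))"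
    unfolding dissect_2_mult dissect_theta_1_0 dissect_phi3
    by (simp add: fps_compose_mult_distrib compose_X_compose_X)
  also have "\<dots> = ((phi * phi3) oo fps_X ^ 2) + 2 * (2 * (fps_X * (psi oo fps_X ^ 4) * fps_X * (psi oo fps_X ^ 12)))"
    by (simp only: mult_ac)
  also have "fps_cong 4 \<dots> (((phi * phi3) oo fps_X ^ 2) + 0)"
    by (intro fps_cong_add fps_cong_refl) (simp only: fps_cong_def fps_two_mult_nth cong_iff_dvd_diff, simp)
  finally have "fps_cong 4 (dissect 2 0 c_even) ((phi * phi3) oo fps_X ^ 2)" by simp
  then have "fps_cong 4 (U_theta * dissect 2 0 c_even) (U_theta * ((phi * phi3) oo fps_X ^ 2))"
    by (intro fps_cong_mult fps_cong_refl)
  then have "fps_cong 4 (dissect 2 1 (U_theta * dissect 2 0 c_even)) (dissect 2 1 (U_theta * ((phi * phi3) oo fps_X ^ 2)))"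
    by (rule fps_cong_dissect)
  moreover have "dissect 2 1 (U_theta * ((phi * phi3) oo fps_X ^ 2)) = 0"
    unfolding dissect_2_mult_compose dissect_theta_3_1 by simp
  moreover have "dissect 2 0 ((U_theta oo fps_X ^ 2) * c_even) = U_theta * dissect 2 0 c_even"
    using dissect_mult_compose[of 2 0 c_even U_theta] by (simp add: mult.commute)
  ultimately have "fps_cong 4 (dissect 2 1 (dissect 2 0 (dissect 2 0 (dissect 3 1 g_xi)))) 0"
    unfolding even by simp
  then have "[dissect 2 1 (dissect 2 0 (dissect 2 0 (dissect 3 1 g_xi))) $ n = 0] (mod 4)"
    by (rule fps_cong_0_nth)
  moreover have "dissect 2 1 (dissect 2 0 (dissect 2 0 (dissect 3 1 g_xi))) $ n = g_xi $ (24 * n + 13)"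
    by (simp add: add.commute)
  ultimately show ?thesis by simp
qed

lemma dissect_X_mult_compose:
  fixes f :: "int fps"
  shows "dissect 2 0 (fps_X * (f oo fps_X ^ 2)) = 0" and "dissect 2 1 (fps_X * (f oo fps_X ^ 2)) = f"
proof -
  have "dissect 2 0 (fps_X :: int fps) = 0" "dissect 2 1 (fps_X :: int fps) = 1"
    by (auto simp: fps_eq_iff)
  then show "dissect 2 0 (fps_X * (f oo fps_X ^ 2)) = 0" "dissect 2 1 (fps_X * (f oo fps_X ^ 2)) = f"
    unfolding dissect_2_mult_compose by simp_all
qed

lemma dissect_2_compose_2:
  fixes f :: "int fps"
  shows "dissect 2 0 (f oo fps_X ^ 2) = f" and "dissect 2 1 (f oo fps_X ^ 2) = 0"
proof -
  have "dissect 2 0 (1 :: int fps) = 1" "dissect 2 1 (1 :: int fps) = 0" by (auto simp: fps_eq_iff)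
  then show "dissect 2 0 (f oo fps_X ^ 2) = f" "dissect 2 1 (f oo fps_X ^ 2) = 0"
    using dissect_2_mult_compose[of 1 f] by simp_all
qed

lemma dissect_theta_3_2_square:
  "dissect 2 0 (T_theta * T_theta) = (U_theta oo fps_X ^ 2) ^ 2 + fps_X * (T_theta oo fps_X ^ 2) ^ 2"
  "dissect 2 1 (T_theta * T_theta) = 2 * ((U_theta oo fps_X ^ 2) * (T_theta oo fps_X ^ 2))"
  unfolding dissect_2_mult dissect_theta_3_2 by (simp_all add: power2_eq_square[of "_ oo _"] mult.commute)

text \<open>By Frobenius the left side is the parity decomposition of \<open>T_theta\<close>
  itself.\<close>

lemma T_theta_square_cong:
  "fps_cong 2 ((U_theta oo fps_X ^ 2) ^ 2 + fps_X * (T_theta oo fps_X ^ 2) ^ 2) T_theta"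
proof -
  have "fps_cong 2 ((U_theta oo fps_X ^ 2) ^ 2 + fps_X * (T_theta oo fps_X ^ 2) ^ 2)
      (((U_theta oo fps_X ^ 2) oo fps_X ^ 2) + fps_X * ((T_theta oo fps_X ^ 2) oo fps_X ^ 2))"
    by (intro fps_cong_add fps_cong_mult fps_cong_refl fps_square_cong)
  also have "\<dots> = T_theta"
    using dissect_2_decomp[of T_theta] unfolding dissect_theta_3_2 by (rule sym)
  finally show ?thesis .
qed

lemma phi_compose_cong: "k > 0 \<Longrightarrow> fps_cong 2 (phi oo fps_X ^ k) 1"
  using fps_cong_compose[OF phi_cong, of k] by simp

lemma fps_cong_2_double_0: "fps_cong 2 (f + f) 0"
  unfolding fps_cong_def mult_2[symmetric] fps_two_mult_nth by (simp add: cong_iff_dvd_diff)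

text \<open>The index 8n + 7 calls for the odd part three times. The odd part of
  \<open>phi * phi3\<close> is twice \<open>P\<close> modulo 4, as \<open>phi\<close> is 1 modulo 2.
  The odd part of \<open>P * T_theta\<close> consists of two summands that agree modulo 2 by
  \<open>psi_T_theta_cong\<close>.\<close>

lemma g_xi_24_22: "[g_xi $ (24 * n + 22) = 0] (mod 4)"
proof -
  define P where "P = (psi oo fps_X ^ 4) + fps_X * (psi oo fps_X ^ 12)"
  have odd: "dissect 2 1 (dissect 3 1 g_xi) = c_even * (T_theta oo fps_X ^ 2)"
    unfolding dissect_3_1_g_xi_theta dissect_2_mult_compose dissect_theta_3_2 by (rule mult.commute)
  have "fps_cong 4 (dissect 2 1 c_even) (dissect 2 1 (phi * phi3))"
    by (intro fps_cong_dissect c_even_cong)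
  also have "dissect 2 1 (phi * phi3) =
      2 * (fps_X * (psi oo fps_X ^ 12)) * (phi oo fps_X ^ 2) + 2 * (psi oo fps_X ^ 4) * (phi oo fps_X ^ 6)"
    unfolding dissect_2_mult dissect_theta_1_0 dissect_phi3 by (simp only: mult_ac)
  also have "fps_cong 4 \<dots> (2 * (fps_X * (psi oo fps_X ^ 12)) + 2 * (psi oo fps_X ^ 4))"
    by (intro fps_cong_add fps_cong_two_mult phi_compose_cong) simp_all
  also have "\<dots> = 2 * P" by (simp only: P_def distrib_left add.commute)
  finally have "fps_cong 4 (dissect 2 1 c_even * T_theta) (2 * P * T_theta)"
    by (intro fps_cong_mult fps_cong_refl)
  then have "fps_cong 4 (dissect 2 1 (dissect 2 1 c_even * T_theta)) (dissect 2 1 (2 * (P * T_theta)))"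
    unfolding mult.assoc by (rule fps_cong_dissect)
  also have "dissect 2 1 (2 * (P * T_theta)) = 2 * dissect 2 1 (P * T_theta)"
    unfolding mult_2 dissect_add ..
  also have "fps_cong 4 (2 * dissect 2 1 (P * T_theta)) (2 * 0)"
  proof (rule fps_cong_2_imp_4)
    have P: "P = ((psi oo fps_X ^ 2) oo fps_X ^ 2) + fps_X * ((psi oo fps_X ^ 6) oo fps_X ^ 2)"
      by (simp add: P_def compose_X_compose_X)
    have "dissect 2 0 P = psi oo fps_X ^ 2" "dissect 2 1 P = psi oo fps_X ^ 6"
      unfolding P dissect_add dissect_X_mult_compose dissect_2_compose_2 by simp_all
    then have "dissect 2 1 (P * T_theta) =
        (psi oo fps_X ^ 2) * (T_theta oo fps_X ^ 2) + (psi oo fps_X ^ 6) * (U_theta oo fps_X ^ 2)"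
      unfolding dissect_2_mult dissect_theta_3_2 by simp
    also have "\<dots> = (psi * T_theta oo fps_X ^ 2) + ((psi oo fps_X ^ 3) * U_theta oo fps_X ^ 2)"
      by (simp add: fps_compose_mult_distrib compose_X_compose_X)
    also have "fps_cong 2 \<dots> (((psi oo fps_X ^ 3) * U_theta oo fps_X ^ 2) + ((psi oo fps_X ^ 3) * U_theta oo fps_X ^ 2))"
      by (intro fps_cong_add fps_cong_refl fps_cong_compose psi_T_theta_cong) simp
    also have "fps_cong 2 \<dots> 0" by (rule fps_cong_2_double_0)
    finally show "fps_cong 2 (dissect 2 1 (P * T_theta)) 0" .
  qed
  finally have "fps_cong 4 (dissect 2 1 (dissect 2 1 (dissect 2 1 (dissect 3 1 g_xi)))) 0"
    unfolding odd dissect_2_mult_compose by simp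
  then have "[dissect 2 1 (dissect 2 1 (dissect 2 1 (dissect 3 1 g_xi))) $ n = 0] (mod 4)"
    by (rule fps_cong_0_nth)
  moreover have "dissect 2 1 (dissect 2 1 (dissect 2 1 (dissect 3 1 g_xi))) $ n = g_xi $ (24 * n + 22)"
    by (simp add: add.commute)
  ultimately show ?thesis by simp
qed

text \<open>The index 4n + 3 in the class 2 modulo 4 calls for the odd part twice. Up to the factor
  \<open>kappa\<close> at X^2 the generating function is \<open>T_theta ^ 2 * phi3\<close> modulo 4;
  its odd part is twice a series, so from there parities are enough.\<close>

lemma g_xi_16_14: "[g_xi $ (16 * n + 14) = 0] (mod 4)"
proof -
  define A K2 where "A = dissect 4 2 g_xi" and "K2 = kappa oo fps_X ^ 2"
  have nz: "euler 6 \<noteq> 0" using euler_nth_0[of 6] by auto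
  have K2: "T_theta * kappa = euler 6 * K2" unfolding K2_def by (rule theta_3_2_kappa)
  have "A * euler 3 ^ 2 * (T_theta * kappa) = T_theta * (A * euler 3 ^ 2 * kappa)" by (simp only: mult_ac)
  also have "\<dots> = T_theta * (T_theta * euler 6 ^ 2)" unfolding A_def dissect_4_2_g_xi ..
  finally have "euler 6 * (A * euler 3 ^ 2 * K2) = euler 6 * (T_theta * T_theta * euler 6)"
    unfolding K2 by (simp add: power2_eq_square mult_ac)
  then have A: "A * euler 3 ^ 2 * K2 = T_theta * T_theta * euler 6" using nz by simp
  have "fps_cong 4 (A * K2 * euler 6 ^ 2) (A * K2 * euler 3 ^ 4)"
    using fps_cong_sym[OF euler_4th_cong[of 3]] by (intro fps_cong_mult fps_cong_refl) simp
  also have "A * K2 * euler 3 ^ 4 = (A * euler 3 ^ 2 * K2) * euler 3 ^ 2" by (simp add: eval_nat_numeral mult_ac)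
  also have "\<dots> = T_theta * T_theta * euler 6 * euler 3 ^ 2" unfolding A ..
  also have "fps_cong 4 \<dots> (T_theta * T_theta * euler 6 * (phi3 * euler 6))"
    by (intro fps_cong_mult fps_cong_refl fps_cong_sym[OF phi3_euler])
  also have "\<dots> = T_theta * T_theta * phi3 * euler 6 ^ 2" by (simp only: power2_eq_square mult_ac)
  finally have "fps_cong 4 (A * K2) (T_theta * T_theta * phi3)"
    by (rule fps_cong_cancel) (simp add: unit_power euler_nth_0)
  then have "fps_cong 4 (dissect 2 1 (A * K2)) (dissect 2 1 (T_theta * T_theta * phi3))"
    by (rule fps_cong_dissect)
  also have "dissect 2 1 (T_theta * T_theta * phi3) =
      2 * (((U_theta oo fps_X ^ 2) ^ 2 + fps_X * (T_theta oo fps_X ^ 2) ^ 2) * (fps_X * (psi oo fps_X ^ 12)))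
      + 2 * ((U_theta oo fps_X ^ 2) * (T_theta oo fps_X ^ 2)) * (phi oo fps_X ^ 6)"
    unfolding dissect_2_mult[of "T_theta * T_theta"] dissect_theta_3_2_square dissect_phi3 by (simp only: mult_ac)
  also have "fps_cong 4 \<dots> (2 * (T_theta * (fps_X * (psi oo fps_X ^ 12))) +
      2 * ((U_theta oo fps_X ^ 2) * (T_theta oo fps_X ^ 2)))"
    by (intro fps_cong_add fps_cong_two_mult phi_compose_cong fps_cong_2_imp_4 fps_cong_mult fps_cong_refl
        T_theta_square_cong) simp
  \<comment> \<open>After one dissection \<open>kappa\<close> is no longer a series in X^2.
    Multiplying by \<open>T_theta\<close> repairs this, since the product is
    \<open>euler 3 * kappa\<close> at X^2, which the second dissection can pull out.\<close>
  finally have "fps_cong 4 (dissect 2 1 A * kappa * T_theta) ((2 * (T_theta * (fps_X * (psi oo fps_X ^ 12))) +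
      2 * ((U_theta oo fps_X ^ 2) * (T_theta oo fps_X ^ 2))) * T_theta)"
    unfolding K2_def dissect_2_mult_compose by (intro fps_cong_mult fps_cong_refl)
  also have "\<dots> = 2 * (T_theta ^ 2 * (fps_X * (psi oo fps_X ^ 12)) + (U_theta oo fps_X ^ 2) * (T_theta oo fps_X ^ 2) * T_theta)"
    by (simp add: power2_eq_square algebra_simps)
  also have "fps_cong 4 \<dots> (2 * ((T_theta oo fps_X ^ 2) * (fps_X * (psi oo fps_X ^ 12)) +
      (U_theta oo fps_X ^ 2) * (T_theta oo fps_X ^ 2) * T_theta))"
    by (intro fps_cong_2_imp_4 fps_cong_add fps_cong_mult fps_cong_refl fps_square_cong)
  also have "\<dots> = 2 * ((fps_X * (psi oo fps_X ^ 12) + T_theta * (U_theta oo fps_X ^ 2)) * (T_theta oo fps_X ^ 2))"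
    by (simp add: algebra_simps)
  finally have "fps_cong 4 (dissect 2 1 (dissect 2 1 A * kappa * T_theta))
      (dissect 2 1 (2 * ((fps_X * (psi oo fps_X ^ 12) + T_theta * (U_theta oo fps_X ^ 2)) * (T_theta oo fps_X ^ 2))))"
    by (rule fps_cong_dissect)
  also have "dissect 2 1 (2 * ((fps_X * (psi oo fps_X ^ 12) + T_theta * (U_theta oo fps_X ^ 2)) * (T_theta oo fps_X ^ 2)))
      = 2 * (((psi oo fps_X ^ 6) + (T_theta oo fps_X ^ 2) * U_theta) * T_theta)"
  proof -
    have "(psi oo fps_X ^ 12) = (psi oo fps_X ^ 6) oo fps_X ^ 2" by (simp add: compose_X_compose_X)
    then show ?thesis
      unfolding mult_2 dissect_add dissect_2_mult_compose dissect_theta_3_2 by (simp only: dissect_X_mult_compose)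
  qed
  also have "fps_cong 4 \<dots> (2 * (((psi oo fps_X ^ 6) + (psi oo fps_X ^ 6)) * T_theta))"
    by (intro fps_cong_2_imp_4 fps_cong_mult fps_cong_add fps_cong_refl T_theta_U_theta_cong)
  also have "fps_cong 4 \<dots> (2 * (0 * T_theta))"
    by (intro fps_cong_2_imp_4 fps_cong_mult fps_cong_refl fps_cong_2_double_0)
  also have "dissect 2 1 A * kappa * T_theta = dissect 2 1 A * ((euler 3 * kappa) oo fps_X ^ 2)"
    using K2 by (simp add: K2_def fps_compose_mult_distrib euler_compose mult_ac)
  finally have "fps_cong 4 (dissect 2 1 (dissect 2 1 A) * (euler 3 * kappa)) (0 * (euler 3 * kappa))"
    unfolding dissect_2_mult_compose by simp
  then have "fps_cong 4 (dissect 2 1 (dissect 2 1 A)) 0"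
    by (rule fps_cong_cancel) (simp add: euler_nth_0 kappa_nth_0)
  then have "[dissect 2 1 (dissect 2 1 A) $ n = 0] (mod 4)"
    by (rule fps_cong_0_nth)
  then show ?thesis by (simp add: A_def add.commute)
qed

lemma p_xi_eq: "k > 0 \<Longrightarrow> p_xi k = 2 * g_xi $ k"
  by (simp add: p_xi_def xi_def g_xi_def fps_two_mult_nth)

lemma cong_double: "[a = 0] (mod 4) \<Longrightarrow> [2 * a = 0] (mod 8)" for a :: int
  by (auto simp: cong_iff_dvd_diff)

theorem theorem5p4:
  fixes n :: nat
  shows "[p_xi (16 * n + 14) = 0] (mod 8) \<and>
         [p_xi (24 * n + 13) = 0] (mod 8) \<and>
         [p_xi (24 * n + 22) = 0] (mod 8)"
proof (intro conjI)
  show "[p_xi (16 * n + 14) = 0] (mod 8)"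
    using cong_double[OF g_xi_16_14] by (simp add: p_xi_eq)
  show "[p_xi (24 * n + 13) = 0] (mod 8)"
    using cong_double[OF g_xi_24_13] by (simp add: p_xi_eq)
  show "[p_xi (24 * n + 22) = 0] (mod 8)"
    using cong_double[OF g_xi_24_22] by (simp add: p_xi_eq)
qed

end
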